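(* Let $\mathcal{G}=\bigcup_{j=1}^k\mathcal{F}_j$, where $\mathcal{F}_j$, $j=1,\ldots,k$, are convex parameter spaces with $\mathcal{F}_i\cap\mathcal{F}_j\ne\varnothing$ for all $i,j$, and suppose $0<\alpha<\frac12$. Then $$\Big(\frac12-\alpha\Big)\,\omega\Big(\frac{z_\alpha}{\sqrt n},\mathcal{G}\Big)\ \le\ L^*_\alpha(\mathcal{G})\ \le\ 12\,\omega\Big(\frac{z_{\alpha/(2k)}}{\sqrt n},\mathcal{G}\Big).$$
   Context: Model. One observes, for a given $n$, either the white noise model $dY(t)=f(t)\,dt+n^{-1/2}\,dW(t)$, $-\frac12\le t\le\frac12$, with $W$ standard Brownian motion, or the Gaussian sequence model $Y(i)=f(i)+n^{-1/2}z_i$, $i\in\mathcal{M}$, with $z_i$ i.i.d. standard normal and $\mathcal{M}$ a finite or countably infinite index set. The result is for either model. $P_f,E_f$ denote probability and expectation when $f$ is the truth. $\|\cdot\|_2$ is the $L_2(-\frac12,\frac12)$ norm, respectively the $\ell_2(\mathcal{M})$ norm. A parameter space is a (nonempty) set of possible $f$, and $T$ is a linear functional. A confidence interval $CI$ is a data-dependent interval, with length $L(CI)$. $\mathcal{I}_{\alpha,\mathcal{G}}$ is the collection of all confidence intervals with $\inf_{f\in\mathcal{G}}P_f(Tf\in CI)\ge1-\alpha$. $L^*_\alpha(\mathcal{G})=\inf_{CI\in\mathcal{I}_{\alpha,\mathcal{G}}}\sup_{f\in\mathcal{G}}E_f(L(CI))$ is the minimax expected length. Modulus of continuity: $\omega(\varepsilon,\mathcal{G})=\sup\{Tg-Tf:\|g-f\|_2\le\varepsilon,\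 f,g\in\mathcal{G}\}$. $z_\alpha=\Phi^{-1}(1-\alpha)$, with $\Phi$ the standard normal distribution function. *)

theory Defs
  imports "HOL-Probability.Probability" "HOL-Library.Function_Algebras"
begin

text \<open>The pointwise vector space structure on real-valued functions, so that \<^const>\<open>convex\<close> and
  \<^const>\<open>subspace\<close> apply to sets of functions.\<close>

instantiation "fun" :: (type, real_vector) real_vector
begin

definition scaleR_fun :: "real \<Rightarrow> ('a \<Rightarrow> 'b) \<Rightarrow> 'a \<Rightarrow> 'b" where
  "scaleR_fun c f = (\<lambda>x. c *\<^sub>R f x)"

instance
  by standard (auto simp: scaleR_fun_def plus_fun_def fun_eq_iff scaleR_add_right scaleR_add_left)

end

definition linear_functional_on :: "'f::real_vector set \<Rightarrow> ('f \<Rightarrow> real) \<Rightarrow> bool" where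
  "linear_functional_on V T \<longleftrightarrow>
     subspace V \<and>
     (\<forall>f\<in>V. \<forall>g\<in>V. T (f + g) = T f + T g) \<and>
     (\<forall>c. \<forall>f\<in>V. T (c *\<^sub>R f) = c * T f)"

definition normal_quantile :: "real \<Rightarrow> real" where
  "normal_quantile a = inv (cdf std_normal_distribution) (1 - a)"

text \<open>An experiment is a family of laws \<open>P f\<close> on a common measurable sample space \<open>S\<close>.
  A data-dependent interval is a map from data to intervals whose graph is
  measurable; coverage events and the length are then measurable. All types of interval
  (open, closed, half-open, unbounded) are allowed, hence the length is an extended real.
  Empty intervals are harmless: replacing them by a point keeps the length and cannot lower the
  coverage.\<close>

definition random_interval :: "'y measure \<Rightarrow> ('y \<Rightarrow> real set) \<Rightarrow> bool" where
  "random_interval S CI \<longleftrightarrow>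
     (\<forall>y\<in>space S. is_interval (CI y)) \<and>
     {(y, t). y \<in> space S \<and> t \<in> CI y} \<in> sets (S \<Otimes>\<^sub>M borel)"

definition confidence_intervals ::
    "'y measure \<Rightarrow> ('f \<Rightarrow> 'y measure) \<Rightarrow> ('f \<Rightarrow> real) \<Rightarrow> real \<Rightarrow> 'f set \<Rightarrow> ('y \<Rightarrow> real set) set" where
  "confidence_intervals S P T \<alpha> G =
     {CI. random_interval S CI \<and> (INF f\<in>G. measure (P f) {y \<in> space S. T f \<in> CI y}) \<ge> 1 - \<alpha>}"

definition expected_length :: "'y measure \<Rightarrow> ('y \<Rightarrow> real set) \<Rightarrow> ennreal" where
  "expected_length Q CI = (\<integral>\<^sup>+ y. emeasure lborel (CI y) \<partial>Q)"

definition minimax_length ::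
    "'y measure \<Rightarrow> ('f \<Rightarrow> 'y measure) \<Rightarrow> ('f \<Rightarrow> real) \<Rightarrow> real \<Rightarrow> 'f set \<Rightarrow> ennreal" where
  "minimax_length S P T \<alpha> G =
     (INF CI\<in>confidence_intervals S P T \<alpha> G. SUP f\<in>G. expected_length (P f) CI)"

definition modulus ::
    "('f::real_vector \<Rightarrow> real) \<Rightarrow> ('f \<Rightarrow> real) \<Rightarrow> real \<Rightarrow> 'f set \<Rightarrow> ereal" where
  "modulus nrm T \<epsilon> G = Sup {ereal (T g - T f) | f g. f \<in> G \<and> g \<in> G \<and> nrm (g - f) \<le> \<epsilon>}"

abbreviation unit_window :: "real set" where
  "unit_window \<equiv> {-1/2..1/2}"

text \<open>Functions on the interval are represented by their extension by zero. They are not identified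
  up to null sets, so that functionals such as point evaluation are covered.\<close>

definition L2_funs :: "(real \<Rightarrow> real) set" where
  "L2_funs = {f. (\<forall>t. t \<notin> unit_window \<longrightarrow> f t = 0) \<and>
     f \<in> borel_measurable lebesgue \<and> integrable lebesgue (\<lambda>t. (f t)\<^sup>2)}"

definition L2_nrm :: "(real \<Rightarrow> real) \<Rightarrow> real" where
  "L2_nrm f = sqrt (LINT t:unit_window|lebesgue. (f t)\<^sup>2)"

text \<open>Standard Brownian motion indexed by the interval, started from zero at its left endpoint.\<close>

definition brownian_motion :: "'w measure \<Rightarrow> (real \<Rightarrow> 'w \<Rightarrow> real) \<Rightarrow> bool" where
  "brownian_motion \<Omega> W \<longleftrightarrow>
     prob_space \<Omega> \<and>
     (\<forall>t\<in>unit_window. W t \<in> borel_measurable \<Omega>) \<and>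
     (AE w in \<Omega>. W (-1/2) w = 0) \<and>
     (\<forall>s\<in>unit_window. \<forall>t\<in>unit_window. s < t \<longrightarrow>
        distributed \<Omega> lborel (\<lambda>w. W t w - W s w) (normal_density 0 (sqrt (t - s)))) \<and>
     (\<forall>m (t :: nat \<Rightarrow> real). mono_on {..m} t \<and> t ` {..m} \<subseteq> unit_window \<longrightarrow>
        prob_space.indep_vars \<Omega> (\<lambda>_. borel) (\<lambda>i w. W (t (Suc i)) w - W (t i) w) {..<m}) \<and>
     (AE w in \<Omega>. continuous_on unit_window (\<lambda>t. W t w))"

definition path_space :: "(real \<Rightarrow> real) measure" where
  "path_space = (\<Pi>\<^sub>M t\<in>unit_window. borel)"

text \<open>The law of the path \<open>Y\<close> with \<open>Y(-1/2) = 0\<close> solving the stochastic differential equation,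
  that is, of the integral of \<open>f\<close> up to \<open>t\<close> plus \<open>n\<close> to the power \<open>-1/2\<close> times \<open>W t\<close>.\<close>

definition white_noise_law ::
    "'w measure \<Rightarrow> (real \<Rightarrow> 'w \<Rightarrow> real) \<Rightarrow> nat \<Rightarrow> (real \<Rightarrow> real) \<Rightarrow> (real \<Rightarrow> real) measure" where
  "white_noise_law \<Omega> W n f =
     distr \<Omega> path_space
       (\<lambda>w. \<lambda>t\<in>unit_window. (LINT s:{-1/2..t}|lebesgue. f s) + W t w / sqrt (real n))"

text \<open>Sequences indexed by \<open>M\<close> are represented by their extension by zero.\<close>

definition l2_seqs :: "'i set \<Rightarrow> ('i \<Rightarrow> real) set" where
  "l2_seqs M = {f. (\<forall>i. i \<notin> M \<longrightarrow> f i = 0) \<and> (\<lambda>i. (f i)\<^sup>2) summable_on M}"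

definition l2_nrm :: "'i set \<Rightarrow> ('i \<Rightarrow> real) \<Rightarrow> real" where
  "l2_nrm M f = sqrt (\<Sum>\<^sub>\<infinity>i\<in>M. (f i)\<^sup>2)"

definition seq_space :: "'i set \<Rightarrow> ('i \<Rightarrow> real) measure" where
  "seq_space M = (\<Pi>\<^sub>M i\<in>M. borel)"

definition gaussian_seq_law :: "'i set \<Rightarrow> nat \<Rightarrow> ('i \<Rightarrow> real) \<Rightarrow> ('i \<Rightarrow> real) measure" where
  "gaussian_seq_law M n f =
     distr (\<Pi>\<^sub>M i\<in>M. std_normal_distribution) (seq_space M)
       (\<lambda>z. \<lambda>i\<in>M. f i + z i / sqrt (real n))"

end

theory Submission
  imports Defs
begin

text \<open>Lower bound: let \<open>f\<close>, \<open>g\<close> be at distance at most \<open>z\<^sub>\<alpha> / sqrt n\<close>. By Neyman--Pearson, an event of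
  probability at least \<open>1 - \<alpha>\<close> under \<open>g\<close> has probability at least \<open>Phi (z\<^sub>\<alpha> - z\<^sub>\<alpha>) = 1/2\<close> under \<open>f\<close>.
  Hence with probability at least \<open>1/2 - \<alpha>\<close> under \<open>f\<close> a confidence interval contains both \<open>T f\<close> and
  \<open>T g\<close>, and so the segment between them. In infinite dimensions the comparison is made for
  cylinder sets, which approximate all events.

  Upper bound: for a pair of convex sets \<open>F i\<close>, \<open>F j\<close>, the set of all \<open>(g - f, T g - T f)\<close> with
  \<open>f \<in> F i\<close>, \<open>g \<in> F j\<close> is convex and contains the origin. A hyperplane supporting it above the
  ball of radius \<open>z / sqrt n\<close>, with \<open>z = z\<^bsub>\<alpha> / (2 k)\<^esub>\<close>, yields an affine estimator of \<open>T\<close> that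
  overestimates on \<open>F i\<close> and underestimates on \<open>F j\<close> by at most the modulus, up to probability
  \<open>\<alpha> / (2 k)\<close>. The confidence bounds obtained from all pairs combine to an interval whose length is
  at most twice the modulus.\<close>

section \<open>The standard normal distribution\<close>

text \<open>The difficulty is that \<open>T\<close> may be unbounded and that the direction of a
  good estimator need not involve only finitely many data, so finite-dimensional arguments have to
  survive a limit. For the lower bound no density between infinite-dimensional laws is used:
  Neyman--Pearson is applied to finitely many coordinates only, where the shift has not grown. For
  the upper bound the slope of the hyperplane is given by a Cauchy sequence \<open>u\<close>, and
  its statistic by an almost sure limit that has to be one and the same measurable function under
  every \<open>P f\<close>. The half width comes from a balance. Let \<rho> be the limit of the
  norms of \<open>u\<close>, \<open>A\<close> the offset of the hyperplane and \<open>w\<close> the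
  modulus. Centring leaves a bias of at most \<open>A / 2\<close> on either side, the noise exceeds
  \<open>z * \<sigma> * \<rho>\<close> with probability at most \<open>1 - Phi z\<close>, and the
  hyperplane satisfies \<open>A / 2 + z * \<sigma> * \<rho> \<le> w\<close>. The level \<alpha> / (2
  k) is what a union bound over 2 k one-sided failures asks for. Both models enter through one
  locale, which records the few facts about Gaussian data that the two bounds rely on.\<close>

abbreviation "Phi \<equiv> cdf std_normal_distribution"

interpretation std_normal: real_distribution std_normal_distribution
  by (rule real_dist_normal_dist)

lemma measure_std_normal_singleton: "measure std_normal_distribution {x} = 0"
proof -
  have "AE t in lborel. t \<notin> {x}"
    by (rule AE_not_in) (simp add: null_sets_def)
  then have "AE t in lborel. t \<in> {x} \<longrightarrow> ennreal (std_normal_density t) = 0"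
    by eventually_elim auto
  then have "{x} \<in> null_sets std_normal_distribution"
    by (subst null_sets_density_iff) auto
  then show ?thesis
    by (simp add: measure_eq_0_null_sets)
qed

lemma isCont_Phi: "isCont Phi x"
  by (simp add: std_normal.isCont_cdf measure_std_normal_singleton)

text \<open>The density is positive everywhere, so an interval of mass zero would be Lebesgue null.
  Strictness later provides the gap \<open>Phi z - Phi c\<close> that pays for approximating
  events.\<close>

lemma Phi_strict_mono: "x < y \<Longrightarrow> Phi x < Phi y"
proof -
  assume xy: "x < y"
  have "Phi y - Phi x = measure std_normal_distribution {x<..y}"
    by (rule std_normal.cdf_diff_eq) (use xy in auto)
  moreover have "measure std_normal_distribution {x<..y} \<noteq> 0"
  proof
    assume "measure std_normal_distribution {x<..y} = 0"
    then have "{x<..y} \<in> null_sets std_normal_distribution"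
      by (auto simp: null_sets_def std_normal.emeasure_eq_measure)
    then have "AE t in lborel. t \<in> {x<..y} \<longrightarrow> std_normal_density t \<le> 0"
      by (subst (asm) null_sets_density_iff) auto
    then have "AE t in lborel. t \<notin> {x<..y}"
      by eventually_elim (metis less_le_not_le normal_density_pos zero_less_one)
    then have "emeasure lborel {x<..y} = 0"
      by (subst (asm) AE_iff_null_sets[symmetric]) auto
    with xy show False by simp
  qed
  ultimately show ?thesis
    using measure_nonneg[of std_normal_distribution "{x<..y}"] by linarith
qed

lemma Phi_mono: "x \<le> y \<Longrightarrow> Phi x \<le> Phi y"
  by (rule std_normal.cdf_nondecreasing)

lemma measure_std_normal_lessThan: "measure std_normal_distribution {..<c} = Phi c"
proof -
  have "Phi c = measure std_normal_distribution ({..<c} \<union> {c})"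
    by (auto simp: cdf_def intro!: arg_cong[where f="measure std_normal_distribution"])
  also have "\<dots> = measure std_normal_distribution {..<c} + measure std_normal_distribution {c}"
    by (rule std_normal.finite_measure_Union) auto
  finally show ?thesis by (simp add: measure_std_normal_singleton)
qed

lemma measure_std_normal_greaterThan: "measure std_normal_distribution {c<..} = 1 - Phi c"
proof -
  have "measure std_normal_distribution (space std_normal_distribution - {..c}) = 1 - Phi c"
    unfolding cdf_def by (rule std_normal.prob_compl) simp
  moreover have "space std_normal_distribution - {..c} = {c<..}" by auto
  ultimately show ?thesis by simp
qed

lemma distributed_id_std_normal: "distributed std_normal_distribution lborel (\<lambda>x. x) std_normal_density"
proof -
  have "distr std_normal_distribution lborel (\<lambda>x. x) = std_normal_distribution"
    by (rule distr_id2) simp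
  then show ?thesis by (simp add: distributed_def)
qed

text \<open>The law is invariant under negation and has no atom at 0, so the two half lines share
  the mass equally.\<close>

lemma Phi_0: "Phi 0 = 1/2"
proof -
  have "distributed std_normal_distribution lborel (\<lambda>x. 0 + (-1) * x) (normal_density (0 + (-1) * 0) (\<bar>-1\<bar> * 1))"
    by (rule std_normal.normal_density_affine[OF distributed_id_std_normal]) auto
  then have eq: "distr std_normal_distribution lborel (\<lambda>x. - x) = std_normal_distribution"
    by (simp add: distributed_def)
  have "Phi 0 = measure (distr std_normal_distribution lborel (\<lambda>x. - x)) {..0}"
    by (simp add: eq cdf_def)
  also have "\<dots> = measure std_normal_distribution {0..}"
    by (subst measure_distr) (auto intro!: arg_cong[where f="measure std_normal_distribution"])
  also have "{0..} = space std_normal_distribution - {..<(0::real)}" by auto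
  also have "measure std_normal_distribution \<dots> = 1 - Phi 0"
    by (subst std_normal.prob_compl) (auto simp: measure_std_normal_lessThan)
  finally show ?thesis by simp
qed

text \<open>As \<open>normal_quantile\<close> is an \<open>inv\<close>, it suffices that
  \<open>1 - a\<close> is attained by \<open>Phi\<close>, which the limits at both ends and the
  intermediate value theorem give.\<close>

lemma Phi_normal_quantile:
  assumes "0 < a" "a < 1"
  shows "Phi (normal_quantile a) = 1 - a"
proof -
  have "eventually (\<lambda>x. Phi x < 1 - a) at_bot" "eventually (\<lambda>x. Phi x > 1 - a) at_top"
    using order_tendstoD(2)[OF std_normal.cdf_lim_at_bot, of "1 - a"]
      order_tendstoD(1)[OF std_normal.cdf_lim_at_top_prob, of "1 - a"] assms by auto
  then obtain l u where lu: "Phi l < 1 - a" "Phi u > 1 - a"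
    by (meson eventually_at_bot_linorder eventually_at_top_linorder order_refl)
  then have "l \<le> u" using Phi_mono[of u l] by linarith
  then obtain x where "Phi x = 1 - a"
    using IVT[of Phi l "1 - a" u] lu isCont_Phi by auto
  then have "1 - a \<in> range Phi" by (metis rangeI)
  then show ?thesis
    unfolding normal_quantile_def by (rule f_inv_into_f)
qed

lemma normal_quantile_pos:
  assumes "0 < a" "a < 1/2"
  shows "0 < normal_quantile a"
proof (rule ccontr)
  assume "\<not> 0 < normal_quantile a"
  then have "Phi (normal_quantile a) \<le> Phi 0" by (intro Phi_mono) auto
  with assms Phi_normal_quantile[of a] Phi_0 show False by simp
qed

context prob_space begin

lemma prob_std_normal:
  assumes "distributed M lborel X std_normal_density" and "B \<in> sets borel"
  shows "prob {x \<in> space M. X x \<in> B} = measure std_normal_distribution B"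
proof -
  have X: "X \<in> measurable M lborel" and d: "distr M lborel X = std_normal_distribution"
    using assms by (auto simp: distributed_def)
  have "measure std_normal_distribution B = measure (distr M lborel X) B" by (simp add: d)
  also have "\<dots> = prob {x \<in> space M. X x \<in> B}"
    using X assms(2) by (subst measure_distr) (auto intro!: arg_cong[where f=prob])
  finally show ?thesis by simp
qed

lemma prob_std_normal_greater:
  assumes "distributed M lborel X std_normal_density"
  shows "prob {x \<in> space M. X x > c} = 1 - Phi c"
  using prob_std_normal[OF assms, of "{c<..}"] by (simp add: measure_std_normal_greaterThan)

lemma prob_std_normal_less:
  assumes "distributed M lborel X std_normal_density"
  shows "prob {x \<in> space M. X x < c} = Phi c"
  using prob_std_normal[OF assms, of "{..<c}"] by (simp add: measure_std_normal_lessThan)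

end

text \<open>Completing the square: the exponential factor is the likelihood ratio of the normal law
  with mean \<open>s\<close> to the standard one.\<close>

lemma std_normal_density_tilt:
  "std_normal_density x * exp (s * x - s\<^sup>2 / 2) = normal_density s 1 x"
proof -
  have "- (x\<^sup>2 / 2) + (s * x - s\<^sup>2 / 2) = - ((x - s)\<^sup>2 / 2)"
    by (simp add: power2_eq_square field_simps)
  then show ?thesis by (simp add: normal_density_def mult_exp_exp)
qed

lemma nn_integral_std_normal_tilt:
  assumes [measurable]: "B \<in> sets borel"
  shows "(\<integral>\<^sup>+x. ennreal (exp (s * x - s\<^sup>2 / 2)) * indicator B x \<partial>std_normal_distribution)
    = emeasure std_normal_distribution {x. x + s \<in> B}"
proof -
  have "distributed std_normal_distribution lborel (\<lambda>x. s + 1 * x) (normal_density (s + 1 * 0) (\<bar>1\<bar> * 1))"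
    by (rule std_normal.normal_density_affine[OF distributed_id_std_normal]) auto
  then have eq: "distr std_normal_distribution lborel (\<lambda>x. s + x) = density lborel (normal_density s 1)"
    by (simp add: distributed_def)
  have "(\<integral>\<^sup>+x. ennreal (exp (s * x - s\<^sup>2 / 2)) * indicator B x \<partial>std_normal_distribution)
    = (\<integral>\<^sup>+x. ennreal (normal_density s 1 x) * indicator B x \<partial>lborel)"
    by (subst nn_integral_density)
       (auto intro!: nn_integral_cong simp: mult.assoc[symmetric] std_normal_density_tilt simp flip: ennreal_mult)
  also have "\<dots> = emeasure (density lborel (normal_density s 1)) B"
    by (subst emeasure_density) auto
  also have "\<dots> = emeasure std_normal_distribution {x. x + s \<in> B}"
    unfolding eq[symmetric]
    by (subst emeasure_distr) (auto intro!: arg_cong[where f="emeasure std_normal_distribution"] simp: add.commute)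
  finally show ?thesis .
qed

text \<open>Neyman--Pearson: the likelihood ratio is increasing in \<open>X\<close>, so that the half space \<open>X < c\<close>
  is a likelihood ratio set.\<close>

lemma (in prob_space) neyman_pearson_tilt:
  assumes X: "distributed M lborel X std_normal_density" and "0 < s"
    and A[measurable]: "A \<in> sets M" and PA: "Phi c \<le> prob A"
  shows "Phi (c - s) \<le> measure (density M (\<lambda>x. ennreal (exp (s * X x - s\<^sup>2 / 2)))) A"
proof -
  define Q where "Q = density M (\<lambda>x. ennreal (exp (s * X x - s\<^sup>2 / 2)))"
  have Xm[measurable]: "X \<in> borel_measurable M"
    using X by (auto simp: distributed_def)
  have d: "distr M lborel X = std_normal_distribution"
    using X by (auto simp: distributed_def)
  have Q: "emeasure Q {x \<in> space M. X x \<in> B} = emeasure std_normal_distribution {x. x + s \<in> B}"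
    if [measurable]: "B \<in> sets borel" for B
  proof -
    have "emeasure Q {x \<in> space M. X x \<in> B}
      = (\<integral>\<^sup>+x. ennreal (exp (s * X x - s\<^sup>2 / 2)) * indicator B (X x) \<partial>M)"
      unfolding Q_def by (subst emeasure_density) (auto intro!: nn_integral_cong simp: indicator_def)
    also have "\<dots> = (\<integral>\<^sup>+x. ennreal (exp (s * x - s\<^sup>2 / 2)) * indicator B x \<partial>distr M lborel X)"
      by (subst nn_integral_distr) auto
    finally show ?thesis using nn_integral_std_normal_tilt[OF that] by (simp add: d)
  qed
  have "emeasure Q (space M) = 1"
    using Q[of UNIV] std_normal.emeasure_space_1 by simp
  then interpret Q: prob_space Q by (intro prob_spaceI) (simp add: Q_def)
  have sQ[measurable_cong]: "sets Q = sets M" by (simp add: Q_def)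
  define R where "R = {x \<in> space M. X x < c}"
  have R[measurable]: "R \<in> sets M" by (simp add: R_def)
  have QR: "measure Q R = Phi (c - s)"
  proof -
    have "{x. x + s \<in> {..<c}} = {..<c - s}" by auto
    then have "emeasure Q R = emeasure std_normal_distribution {..<c - s}"
      using Q[of "{..<c}"] unfolding R_def by simp
    then show ?thesis by (simp add: measure_def flip: measure_std_normal_lessThan)
  qed
  have PR: "prob R = Phi c" unfolding R_def by (rule prob_std_normal_less[OF X])
  \<comment> \<open>The likelihood ratio at the boundary \<open>X = c\<close>: since
    \<open>s\<close> is positive, the ratio is at most \<open>l\<close> on \<open>R\<close> and at
    least \<open>l\<close> off \<open>R\<close>.\<close>
  define l where "l = exp (s * c - s\<^sup>2 / 2)"
  have up: "measure Q (R - A) \<le> l * prob (R - A)"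
  proof -
    have "emeasure Q (R - A) = (\<integral>\<^sup>+x. ennreal (exp (s * X x - s\<^sup>2 / 2)) * indicator (R - A) x \<partial>M)"
      unfolding Q_def by (subst emeasure_density) auto
    also have "\<dots> \<le> (\<integral>\<^sup>+x. ennreal l * indicator (R - A) x \<partial>M)"
      using \<open>0 < s\<close> by (intro nn_integral_mono)
        (auto simp: indicator_def l_def R_def intro!: ennreal_leI)
    also have "\<dots> = ennreal (l * prob (R - A))"
      by (subst nn_integral_cmult_indicator) (auto simp: emeasure_eq_measure ennreal_mult l_def)
    finally show ?thesis by (simp add: Q.emeasure_eq_measure l_def)
  qed
  have low: "measure Q (A - R) \<ge> l * prob (A - R)"
  proof -
    have "ennreal (l * prob (A - R)) = (\<integral>\<^sup>+x. ennreal l * indicator (A - R) x \<partial>M)"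
      by (subst nn_integral_cmult_indicator) (auto simp: emeasure_eq_measure ennreal_mult l_def)
    also have "\<dots> \<le> (\<integral>\<^sup>+x. ennreal (exp (s * X x - s\<^sup>2 / 2)) * indicator (A - R) x \<partial>M)"
      using \<open>0 < s\<close> sets.sets_into_space[OF A] by (intro nn_integral_mono)
        (auto simp: indicator_def l_def R_def intro!: ennreal_leI)
    also have "\<dots> = emeasure Q (A - R)"
      unfolding Q_def by (subst emeasure_density) auto
    finally show ?thesis by (simp add: Q.emeasure_eq_measure)
  qed
  \<comment> \<open>\<open>R\<close> has mass \<open>Phi c\<close>, which is at most the mass of
    \<open>A\<close>; removing the common part \<open>A \<inter> R\<close> preserves the
    order.\<close>
  have "prob (R - A) \<le> prob (A - R)"
    using finite_measure_Diff'[OF R A] finite_measure_Diff'[OF A R] PA PR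
    by (simp add: Int_commute)
  then have "l * prob (R - A) \<le> l * prob (A - R)" by (simp add: l_def)
  then have "measure Q (R - A) \<le> measure Q (A - R)" using up low by linarith
  then have "measure Q R \<le> measure Q A"
    using Q.finite_measure_Diff'[of R A] Q.finite_measure_Diff'[of A R]
    by (simp add: Int_commute sQ)
  then show ?thesis by (simp add: QR flip: Q_def)
qed

section \<open>Finite Gaussian vectors\<close>

context prob_space begin

lemma distributed_std_normal_sum:
  assumes I: "finite I" and ind: "indep_vars (\<lambda>_. borel) X I"
    and X: "\<And>i. i \<in> I \<Longrightarrow> distributed M lborel (X i) std_normal_density"
    and pos: "0 < (\<Sum>i\<in>I. (c i)\<^sup>2)"
  shows "distributed M lborel (\<lambda>x. (\<Sum>i\<in>I. c i * X i x) / sqrt (\<Sum>i\<in>I. (c i)\<^sup>2)) std_normal_density"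
proof -
  \<comment> \<open>Vanishing coefficients are dropped, because a normal summand must have positive
    standard deviation.\<close>
  define J where "J = {i \<in> I. c i \<noteq> 0}"
  have sJ: "(\<Sum>i\<in>J. f i) = (\<Sum>i\<in>I. f i)" if "\<And>i. c i = 0 \<Longrightarrow> f i = 0" for f :: "_ \<Rightarrow> real"
    unfolding J_def using I that by (intro sum.mono_neutral_left) auto
  have "J \<noteq> {}"
    using pos sJ[of "\<lambda>i. (c i)\<^sup>2"] by auto
  then have J: "finite J" "J \<noteq> {}" "J \<subseteq> I"
    using I by (auto simp: J_def)
  have "distributed M lborel (\<lambda>x. \<Sum>i\<in>J. c i * X i x) (normal_density (\<Sum>i\<in>J. 0) (sqrt (\<Sum>i\<in>J. \<bar>c i\<bar>\<^sup>2)))"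
  proof (rule sum_indep_normal)
    show "indep_vars (\<lambda>_. borel) (\<lambda>i x. c i * X i x) J"
      using indep_vars_compose2[OF indep_vars_subset[OF ind J(3)], of "\<lambda>i x. c i * x" "\<lambda>_. borel"] by simp
    fix i assume i: "i \<in> J"
    then show "0 < \<bar>c i\<bar>" by (simp add: J_def)
    have "distributed M lborel (\<lambda>x. 0 + c i * X i x) (normal_density (0 + c i * 0) (\<bar>c i\<bar> * 1))"
      using i J X by (intro normal_density_affine) (auto simp: J_def)
    then show "distributed M lborel (\<lambda>x. c i * X i x) (normal_density 0 \<bar>c i\<bar>)" by simp
  qed (use J in auto)
  then have "distributed M lborel (\<lambda>x. \<Sum>i\<in>I. c i * X i x) (normal_density 0 (sqrt (\<Sum>i\<in>I. (c i)\<^sup>2)))"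
    using sJ[of "\<lambda>i. (c i)\<^sup>2"] sJ[of "\<lambda>i. c i * X i x" for x] by simp
  then show ?thesis
    using normal_standard_normal_convert[of "sqrt (\<Sum>i\<in>I. (c i)\<^sup>2)" "\<lambda>x. \<Sum>i\<in>I. c i * X i x" 0] pos
    by simp
qed

lemma prob_gauss_sum_greater:
  assumes I: "finite I" and ind: "indep_vars (\<lambda>_. borel) X I"
    and X: "\<And>i. i \<in> I \<Longrightarrow> distributed M lborel (X i) std_normal_density"
    and "0 \<le> z" and v: "v = (\<Sum>i\<in>I. (c i)\<^sup>2)"
  shows "prob {x \<in> space M. (\<Sum>i\<in>I. c i * X i x) > z * sqrt v} \<le> 1 - Phi z"
proof (cases "v = 0")
  case True
  then have "\<And>i. i \<in> I \<Longrightarrow> c i = 0"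
    using I v by (simp add: sum_nonneg_eq_0_iff)
  \<comment> \<open>With variance 0 the sum is identically 0 and cannot strictly exceed the
    threshold 0.\<close>
  then have "{x \<in> space M. (\<Sum>i\<in>I. c i * X i x) > z * sqrt v} = {}"
    using True by simp
  then show ?thesis using std_normal.cdf_bounded_prob[of z]
    by (metis diff_ge_0_iff_ge measure_empty)
next
  case False
  then have pos: "0 < (\<Sum>i\<in>I. (c i)\<^sup>2)"
    using v sum_nonneg[of I "\<lambda>i. (c i)\<^sup>2"] by simp
  have "{x \<in> space M. (\<Sum>i\<in>I. c i * X i x) > z * sqrt v}
    = {x \<in> space M. (\<Sum>i\<in>I. c i * X i x) / sqrt (\<Sum>i\<in>I. (c i)\<^sup>2) > z}"
    using pos unfolding v by (auto simp: pos_less_divide_eq)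
  then show ?thesis
    using prob_std_normal_greater[OF distributed_std_normal_sum[OF I ind X pos], of z] by simp
qed

end

text \<open>The Cameron--Martin formula in finite dimension. The exponential factorises over the
  coordinates, so both the tilted measure and the law of the shifted vector agree on boxes with the
  product of the shifted normal laws.\<close>

lemma emeasure_PiM_std_normal_shift:
  fixes a :: "'i \<Rightarrow> real"
  assumes I: "finite I" and C: "C \<in> sets (\<Pi>\<^sub>M i\<in>I. (borel::real measure))"
  shows "emeasure (density (\<Pi>\<^sub>M i\<in>I. std_normal_distribution)
       (\<lambda>x. ennreal (exp ((\<Sum>i\<in>I. a i * x i) - (\<Sum>i\<in>I. (a i)\<^sup>2) / 2)))) C
    = emeasure (\<Pi>\<^sub>M i\<in>I. std_normal_distribution)
       {x \<in> space (\<Pi>\<^sub>M i\<in>I. std_normal_distribution). (\<lambda>i\<in>I. a i + x i) \<in> C}"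
proof -
  let ?P = "\<Pi>\<^sub>M i\<in>I. std_normal_distribution"
  let ?B = "\<Pi>\<^sub>M i\<in>I. (borel :: real measure)"
  let ?N = "\<lambda>i. distr std_normal_distribution borel (\<lambda>x. a i + x)"
  let ?e = "\<lambda>x. ennreal (exp ((\<Sum>i\<in>I. a i * x i) - (\<Sum>i\<in>I. (a i)\<^sup>2) / 2))"
  have N: "prob_space (?N i)" for i by (rule std_normal.prob_space_distr) simp
  interpret S: product_sigma_finite "\<lambda>_::'i. std_normal_distribution"
    by standard
  interpret N: product_sigma_finite ?N
    using N by (auto simp: product_sigma_finite_def intro!: prob_space_imp_sigma_finite)
  have sP: "sets ?P = sets ?B" by (intro sets_PiM_cong) auto
  have sN: "sets (PiM I ?N) = sets ?B" by (intro sets_PiM_cong) auto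
  have m[measurable]: "(\<lambda>x. \<lambda>i\<in>I. a i + x i) \<in> measurable ?P ?B" by measurable
  have me[measurable]: "?e \<in> borel_measurable ?P" by measurable
  have "density ?P ?e = PiM I ?N"
  proof (rule N.PiM_eqI[OF I])
    fix A assume "\<And>i. i \<in> I \<Longrightarrow> A i \<in> sets (?N i)"
    then have A[measurable]: "\<And>i. i \<in> I \<Longrightarrow> A i \<in> sets borel" by simp
    have "Pi\<^sub>E I A \<in> sets ?P" using I A by (simp add: sP sets_PiM_I_finite)
    then have "emeasure (density ?P ?e) (Pi\<^sub>E I A) = (\<integral>\<^sup>+x. ?e x * indicator (Pi\<^sub>E I A) x \<partial>?P)"
      by (subst emeasure_density) auto
    also have "\<dots> = (\<integral>\<^sup>+x. (\<Prod>i\<in>I. ennreal (exp (a i * x i - (a i)\<^sup>2 / 2)) * indicator (A i) (x i)) \<partial>?P)"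
    proof (intro nn_integral_cong)
      fix x assume x: "x \<in> space ?P"
      have "indicator (Pi\<^sub>E I A) x = (\<Prod>i\<in>I. indicator (A i) (x i) :: ennreal)"
        using x I by (auto simp: indicator_def space_PiM PiE_iff prod_zero_iff)
      moreover have "?e x = (\<Prod>i\<in>I. ennreal (exp (a i * x i - (a i)\<^sup>2 / 2)))"
        using I by (simp add: prod_ennreal exp_sum[symmetric] sum_subtractf sum_divide_distrib)
      ultimately show "?e x * indicator (Pi\<^sub>E I A) x =
          (\<Prod>i\<in>I. ennreal (exp (a i * x i - (a i)\<^sup>2 / 2)) * indicator (A i) (x i))"
        by (simp add: prod.distrib)
    qed
    also have "\<dots> = (\<Prod>i\<in>I. \<integral>\<^sup>+x. ennreal (exp (a i * x - (a i)\<^sup>2 / 2)) * indicator (A i) x \<partial>std_normal_distribution)"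
      using I A by (subst S.product_nn_integral_prod) auto
    also have "\<dots> = (\<Prod>i\<in>I. emeasure (?N i) (A i))"
    proof (intro prod.cong refl)
      fix i assume i: "i \<in> I"
      have "emeasure (?N i) (A i) = emeasure std_normal_distribution {x. x + a i \<in> A i}"
        using A[OF i] by (subst emeasure_distr)
          (auto intro!: arg_cong[where f="emeasure std_normal_distribution"] simp: add.commute)
      then show "(\<integral>\<^sup>+x. ennreal (exp (a i * x - (a i)\<^sup>2 / 2)) * indicator (A i) x \<partial>std_normal_distribution)
          = emeasure (?N i) (A i)"
        using nn_integral_std_normal_tilt[OF A[OF i], of "a i"] by simp
    qed
    finally show "emeasure (density ?P ?e) (Pi\<^sub>E I A) = (\<Prod>i\<in>I. emeasure (?N i) (A i))" .
  qed (simp add: sP sN)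
  \<comment> \<open>Uniqueness of the product measure is used a second time, now for the law of the
    shifted vector.\<close>
  also have "PiM I ?N = distr ?P ?B (\<lambda>x. \<lambda>i\<in>I. a i + x i)"
  proof (rule N.PiM_eqI[OF I, symmetric])
    fix A assume "\<And>i. i \<in> I \<Longrightarrow> A i \<in> sets (?N i)"
    then have A[measurable]: "\<And>i. i \<in> I \<Longrightarrow> A i \<in> sets borel" by simp
    have "Pi\<^sub>E I A \<in> sets ?B" using I A by (simp add: sets_PiM_I_finite)
    then have "emeasure (distr ?P ?B (\<lambda>x. \<lambda>i\<in>I. a i + x i)) (Pi\<^sub>E I A)
      = emeasure ?P ((\<lambda>x. \<lambda>i\<in>I. a i + x i) -` Pi\<^sub>E I A \<inter> space ?P)"
      by (subst emeasure_distr) auto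
    also have "(\<lambda>x. \<lambda>i\<in>I. a i + x i) -` Pi\<^sub>E I A \<inter> space ?P = Pi\<^sub>E I (\<lambda>i. {x. a i + x \<in> A i})"
      by (auto simp: space_PiM PiE_iff)
    also have "emeasure ?P \<dots> = (\<Prod>i\<in>I. emeasure std_normal_distribution {x. a i + x \<in> A i})"
      using I A by (intro S.emeasure_PiM) auto
    also have "\<dots> = (\<Prod>i\<in>I. emeasure (?N i) (A i))"
      using A by (intro prod.cong refl, subst emeasure_distr)
          (auto intro!: arg_cong[where f="emeasure std_normal_distribution"])
    finally show "emeasure (distr ?P ?B (\<lambda>x. \<lambda>i\<in>I. a i + x i)) (Pi\<^sub>E I A) = (\<Prod>i\<in>I. emeasure (?N i) (A i))" .
  qed (simp add: sN)
  finally show ?thesis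
    using C by (simp add: emeasure_distr vimage_def Int_def conj_commute)
qed

text \<open>The likelihood ratio of the two means depends on the data only through the normalised
  component along the shift \<open>d - b\<close>, which is standard normal. This reduces the claim
  to \<open>neyman_pearson_tilt\<close> with \<open>s\<close> the length of the shift. Equal means
  are treated apart, since both the normalisation and the tilt need a positive length.\<close>

lemma (in prob_space) gauss_shift_prob:
  fixes b d :: "'i \<Rightarrow> real"
  assumes I: "finite I" and ind: "indep_vars (\<lambda>_. borel) X I"
    and X: "\<And>i. i \<in> I \<Longrightarrow> distributed M lborel (X i) std_normal_density"
    and B[measurable]: "B \<in> sets (\<Pi>\<^sub>M i\<in>I. (borel::real measure))"
    and z: "0 \<le> z" "(\<Sum>i\<in>I. (d i - b i)\<^sup>2) \<le> z\<^sup>2"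
    and c: "Phi c \<le> prob {x \<in> space M. (\<lambda>i\<in>I. b i + X i x) \<in> B}"
  shows "Phi (c - z) \<le> prob {x \<in> space M. (\<lambda>i\<in>I. d i + X i x) \<in> B}"
proof (cases "(\<Sum>i\<in>I. (d i - b i)\<^sup>2) = 0")
  case True
  then have "\<And>i. i \<in> I \<Longrightarrow> d i = b i" using I by (simp add: sum_nonneg_eq_0_iff)
  then have "(\<lambda>i\<in>I. d i + X i x) = (\<lambda>i\<in>I. b i + X i x)" for x by auto
  with c show ?thesis using Phi_mono[of "c - z" c] z by simp
next
  case False
  define a where "a i = d i - b i" for i
  define v where "v = (\<Sum>i\<in>I. (a i)\<^sup>2)"
  have v: "0 < v" using False sum_nonneg[of I "\<lambda>i. (a i)\<^sup>2"] by (simp add: v_def a_def less_le)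
  have ne: "I \<noteq> {}" using False by auto
  let ?P = "\<Pi>\<^sub>M i\<in>I. std_normal_distribution"
  let ?Bo = "\<Pi>\<^sub>M i\<in>I. (borel :: real measure)"
  define e where "e x = ennreal (exp ((\<Sum>i\<in>I. a i * x i) - v / 2))" for x :: "'i \<Rightarrow> real"
  define Z where "Z x = (\<lambda>i\<in>I. X i x)" for x
  have sP[measurable_cong]: "sets ?P = sets ?Bo" by (intro sets_PiM_cong) auto
  have Xm[measurable]: "\<And>i. i \<in> I \<Longrightarrow> X i \<in> borel_measurable M"
    using X by (auto simp: distributed_def)
  have Zm[measurable]: "Z \<in> measurable M ?Bo" unfolding Z_def by measurable
  have Zm'[measurable]: "Z \<in> measurable M ?P" using Zm by measurable
  have em[measurable]: "e \<in> borel_measurable ?Bo" unfolding e_def by measurable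
  have em'[measurable]: "e \<in> borel_measurable ?P" using em by measurable
  have dX: "distr M borel (X i) = std_normal_distribution" if "i \<in> I" for i
    using X[OF that] by (auto simp: distributed_def cong: distr_cong)
  have "distr M ?Bo Z = (\<Pi>\<^sub>M i\<in>I. distr M borel (X i))"
    unfolding Z_def using ind indep_vars_iff_distr_eq_PiM'[OF ne, where M'="\<lambda>_. borel" and X=X] Xm by simp
  also have "\<dots> = ?P" by (intro PiM_cong dX refl)
  finally have dZ: "distr M ?Bo Z = ?P" .
  \<comment> \<open>The mean \<open>b\<close> is absorbed into the event, so that the reference law
    is centred and only the difference \<open>a\<close> of the means remains.\<close>
  define C where "C = {x \<in> space ?Bo. (\<lambda>i\<in>I. b i + x i) \<in> B}"
  have C[measurable]: "C \<in> sets ?Bo" unfolding C_def by measurable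
  have Zs: "Z x \<in> space ?Bo" for x by (simp add: Z_def space_PiM)
  \<comment> \<open>Puts the exponent of \<open>e (Z x)\<close> into the form of the one-dimensional
    tilt with \<open>s = sqrt v\<close>.\<close>
  have s: "sqrt v * ((\<Sum>i\<in>I. a i * X i x) / sqrt v) - (sqrt v)\<^sup>2 / 2 = (\<Sum>i\<in>I. a i * Z x i) - v / 2" for x
    using v by (simp add: Z_def)
  let ?Q = "density M (\<lambda>x. e (Z x))"
  have "Phi (c - z) \<le> Phi (c - sqrt v)"
    using z by (intro Phi_mono) (auto simp: v_def a_def real_le_lsqrt)
  also have "\<dots> \<le> measure ?Q {x \<in> space M. Z x \<in> C}"
  proof -
    have "Phi c \<le> prob {x \<in> space M. Z x \<in> C}"
      using c by (simp add: C_def Zs) (simp add: Z_def cong: restrict_cong)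
    from neyman_pearson_tilt[OF distributed_std_normal_sum[OF I ind X, of a] _ _ this, of "sqrt v"]
    show ?thesis using v unfolding v_def[symmetric] s e_def[symmetric] by simp
  qed
  also have "\<dots> = prob {x \<in> space M. (\<lambda>i\<in>I. d i + X i x) \<in> B}"
  proof -
    have "emeasure ?Q {x \<in> space M. Z x \<in> C} = (\<integral>\<^sup>+x. e (Z x) * indicator C (Z x) \<partial>M)"
      by (subst emeasure_density) (auto intro!: nn_integral_cong simp: indicator_def)
    also have "\<dots> = (\<integral>\<^sup>+x. e x * indicator C x \<partial>distr M ?Bo Z)"
      by (subst nn_integral_distr) auto
    also have "\<dots> = emeasure (density ?P e) C"
      unfolding dZ by (subst emeasure_density) auto
    also have "\<dots> = emeasure ?P {x \<in> space ?P. (\<lambda>i\<in>I. a i + x i) \<in> C}"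
      using emeasure_PiM_std_normal_shift[OF I C, of a] unfolding e_def v_def .
    also have "\<dots> = emeasure (distr M ?Bo Z) {x \<in> space ?Bo. (\<lambda>i\<in>I. a i + x i) \<in> C}"
      unfolding dZ by (simp add: sets_eq_imp_space_eq[OF sP])
    also have "\<dots> = emeasure M {x \<in> space M. (\<lambda>i\<in>I. a i + Z x i) \<in> C}"
      by (subst emeasure_distr) (auto intro!: arg_cong[where f="emeasure M"] simp: Zs)
    also have "{x \<in> space M. (\<lambda>i\<in>I. a i + Z x i) \<in> C} = {x \<in> space M. (\<lambda>i\<in>I. d i + X i x) \<in> B}"
    proof -
      have "(\<lambda>i\<in>I. b i + (\<lambda>i\<in>I. a i + Z x i) i) = (\<lambda>i\<in>I. d i + X i x)" for x
        by (auto simp: a_def Z_def)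
      then show ?thesis by (auto simp: C_def space_PiM)
    qed
    finally show ?thesis by (simp add: measure_def)
  qed
  finally show ?thesis .
qed

section \<open>The lower bound\<close>

text \<open>Events approximable from the algebra are closed under complements and countable unions.
  It matters that one \<open>B\<close> serves both measures: a comparison between \<open>P\<close>
  and \<open>Q\<close> is to be carried over through \<open>B\<close>.\<close>

lemma sigma_algebra_approx:
  assumes alg: "algebra \<Omega> \<A>" and P: "finite_measure P" and Q: "finite_measure Q"
    and sP: "sets P = sigma_sets \<Omega> \<A>" and sQ: "sets Q = sigma_sets \<Omega> \<A>"
    and A: "A \<in> sigma_sets \<Omega> \<A>" and "0 < e"
  shows "\<exists>B\<in>\<A>. measure P (sym_diff A B) < e \<and> measure Q (sym_diff A B) < e"
  using A \<open>0 < e\<close>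
proof (induction A arbitrary: e)
  interpret algebra \<Omega> \<A> by fact
  interpret P: finite_measure P by fact
  interpret Q: finite_measure Q by fact
  have \<A>: "\<A> \<subseteq> sets P" "\<A> \<subseteq> sets Q" by (auto simp: sP sQ)
  {
    case (Basic A)
    then show ?case by (intro bexI[of _ A]) auto
  next
    case Empty
    then show ?case by (intro bexI[of _ "{}"]) auto
  next
    case (Compl A)
    then obtain B where B: "B \<in> \<A>" "measure P (sym_diff A B) < e" "measure Q (sym_diff A B) < e"
      by blast
    have "A \<subseteq> \<Omega>" "B \<subseteq> \<Omega>"
      using sigma_sets_into_sp[OF space_closed Compl(1)] sets_into_space[OF B(1)] by auto
    then have "sym_diff (\<Omega> - A) (\<Omega> - B) = sym_diff A B" by auto
    with B show ?case by (intro bexI[of _ "\<Omega> - B"]) auto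
  next
    case (Union A)
    define U where "U = (\<Union>i. A i)"
    define V where "V n = (\<Union>i<n. A i)" for n
    have AP: "A i \<in> sets P" "A i \<in> sets Q" for i using Union by (auto simp: sP sQ)
    have UV: "U \<in> sets P" "U \<in> sets Q" "V n \<in> sets P" "V n \<in> sets Q" for n
      using AP by (auto simp: U_def V_def)
    have "(\<lambda>n. measure P (V n)) \<longlonglongrightarrow> measure P (\<Union>n. V n)" "(\<lambda>n. measure Q (V n)) \<longlonglongrightarrow> measure Q (\<Union>n. V n)"
      using UV by (intro P.finite_Lim_measure_incseq Q.finite_Lim_measure_incseq; fastforce simp: incseq_def V_def)+
    moreover have "(\<Union>n. V n) = U" by (auto simp: U_def V_def)
    ultimately have "(\<lambda>n. measure P (V n)) \<longlonglongrightarrow> measure P U" "(\<lambda>n. measure Q (V n)) \<longlonglongrightarrow> measure Q U"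
      by auto
    then have "\<forall>\<^sub>F n in sequentially. measure P (V n) > measure P U - e/2"
       "\<forall>\<^sub>F n in sequentially. measure Q (V n) > measure Q U - e/2"
      using \<open>0 < e\<close> by (auto dest!: order_tendstoD(1)[where a="_ - e/2"])
    then obtain n where n: "measure P (V n) > measure P U - e/2" "measure Q (V n) > measure Q U - e/2"
      by (metis (mono_tags, lifting) eventually_conj eventually_sequentially order_refl)
    \<comment> \<open>Half of \<open>e\<close> is spent on truncating the union at \<open>n\<close>,
      the other half on approximating the \<open>n\<close> remaining sets, at cost \<open>r\<close>
      each.\<close>
    define r where "r = e / (2 * (real n + 1))"
    have "0 < r" using \<open>0 < e\<close> by (simp add: r_def)
    then have "\<forall>i. \<exists>B\<in>\<A>. measure P (sym_diff (A i) B) < r \<and> measure Q (sym_diff (A i) B) < r"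
      using Union.IH by blast
    then obtain B where B: "\<And>i. B i \<in> \<A>" "\<And>i. measure P (sym_diff (A i) (B i)) < r"
      "\<And>i. measure Q (sym_diff (A i) (B i)) < r"
      by metis
    define D where "D = (\<Union>i<n. B i)"
    have D: "D \<in> \<A>" unfolding D_def using B by (intro finite_UN) auto
    have nr: "real n * r \<le> e / 2" using \<open>0 < e\<close> by (simp add: r_def field_simps)
    have bound: "measure M (sym_diff U D) < e"
      if M: "finite_measure M" "sets M = sigma_sets \<Omega> \<A>" "measure M (V n) > measure M U - e/2"
        and Br: "\<And>i. measure M (sym_diff (A i) (B i)) < r" for M
    proof -
      interpret M: finite_measure M by fact
      have s: "A i \<in> sets M" "B i \<in> sets M" "U \<in> sets M" "V n \<in> sets M" for i
        using B Union UV by (auto simp: M(2) sP)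
      have "measure M (sym_diff U D) \<le> measure M ((U - V n) \<union> (\<Union>i<n. sym_diff (A i) (B i)))"
        using s by (intro M.finite_measure_mono) (auto simp: U_def V_def D_def)
      also have "\<dots> \<le> measure M (U - V n) + measure M (\<Union>i<n. sym_diff (A i) (B i))"
        using s by (intro measure_Un_le) auto
      also have "measure M (\<Union>i<n. sym_diff (A i) (B i)) \<le> (\<Sum>i<n. measure M (sym_diff (A i) (B i)))"
        using s by (intro measure_UNION_le) auto
      also have "\<dots> \<le> (\<Sum>i<n. r)" by (intro sum_mono) (use Br in \<open>auto intro: less_imp_le\<close>)
      also have "measure M (U - V n) = measure M U - measure M (V n)"
        using s by (intro M.finite_measure_Diff) (auto simp: U_def V_def)
      finally show ?thesis using nr M(3) by simp
    qed
    show ?case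
      using D bound[OF P sP n(1) B(2)] bound[OF Q sQ n(2) B(3)] by (auto simp: U_def)
  }
qed

text \<open>An approximating set may fall slightly short of the level \<open>Phi z\<close>, so the
  comparison is made at each \<open>c < z\<close>, and continuity of \<open>Phi\<close> removes the
  loss as \<open>c\<close> tends to \<open>z\<close>.\<close>

lemma prob_ge_half_of_algebra:
  assumes alg: "algebra \<Omega> \<A>" and P: "prob_space P" and Q: "prob_space Q"
    and sP: "sets P = sigma_sets \<Omega> \<A>" and sQ: "sets Q = sigma_sets \<Omega> \<A>"
    and np: "\<And>A c. A \<in> \<A> \<Longrightarrow> Phi c \<le> measure P A \<Longrightarrow> Phi (c - z) \<le> measure Q A"
    and A: "A \<in> sets P" "Phi z \<le> measure P A"
  shows "1/2 \<le> measure Q A"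
proof -
  interpret P: prob_space P by fact
  interpret Q: prob_space Q by fact
  have close: "\<bar>measure M A - measure M B\<bar> \<le> measure M (sym_diff A B)"
    if "prob_space M" "A \<in> sets M" "B \<in> sets M" for M :: "'a measure" and A B
  proof -
    interpret M: prob_space M by fact
    have "measure M (sym_diff A B) = measure M (A - B) + measure M (B - A)"
      using that by (intro M.finite_measure_Union) auto
    moreover have "measure M (A - B) = measure M A - measure M (A \<inter> B)"
      "measure M (B - A) = measure M B - measure M (A \<inter> B)"
      using that M.finite_measure_Diff'[of A B] M.finite_measure_Diff'[of B A] by (auto simp: Int_commute)
    ultimately show ?thesis
      using measure_nonneg[of M "A - B"] measure_nonneg[of M "B - A"] by linarith
  qed
  have less: "Phi (c - z) \<le> measure Q A" if c: "c < z" for c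
  proof (rule field_le_epsilon)
    fix e :: real assume "0 < e"
    \<comment> \<open>The gap \<open>Phi z - Phi c\<close> keeps \<open>B\<close> above level
      \<open>Phi c\<close> under \<open>P\<close>; the bound \<open>e\<close> controls the way back
      from \<open>B\<close> to \<open>A\<close> under \<open>Q\<close>.\<close>
    define r where "r = min e (Phi z - Phi c)"
    have "0 < r" using \<open>0 < e\<close> Phi_strict_mono[OF c] by (simp add: r_def)
    then obtain B where B: "B \<in> \<A>" "measure P (sym_diff A B) < r" "measure Q (sym_diff A B) < r"
      using sigma_algebra_approx[OF alg P.finite_measure_axioms Q.finite_measure_axioms sP sQ, of A r] A sP by auto
    have s: "A \<in> sets P" "B \<in> sets P" "A \<in> sets Q" "B \<in> sets Q" using A B by (auto simp: sP sQ)
    have "Phi c \<le> measure P B"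
      using close[OF P s(1,2)] B(2) A(2) unfolding r_def min_less_iff_conj abs_le_iff by linarith
    then have "Phi (c - z) \<le> measure Q B" using np B by blast
    then show "Phi (c - z) \<le> measure Q A + e"
      using close[OF Q s(3,4)] B(3) unfolding r_def min_less_iff_conj abs_le_iff by linarith
  qed
  have "((\<lambda>c. Phi (c - z)) \<longlongrightarrow> Phi (z - z)) (at_left z)"
    by (intro isCont_tendsto_compose[OF isCont_Phi] tendsto_intros)
  then have "Phi 0 \<le> measure Q A"
    by (intro tendsto_upperbound[where F="at_left z" and f="\<lambda>c. Phi (c - z)"])
      (use less in \<open>auto simp: eventually_at_left_field intro!: exI[of _ "z - 1"]\<close>)
  then show ?thesis by (simp add: Phi_0)
qed

section \<open>Expected length from the coverage of two values\<close>

lemma random_interval_section: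
  assumes "random_interval S CI"
  shows "{y \<in> space S. t \<in> CI y} \<in> sets S"
proof -
  have "(\<lambda>y. (y, t)) \<in> measurable S (S \<Otimes>\<^sub>M borel)" by simp
  then have "(\<lambda>y. (y, t)) -` {(y, t). y \<in> space S \<and> t \<in> CI y} \<inter> space S \<in> sets S"
    by (rule measurable_sets) (use assms in \<open>simp add: random_interval_def\<close>)
  also have "(\<lambda>y. (y, t)) -` {(y, t). y \<in> space S \<and> t \<in> CI y} \<inter> space S = {y \<in> space S. t \<in> CI y}"
    by auto
  finally show ?thesis .
qed

lemma expected_length_ge:
  assumes CI: "random_interval S CI" and Q: "prob_space Q" and sQ: "sets Q = sets S"
    and a: "1/2 \<le> measure Q {y \<in> space S. a \<in> CI y}"
    and b: "1 - \<alpha> \<le> measure Q {y \<in> space S. b \<in> CI y}" and \<alpha>: "\<alpha> < 1/2"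
  shows "ennreal ((1/2 - \<alpha>) * (a - b)) \<le> expected_length Q CI"
proof (cases "(1/2 - \<alpha>) * (a - b) \<le> 0")
  case True
  then show ?thesis by (simp add: ennreal_neg)
next
  case False
  interpret Q: prob_space Q by fact
  have sp: "space Q = space S" using sQ by (rule sets_eq_imp_space_eq)
  define A where "A = {y \<in> space S. a \<in> CI y}"
  define B where "B = {y \<in> space S. b \<in> CI y}"
  have AB: "A \<in> sets Q" "B \<in> sets Q"
    using random_interval_section[OF CI] by (auto simp: A_def B_def sQ)
  have "measure Q (A \<union> B) = measure Q A + measure Q (B - A)"
    using AB Q.finite_measure_Union[of A "B - A"] by simp
  moreover have "measure Q (B - A) = measure Q B - measure Q (A \<inter> B)"
    using Q.finite_measure_Diff'[OF AB(2,1)] by (simp add: Int_commute)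
  \<comment> \<open>Inclusion-exclusion: 1/2 + (1 - \<alpha>) - 1.\<close>
  ultimately have "1/2 - \<alpha> \<le> measure Q (A \<inter> B)"
    using Q.prob_le_1[of "A \<union> B"] a b unfolding A_def[symmetric] B_def[symmetric] by linarith
  then have "(1/2 - \<alpha>) * (a - b) \<le> measure Q (A \<inter> B) * \<bar>a - b\<bar>"
    using False \<alpha> by (intro mult_mono) (auto simp: mult_le_0_iff)
  then have "ennreal ((1/2 - \<alpha>) * (a - b)) \<le> ennreal (\<bar>a - b\<bar> * measure Q (A \<inter> B))"
    by (intro ennreal_leI) (simp add: mult.commute)
  also have "\<dots> = (\<integral>\<^sup>+y. ennreal \<bar>a - b\<bar> * indicator (A \<inter> B) y \<partial>Q)"
    using AB by (subst nn_integral_cmult_indicator) (auto simp: Q.emeasure_eq_measure ennreal_mult)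
  also have "\<dots> \<le> expected_length Q CI"
    unfolding expected_length_def
  proof (intro nn_integral_mono)
    fix y assume y: "y \<in> space Q"
    show "ennreal \<bar>a - b\<bar> * indicator (A \<inter> B) y \<le> emeasure lborel (CI y)"
    proof (cases "y \<in> A \<inter> B")
      case True
      have int: "is_interval (CI y)" using CI y by (simp add: random_interval_def sp)
      then have cs: "closed_segment a b \<subseteq> CI y"
        using True by (intro closed_segment_subset) (auto simp: A_def B_def is_interval_convex_1)
      have m: "CI y \<in> sets lborel" using int by (simp add: real_interval_borel_measurable)
      have "ennreal \<bar>a - b\<bar> = emeasure lborel (closed_segment a b)"
        by (auto simp: closed_segment_eq_real_ivl)
      also have "\<dots> \<le> emeasure lborel (CI y)"
        using cs m by (intro emeasure_mono) auto
      finally show ?thesis using True by simp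
    qed simp
  qed
  finally show ?thesis .
qed

text \<open>The assumption \<open>half\<close> is the testing bound left to the model: coverage of
  \<open>T g\<close> under \<open>P g\<close> becomes coverage with probability 1/2 under
  \<open>P f\<close>. Together with the coverage of \<open>T f\<close> under the same
  \<open>P f\<close> it feeds \<open>expected_length_ge\<close>.\<close>

lemma minimax_length_ge:
  fixes T :: "'f::real_vector \<Rightarrow> real"
  assumes P: "\<And>f. f \<in> G \<Longrightarrow> prob_space (P f)" "\<And>f. f \<in> G \<Longrightarrow> sets (P f) = sets S"
    and half: "\<And>f g A. f \<in> G \<Longrightarrow> g \<in> G \<Longrightarrow> nrm (g - f) \<le> \<epsilon> \<Longrightarrow> A \<in> sets S \<Longrightarrow>
      1 - \<alpha> \<le> measure (P g) A \<Longrightarrow> 1/2 \<le> measure (P f) A"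
    and \<alpha>: "\<alpha> < 1/2"
  shows "ereal (1/2 - \<alpha>) * modulus nrm T \<epsilon> G \<le> enn2ereal (minimax_length S P T \<alpha> G)"
proof -
  let ?L = "minimax_length S P T \<alpha> G"
  have pair: "ennreal ((1/2 - \<alpha>) * (T g - T f)) \<le> ?L"
    if fg: "f \<in> G" "g \<in> G" "nrm (g - f) \<le> \<epsilon>" for f g
    unfolding minimax_length_def
  proof (rule INF_greatest)
    fix CI assume "CI \<in> confidence_intervals S P T \<alpha> G"
    then have CI: "random_interval S CI"
      and cov: "(INF f\<in>G. measure (P f) {y \<in> space S. T f \<in> CI y}) \<ge> 1 - \<alpha>"
      by (auto simp: confidence_intervals_def)
    have cov: "1 - \<alpha> \<le> measure (P f) {y \<in> space S. T f \<in> CI y}" if "f \<in> G" for f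
      using cov by (rule order_trans) (use that in \<open>auto intro!: cINF_lower bdd_belowI[of _ 0]\<close>)
    have "1/2 \<le> measure (P f) {y \<in> space S. T g \<in> CI y}"
      by (rule half[OF fg random_interval_section[OF CI] cov[OF fg(2)]])
    then have "ennreal ((1/2 - \<alpha>) * (T g - T f)) \<le> expected_length (P f) CI"
      using cov[OF fg(1)] \<alpha> by (intro expected_length_ge[OF CI P]) (use fg in auto)
    also have "\<dots> \<le> (SUP f\<in>G. expected_length (P f) CI)"
      using fg by (intro SUP_upper) auto
    finally show "ennreal ((1/2 - \<alpha>) * (T g - T f)) \<le> (SUP f\<in>G. expected_length (P f) CI)" .
  qed
  \<comment> \<open>Dividing by the positive constant allows the supremum to be bounded term by
    term, including the case of an infinite modulus.\<close>
  have "modulus nrm T \<epsilon> G \<le> enn2ereal ?L / ereal (1/2 - \<alpha>)"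
    unfolding modulus_def
  proof (rule Sup_least, safe)
    fix f g assume fg: "f \<in> G" "g \<in> G" "nrm (g - f) \<le> \<epsilon>"
    have "ereal ((1/2 - \<alpha>) * (T g - T f)) \<le> enn2ereal (ennreal ((1/2 - \<alpha>) * (T g - T f)))"
      by (simp add: ennreal.rep_eq)
    also have "\<dots> \<le> enn2ereal ?L" using pair[OF fg] by (simp add: less_eq_ennreal.rep_eq)
    finally show "ereal (T g - T f) \<le> enn2ereal ?L / ereal (1/2 - \<alpha>)"
      using \<alpha> by (subst ereal_le_divide_pos) auto
  qed
  then show ?thesis using \<alpha> by (subst (asm) ereal_le_divide_pos) auto
qed

section \<open>Supporting functionals in semi-inner product spaces\<close>

text \<open>Definiteness is not demanded, as functions equal almost everywhere are kept distinct.
  The laws are asked for on \<open>H\<close> only, because sums and integrals that do not converge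
  take default values.\<close>

locale semi_inner =
  fixes H :: "'f::real_vector set" and ip :: "'f \<Rightarrow> 'f \<Rightarrow> real"
  assumes H: "subspace H"
    and ip_commute: "f \<in> H \<Longrightarrow> g \<in> H \<Longrightarrow> ip f g = ip g f"
    and ip_add_left: "f \<in> H \<Longrightarrow> g \<in> H \<Longrightarrow> h \<in> H \<Longrightarrow> ip (f + g) h = ip f h + ip g h"
    and ip_scale_left: "f \<in> H \<Longrightarrow> h \<in> H \<Longrightarrow> ip (c *\<^sub>R f) h = c * ip f h"
    and ip_nonneg: "f \<in> H \<Longrightarrow> 0 \<le> ip f f"
begin

definition nm :: "'f \<Rightarrow> real" where "nm f = sqrt (ip f f)"

lemma H_closed [simp, intro]:
  "0 \<in> H" "f \<in> H \<Longrightarrow> g \<in> H \<Longrightarrow> f + g \<in> H" "f \<in> H \<Longrightarrow> g \<in> H \<Longrightarrow> f - g \<in> H" "f \<in> H \<Longrightarrow> c *\<^sub>R f \<in> H"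
  using H by (auto simp: subspace_0 subspace_add subspace_diff subspace_scale)

lemma ip_diff_left: "f \<in> H \<Longrightarrow> g \<in> H \<Longrightarrow> h \<in> H \<Longrightarrow> ip (f - g) h = ip f h - ip g h"
  using ip_add_left[of f "(-1) *\<^sub>R g" h] ip_scale_left[of g h "-1"] H_closed(4)[of g "-1"] by simp

lemma ip_add_right: "f \<in> H \<Longrightarrow> g \<in> H \<Longrightarrow> h \<in> H \<Longrightarrow> ip h (f + g) = ip h f + ip h g"
  by (simp add: ip_commute[of h] ip_add_left)

lemma ip_diff_right: "f \<in> H \<Longrightarrow> g \<in> H \<Longrightarrow> h \<in> H \<Longrightarrow> ip h (f - g) = ip h f - ip h g"
  by (simp add: ip_commute[of h] ip_diff_left)

lemma ip_scale_right: "f \<in> H \<Longrightarrow> h \<in> H \<Longrightarrow> ip h (c *\<^sub>R f) = c * ip h f"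
  by (simp add: ip_commute[of h] ip_scale_left)

lemmas ip_simps = ip_add_left ip_add_right ip_diff_left ip_diff_right ip_scale_left ip_scale_right

lemma ip_zero_left [simp]: "h \<in> H \<Longrightarrow> ip 0 h = 0"
  using ip_scale_left[of 0 h 0] by simp

lemma nm_sq: "f \<in> H \<Longrightarrow> (nm f)\<^sup>2 = ip f f"
  by (simp add: nm_def ip_nonneg)

lemma nm_nonneg [simp]: "f \<in> H \<Longrightarrow> 0 \<le> nm f"
  by (simp add: nm_def ip_nonneg)

lemma nm_zero [simp]: "nm 0 = 0"
  by (simp add: nm_def)

lemma Cauchy_Schwarz: assumes f: "f \<in> H" and g: "g \<in> H" shows "\<bar>ip f g\<bar> \<le> nm f * nm g"
proof -
  have q: "0 \<le> ip f f - 2 * t * ip f g + t\<^sup>2 * ip g g" for t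
    using ip_nonneg[of "f - t *\<^sub>R g"] f g
    by (simp add: ip_simps ip_commute[of g f] power2_eq_square algebra_simps)
  have "(ip f g)\<^sup>2 \<le> ip f f * ip g g"
  proof (cases "ip g g = 0")
    case True
    have "ip f g = 0"
    proof (rule ccontr)
      assume "ip f g \<noteq> 0"
      \<comment> \<open>For \<open>ip g g = 0\<close> the quadratic \<open>q\<close> is affine in
        \<open>t\<close>; this \<open>t\<close> makes it equal to -1.\<close>
      then show False using q[of "(ip f f + 1) / (2 * ip f g)"] True by simp
    qed
    then show ?thesis using True by simp
  next
    case False
    then have "0 < ip g g" using ip_nonneg[OF g] by simp
    moreover have "0 \<le> ip f f - (ip f g)\<^sup>2 / ip g g"
      using q[of "ip f g / ip g g"] False by (simp add: power2_eq_square field_simps)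
    ultimately show ?thesis by (simp add: field_simps)
  qed
  then have "sqrt ((ip f g)\<^sup>2) \<le> sqrt (ip f f * ip g g)" by (rule real_sqrt_le_mono)
  then show ?thesis by (simp add: nm_def real_sqrt_mult)
qed

lemma nm_scale: "f \<in> H \<Longrightarrow> nm (c *\<^sub>R f) = \<bar>c\<bar> * nm f"
  by (simp add: nm_def ip_simps real_sqrt_mult flip: mult.assoc)

lemma nm_triangle: assumes f: "f \<in> H" and g: "g \<in> H" shows "nm (f + g) \<le> nm f + nm g"
proof (rule power2_le_imp_le)
  show "(nm (f + g))\<^sup>2 \<le> (nm f + nm g)\<^sup>2"
    using Cauchy_Schwarz[OF f g] f g
    by (simp add: nm_sq power2_sum ip_simps ip_commute[of g f] abs_le_iff)
qed (use f g in simp)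

lemma nm_minus: "f \<in> H \<Longrightarrow> g \<in> H \<Longrightarrow> nm (f - g) = nm (g - f)"
  using nm_scale[of "f - g" "-1"] by simp

lemma nm_triangle_diff: "f \<in> H \<Longrightarrow> g \<in> H \<Longrightarrow> h \<in> H \<Longrightarrow> nm (f - h) \<le> nm (f - g) + nm (g - h)"
  using nm_triangle[of "f - g" "g - h"] by simp

lemma nm_diff_le: "f \<in> H \<Longrightarrow> g \<in> H \<Longrightarrow> \<bar>nm f - nm g\<bar> \<le> nm (f - g)"
  using nm_triangle[of "f - g" g] nm_triangle[of "g - f" f] nm_minus[of f g] by (simp add: abs_le_iff)

text \<open>Such a sequence stands for an element of the completion of \<open>H\<close>, which is
  seen only through the limits of its norms and inner products.\<close>

definition nm_Cauchy :: "(nat \<Rightarrow> 'f) \<Rightarrow> bool" where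
  "nm_Cauchy u \<longleftrightarrow> (\<forall>e>0. \<exists>N. \<forall>m\<ge>N. \<forall>k\<ge>N. nm (u m - u k) < e)"

lemma nm_Cauchy_convergent_nm:
  assumes u: "\<And>m. u m \<in> H" and c: "nm_Cauchy u"
  shows "convergent (\<lambda>m. nm (u m))"
  unfolding Cauchy_convergent_iff[symmetric] Cauchy_def dist_real_def
  using c nm_diff_le[OF u u] unfolding nm_Cauchy_def by (meson le_less_trans)

lemma nm_Cauchy_convergent_ip:
  assumes u: "\<And>m. u m \<in> H" and c: "nm_Cauchy u" and h: "h \<in> H"
  shows "(\<lambda>m. ip (u m) h) \<longlonglongrightarrow> lim (\<lambda>m. ip (u m) h)"
proof -
  have "Cauchy (\<lambda>m. ip (u m) h)"
    unfolding Cauchy_def dist_real_def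
  proof (intro allI impI)
    fix e :: real assume "0 < e"
    then have "0 < e / (nm h + 1)" using h by (simp add: add_nonneg_pos)
    then obtain N where N: "\<And>m k. m \<ge> N \<Longrightarrow> k \<ge> N \<Longrightarrow> nm (u m - u k) < e / (nm h + 1)"
      using c unfolding nm_Cauchy_def by meson
    show "\<exists>N. \<forall>m\<ge>N. \<forall>k\<ge>N. \<bar>ip (u m) h - ip (u k) h\<bar> < e"
    proof (intro exI allI impI)
      fix m k assume mk: "N \<le> m" "N \<le> k"
      have "\<bar>ip (u m) h - ip (u k) h\<bar> \<le> nm (u m - u k) * nm h"
        using Cauchy_Schwarz[of "u m - u k" h] u h by (simp add: ip_diff_left)
      also have "\<dots> \<le> nm (u m - u k) * (nm h + 1)"
        using u h by (intro mult_left_mono) auto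
      also have "\<dots> < e"
        using N[OF mk] h by (simp add: pos_less_divide_eq add_nonneg_pos)
      finally show "\<bar>ip (u m) h - ip (u k) h\<bar> < e" .
    qed
  qed
  then show ?thesis by (simp add: Cauchy_convergent_iff convergent_LIMSEQ_iff)
qed

text \<open>The limit of \<open>ip (u m)\<close> plays the role of the hyperplane that separates \<open>D\<close> from the
  points above \<open>w\<close> over the ball of radius \<open>\<epsilon>\<close>. As \<open>H\<close> need not be complete, it is obtained from a
  sequence minimising \<open>\<kappa> / 2 * (nm h)\<^sup>2 - t\<close> over \<open>D\<close>; by strong convexity this sequence is Cauchy.\<close>

lemma supporting_functional:
  assumes DH: "\<And>h t. (h, t) \<in> D \<Longrightarrow> h \<in> H" and D0: "(0, 0) \<in> D"
    and conv: "\<And>h t h' t' s. (h, t) \<in> D \<Longrightarrow> (h', t') \<in> D \<Longrightarrow> 0 \<le> s \<Longrightarrow> s \<le> 1 \<Longrightarrow>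
      (h + s *\<^sub>R (h' - h), t + s * (t' - t)) \<in> D"
    and \<epsilon>: "0 < \<epsilon>" and w: "\<And>h t. (h, t) \<in> D \<Longrightarrow> nm h \<le> \<epsilon> \<Longrightarrow> t \<le> w"
  obtains u A \<rho> where "\<And>m. u m \<in> H" "nm_Cauchy u" "(\<lambda>m. nm (u m)) \<longlonglongrightarrow> \<rho>"
    "A + 2 * \<epsilon> * \<rho> \<le> 2 * w" "\<And>h t. (h, t) \<in> D \<Longrightarrow> t \<le> lim (\<lambda>m. ip (u m) h) + A"
proof -
  have w0: "0 \<le> w" using w[OF D0] \<epsilon> by simp
  \<comment> \<open>A point outside the ball is pulled towards the origin until its norm is
    \<epsilon>, where \<open>w\<close> applies. Heights thus grow at most linearly in the norm, and
    a quadratic penalty dominates them.\<close>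
  have growth: "t \<le> w * max 1 (nm h / \<epsilon>)" if ht: "(h, t) \<in> D" for h t
  proof (cases "nm h \<le> \<epsilon>")
    case True
    then have "t \<le> w * 1" using w[OF ht] by simp
    also have "\<dots> \<le> w * max 1 (nm h / \<epsilon>)" using w0 by (intro mult_left_mono) auto
    finally show ?thesis .
  next
    case False
    then have n0: "0 < nm h" using \<epsilon> by simp
    define s where "s = \<epsilon> / nm h"
    have s: "0 < s" "s \<le> 1" using False \<epsilon> n0 by (auto simp: s_def)
    have "(s *\<^sub>R h, s * t) \<in> D" using conv[OF D0 ht, of s] s by simp
    moreover have "nm (s *\<^sub>R h) = \<epsilon>" using nm_scale[OF DH[OF ht], of s] s n0 \<epsilon> by (simp add: s_def)
    ultimately have "s * t \<le> w" using w by force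
    then have "t \<le> w * (nm h / \<epsilon>)" using \<epsilon> n0 by (simp add: s_def field_simps)
    also have "\<dots> \<le> w * max 1 (nm h / \<epsilon>)" using w0 by (intro mult_left_mono) auto
    finally show ?thesis .
  qed
  show thesis
  proof (cases "w = 0")
    case True
    \<comment> \<open>Here \<open>growth\<close> makes all heights nonpositive, and the horizontal
      hyperplane does.\<close>
    show thesis
    proof (rule that[of "\<lambda>_. 0" 0 0])
      show "t \<le> lim (\<lambda>m. ip 0 h) + 0" if "(h, t) \<in> D" for h t
        using growth[OF that] DH[OF that] True by simp
    qed (use True in \<open>auto simp: nm_Cauchy_def\<close>)
  next
    case False
    with w0 have wp: "0 < w" by simp
    \<comment> \<open>With \<open>r = nm h / \<epsilon>\<close> the penalty is
      \<open>w * (r\<^sup>2 / 2)\<close>, on the scale of the growth bound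
      \<open>w * max 1 r\<close>. This scaling is what keeps the limit norm \<rho> within \<epsilon>
      and produces the bound \<open>2 * w\<close> at the end.\<close>
    define \<kappa> where "\<kappa> = w / \<epsilon>\<^sup>2"
    have \<kappa>: "0 < \<kappa>" using wp \<epsilon> by (simp add: \<kappa>_def)
    define \<psi> where "\<psi> h t = \<kappa> / 2 * (nm h)\<^sup>2 - t" for h t
    define m0 where "m0 = Inf (case_prod \<psi> ` D)"
    have bdd: "bdd_below (case_prod \<psi> ` D)"
    proof (rule bdd_belowI2[where m="- w"], clarify)
      fix h t assume ht: "(h, t) \<in> D"
      define r where "r = nm h / \<epsilon>"
      have "\<kappa> / 2 * (nm h)\<^sup>2 = w * (r\<^sup>2 / 2)" by (simp add: \<kappa>_def r_def power_divide)
      moreover have "t \<le> w * max 1 r" using growth[OF ht] by (simp add: r_def)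
      \<comment> \<open>Follows from \<open>(r - 1)\<^sup>2 \<ge> 0\<close>.\<close>
      moreover have "w * (max 1 r - 1) \<le> w * (r\<^sup>2 / 2)"
        using wp sum_power2_ge_zero[of "r - 1" 0]
        by (intro mult_left_mono) (auto simp: max_def power2_eq_square algebra_simps)
      ultimately show "- w \<le> \<psi> h t" by (simp add: \<psi>_def algebra_simps)
    qed
    have m0: "m0 \<le> \<psi> h t" if "(h, t) \<in> D" for h t
      unfolding m0_def using bdd that by (intro cInf_lower) (auto intro!: image_eqI[of _ _ "(h, t)"])
    define \<eta> where "\<eta> m = 1 / real (Suc m)" for m
    have \<eta>: "0 < \<eta> m" for m by (simp add: \<eta>_def)
    have \<eta>0: "\<eta> \<longlonglongrightarrow> 0" unfolding \<eta>_def by (rule LIMSEQ_inverse_real_of_nat[unfolded inverse_eq_divide])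
    have "\<exists>h t. (h, t) \<in> D \<and> \<psi> h t < m0 + \<eta> m" for m
    proof -
      have "case_prod \<psi> ` D \<noteq> {}" "Inf (case_prod \<psi> ` D) < m0 + \<eta> m"
        using D0 \<eta>[of m] unfolding m0_def by auto
      from cInf_lessD[OF this] show ?thesis by auto
    qed
    then obtain h t where ht: "\<And>m. (h m, t m) \<in> D" "\<And>m. \<psi> (h m) (t m) < m0 + \<eta> m" by metis
    have hH: "h m \<in> H" for m using DH ht by blast
    \<comment> \<open>Parallelogram identity: at the midpoint of two near-minimisers the functional
      is smaller than the average by a multiple of the squared distance, yet it stays above
      \<open>m0\<close>.\<close>
    have close: "\<kappa> / 4 * (nm (h m - h k))\<^sup>2 \<le> \<eta> m + \<eta> k" for m k
    proof -
      have "(h m + (1/2) *\<^sub>R (h k - h m), t m + 1/2 * (t k - t m)) \<in> D"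
        by (rule conv) (auto simp: ht)
      then have "m0 \<le> \<psi> (h m + (1/2) *\<^sub>R (h k - h m)) (t m + 1/2 * (t k - t m))" by (rule m0)
      also have "\<dots> = (\<psi> (h m) (t m) + \<psi> (h k) (t k)) / 2 - \<kappa> / 8 * (nm (h m - h k))\<^sup>2"
        using hH[of m] hH[of k]
        by (simp add: \<psi>_def nm_sq ip_simps ip_commute[of "h k" "h m"] field_simps)
      finally have "\<kappa> / 8 * (nm (h m - h k))\<^sup>2 \<le> (\<eta> m + \<eta> k) / 2"
        using ht(2)[of m] ht(2)[of k] by argo
      then show ?thesis by argo
    qed
    have Ch: "nm_Cauchy h"
      unfolding nm_Cauchy_def
    proof (intro allI impI)
      fix e :: real assume e: "0 < e"
      then have "\<forall>\<^sub>F m in sequentially. \<eta> m < \<kappa> / 8 * e\<^sup>2"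
        by (intro order_tendstoD(2)[OF \<eta>0]) (use \<kappa> e in simp)
      then obtain N where N: "\<And>m. m \<ge> N \<Longrightarrow> \<eta> m < \<kappa> / 8 * e\<^sup>2" by (auto simp: eventually_sequentially)
      show "\<exists>N. \<forall>m\<ge>N. \<forall>k\<ge>N. nm (h m - h k) < e"
      proof (intro exI allI impI)
        fix m k assume "N \<le> m" "N \<le> k"
        then have "\<kappa> / 4 * (nm (h m - h k))\<^sup>2 < \<kappa> / 4 * e\<^sup>2"
          using close[of m k] N[of m] N[of k] by simp
        then have "(nm (h m - h k))\<^sup>2 < e\<^sup>2" using \<kappa> by simp
        then show "nm (h m - h k) < e" using e by (simp add: power_less_imp_less_base)
      qed
    qed
    obtain \<rho> where \<rho>: "(\<lambda>m. nm (h m)) \<longlonglongrightarrow> \<rho>"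
      using nm_Cauchy_convergent_nm[OF hH Ch] by (auto simp: convergent_def)
    have \<psi>0: "(\<lambda>m. \<psi> (h m) (t m)) \<longlonglongrightarrow> m0"
    proof (rule tendsto_sandwich)
      show "\<forall>\<^sub>F m in sequentially. m0 \<le> \<psi> (h m) (t m)"
        by (intro always_eventually allI m0 ht)
      show "\<forall>\<^sub>F m in sequentially. \<psi> (h m) (t m) \<le> m0 + \<eta> m"
        by (intro always_eventually allI less_imp_le ht)
      show "(\<lambda>m. m0 + \<eta> m) \<longlonglongrightarrow> m0" using tendsto_add[OF tendsto_const \<eta>0, of m0] by simp
      show "(\<lambda>m. m0) \<longlonglongrightarrow> m0" by simp
    qed
    define t0 where "t0 = \<kappa> / 2 * \<rho>\<^sup>2 - m0"
    have t0: "t \<longlonglongrightarrow> t0"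
    proof -
      have "(\<lambda>m. \<kappa> / 2 * (nm (h m))\<^sup>2 - \<psi> (h m) (t m)) \<longlonglongrightarrow> t0"
        unfolding t0_def by (intro tendsto_intros \<rho> \<psi>0)
      then show ?thesis by (simp add: \<psi>_def)
    qed
    \<comment> \<open>First-order optimality of the idealised minimiser, which has height
      \<open>t0\<close>, norm \<rho> and inner products given by limits: its tangent hyperplane lies
      above \<open>D\<close>.\<close>
    have main: "y \<le> t0 + \<kappa> * (lim (\<lambda>m. ip (h m) x) - \<rho>\<^sup>2)" if xy: "(x, y) \<in> D" for x y
    proof -
      have x: "x \<in> H" using DH xy by blast
      define l where "l = lim (\<lambda>m. ip (h m) x)"
      have l: "(\<lambda>m. ip (h m) x) \<longlonglongrightarrow> l"
        unfolding l_def by (rule nm_Cauchy_convergent_ip[OF hH Ch x])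
      define N where "N = (nm x)\<^sup>2 - 2 * l + \<rho>\<^sup>2"
      \<comment> \<open>Moves from \<open>(h m, t m)\<close> a fraction \<open>s\<close> of the way
        to \<open>(x, y)\<close>, lets \<open>m\<close> tend to infinity and divides by
        \<open>s\<close>. The second-order term on the right disappears as \<open>s\<close> tends to
        0.\<close>
      have var: "y - t0 - \<kappa> * (l - \<rho>\<^sup>2) \<le> s * (\<kappa> / 2 * N)" if s: "0 < s" "s \<le> 1" for s
      proof -
        have "m0 \<le> \<psi> (h m) (t m) + s * (\<kappa> * (ip (h m) x - (nm (h m))\<^sup>2)
            + s * (\<kappa> / 2 * ((nm x)\<^sup>2 - 2 * ip (h m) x + (nm (h m))\<^sup>2)) - (y - t m))" for m
        proof -
          have "m0 \<le> \<psi> (h m + s *\<^sub>R (x - h m)) (t m + s * (y - t m))"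
            using s by (intro m0 conv ht xy) auto
          also have "\<dots> = \<psi> (h m) (t m) + s * (\<kappa> * (ip (h m) x - (nm (h m))\<^sup>2)
            + s * (\<kappa> / 2 * ((nm x)\<^sup>2 - 2 * ip (h m) x + (nm (h m))\<^sup>2)) - (y - t m))"
            using hH[of m] x
            by (simp add: \<psi>_def nm_sq ip_simps ip_commute[of x "h m"]) (simp add: field_simps)
          finally show ?thesis .
        qed
        then have "m0 \<le> m0 + s * (\<kappa> * (l - \<rho>\<^sup>2) + s * (\<kappa> / 2 * N) - (y - t0))"
          unfolding N_def
          by (intro LIMSEQ_le_const[where X="\<lambda>m. \<psi> (h m) (t m) + s * (\<kappa> * (ip (h m) x - (nm (h m))\<^sup>2)
            + s * (\<kappa> / 2 * ((nm x)\<^sup>2 - 2 * ip (h m) x + (nm (h m))\<^sup>2)) - (y - t m))"]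
            tendsto_intros \<psi>0 l \<rho> t0) auto
        then have "0 \<le> s * (\<kappa> * (l - \<rho>\<^sup>2) + s * (\<kappa> / 2 * N) - (y - t0))" by simp
        then show ?thesis using s by (simp add: zero_le_mult_iff)
      qed
      have lim0: "((\<lambda>s. s * (\<kappa> / 2 * N)) \<longlongrightarrow> 0 * (\<kappa> / 2 * N)) (at_right 0)"
        by (intro tendsto_intros)
      have "y - t0 - \<kappa> * (l - \<rho>\<^sup>2) \<le> 0 * (\<kappa> / 2 * N)"
        by (rule tendsto_lowerbound[OF lim0])
          (use var in \<open>auto simp: eventually_at_right_field intro!: exI[of _ 1]\<close>)
      then show ?thesis by (simp add: l_def)
    qed
    define r where "r = \<rho> / \<epsilon>"
    have \<kappa>r: "\<kappa> * \<rho>\<^sup>2 = w * r\<^sup>2" "\<epsilon> * (\<kappa> * \<rho>) = w * r"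
      using \<epsilon> by (simp_all add: \<kappa>_def r_def power2_eq_square)
    have "(\<lambda>m. w * max 1 (nm (h m) / \<epsilon>)) \<longlonglongrightarrow> w * max 1 r"
      unfolding r_def using \<epsilon> by (intro tendsto_intros \<rho>) auto
    then have t0w: "t0 \<le> w * max 1 r"
      by (rule LIMSEQ_le[OF t0]) (use growth ht in auto)
    \<comment> \<open>\<open>main\<close> at the origin. Combined with \<open>growth\<close> in the
      limit it gives \<open>r\<^sup>2 \<le> max 1 r\<close>, which rules out
      \<open>r > 1\<close>.\<close>
    have "w * r\<^sup>2 \<le> t0"
      using main[OF D0] \<kappa>r ip_commute[of _ 0] hH by (simp add: algebra_simps)
    then have "w * r\<^sup>2 \<le> w * max 1 r" using t0w by simp
    then have "r\<^sup>2 \<le> max 1 r" using wp by simp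
    then have r1: "r \<le> 1"
      by (rule contrapos_pp) (auto simp: max_def power2_eq_square)
    then have t0w: "t0 \<le> w" using t0w by (simp add: max_def split: if_splits)
    show thesis
    proof (rule that[of "\<lambda>m. \<kappa> *\<^sub>R h m" "\<kappa> * \<rho>" "t0 - \<kappa> * \<rho>\<^sup>2"])
      show "nm_Cauchy (\<lambda>m. \<kappa> *\<^sub>R h m)"
        unfolding nm_Cauchy_def
      proof (intro allI impI)
        fix e :: real assume "0 < e"
        then have "0 < e / \<kappa>" using \<kappa> by simp
        then obtain N where "\<And>m k. m \<ge> N \<Longrightarrow> k \<ge> N \<Longrightarrow> nm (h m - h k) < e / \<kappa>"
          using Ch unfolding nm_Cauchy_def by meson
        then show "\<exists>N. \<forall>m\<ge>N. \<forall>k\<ge>N. nm (\<kappa> *\<^sub>R h m - \<kappa> *\<^sub>R h k) < e"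
          using \<kappa> hH by (auto simp: nm_scale pos_less_divide_eq mult.commute simp flip: scaleR_diff_right intro!: exI[of _ N])
      qed
      show "(\<lambda>m. nm (\<kappa> *\<^sub>R h m)) \<longlonglongrightarrow> \<kappa> * \<rho>"
        using \<kappa> hH by (simp add: nm_scale) (intro tendsto_intros \<rho>)
      \<comment> \<open>The offset is \<open>t0 - w * r\<^sup>2\<close> with
        \<open>t0 \<le> w\<close>, and the second term is \<open>2 * w * r\<close>; the claim
        reduces to \<open>1 - r\<^sup>2 + 2 * r \<le> 2\<close>.\<close>
      have "0 \<le> w * (r - 1)\<^sup>2" using wp by simp
      then show "t0 - \<kappa> * \<rho>\<^sup>2 + 2 * \<epsilon> * (\<kappa> * \<rho>) \<le> 2 * w"
        using t0w \<kappa>r by (simp add: power2_eq_square algebra_simps)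
      show "y \<le> lim (\<lambda>m. ip (\<kappa> *\<^sub>R h m) x) + (t0 - \<kappa> * \<rho>\<^sup>2)" if xy: "(x, y) \<in> D" for x y
      proof -
        have x: "x \<in> H" using DH xy by blast
        have "(\<lambda>m. \<kappa> * ip (h m) x) \<longlonglongrightarrow> \<kappa> * lim (\<lambda>m. ip (h m) x)"
          by (intro tendsto_intros nm_Cauchy_convergent_ip[OF hH Ch x])
        then have "lim (\<lambda>m. ip (\<kappa> *\<^sub>R h m) x) = \<kappa> * lim (\<lambda>m. ip (h m) x)"
          using hH x by (simp add: ip_simps limI)
        then show ?thesis using main[OF xy] by (simp add: algebra_simps)
      qed
    qed (use hH in auto)
  qed
qed

end

section \<open>Gaussian experiments\<close>

text \<open>Where \<open>X > b\<close>, the differences \<open>Y m - c m\<close> have a positive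
  limit and are eventually positive. Almost surely such points lie in the increasing union of the
  \<open>A N\<close>, each of probability at most \<open>p\<close>.\<close>

lemma (in prob_space) prob_limit_greater:
  fixes Y :: "nat \<Rightarrow> 'a \<Rightarrow> real"
  assumes Y[measurable]: "\<And>m. Y m \<in> borel_measurable M" and X[measurable]: "X \<in> borel_measurable M"
    and lim: "AE x in M. (\<lambda>m. Y m x) \<longlonglongrightarrow> X x" and c: "c \<longlonglongrightarrow> b"
    and p: "\<And>m. prob {x \<in> space M. Y m x > c m} \<le> p"
  shows "prob {x \<in> space M. X x > b} \<le> p"
proof -
  define A where "A N = {x \<in> space M. \<forall>m\<ge>N. Y m x > c m}" for N
  have A[measurable]: "A N \<in> sets M" for N unfolding A_def by measurable
  have "prob {x \<in> space M. X x > b} \<le> prob (\<Union>N. A N)"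
  proof (rule finite_measure_mono_AE)
    show "AE x in M. x \<in> {x \<in> space M. X x > b} \<longrightarrow> x \<in> (\<Union>N. A N)"
      using lim
    proof eventually_elim
      case (elim x)
      show ?case
      proof (intro impI)
        assume x: "x \<in> {x \<in> space M. X x > b}"
        have "(\<lambda>m. Y m x - c m) \<longlonglongrightarrow> X x - b" by (intro tendsto_intros elim c)
        then have "\<forall>\<^sub>F m in sequentially. 0 < Y m x - c m" using x by (intro order_tendstoD(1)) auto
        then show "x \<in> (\<Union>N. A N)" using x by (auto simp: A_def eventually_sequentially)
      qed
    qed
  qed auto
  also have "\<dots> \<le> p"
  proof (rule LIMSEQ_le_const2)
    show "(\<lambda>N. prob (A N)) \<longlonglongrightarrow> prob (\<Union>N. A N)"
      by (rule finite_Lim_measure_incseq) (auto simp: incseq_def A_def)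
    show "\<exists>N. \<forall>n\<ge>N. prob (A n) \<le> p"
    proof (intro exI allI impI)
      fix n
      have "prob (A n) \<le> prob {x \<in> space M. Y n x > c n}"
        by (rule finite_measure_mono) (auto simp: A_def)
      also have "\<dots> \<le> p" by (rule p)
      finally show "prob (A n) \<le> p" .
    qed
  qed
  finally show ?thesis .
qed

text \<open>\<open>R\<close> consists of pairs of a direction \<open>h\<close> and a statistic that is normal with mean \<open>ip h f\<close> and
  standard deviation \<open>\<sigma> * nm h\<close> under every \<open>P f\<close>; only its upper tail enters, as \<open>R\<close> is closed under
  differences. The last assumption compares the experiment with a shift of a standard normal.\<close>

locale gauss_experiment = semi_inner H ip
  for H :: "'f::real_vector set" and ip +
  fixes S :: "'y measure" and P :: "'f \<Rightarrow> 'y measure" and \<sigma> :: real and R :: "('f \<times> ('y \<Rightarrow> real)) set"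
  assumes \<sigma>: "0 < \<sigma>"
    and P: "f \<in> H \<Longrightarrow> prob_space (P f)" and sets_P: "f \<in> H \<Longrightarrow> sets (P f) = sets S"
    and R: "(h, X) \<in> R \<Longrightarrow> h \<in> H" "(h, X) \<in> R \<Longrightarrow> X \<in> borel_measurable S"
    and R_diff: "(h, X) \<in> R \<Longrightarrow> (h', X') \<in> R \<Longrightarrow> (h - h', \<lambda>y. X y - X' y) \<in> R"
    and R_dense: "h \<in> H \<Longrightarrow> 0 < e \<Longrightarrow> \<exists>h' X'. (h', X') \<in> R \<and> nm (h' - h) < e"
    and R_tail: "(h, X) \<in> R \<Longrightarrow> f \<in> H \<Longrightarrow> 0 \<le> z \<Longrightarrow>
      measure (P f) {y \<in> space S. X y - ip h f > z * \<sigma> * nm h} \<le> 1 - Phi z"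
    and shift: "f \<in> H \<Longrightarrow> g \<in> H \<Longrightarrow> 0 \<le> z \<Longrightarrow> nm (g - f) \<le> z * \<sigma> \<Longrightarrow> A \<in> sets S \<Longrightarrow>
      Phi z \<le> measure (P g) A \<Longrightarrow> 1/2 \<le> measure (P f) A"
begin

lemma space_P: "f \<in> H \<Longrightarrow> space (P f) = space S"
  using sets_P by (rule sets_eq_imp_space_eq)

lemma measurable_P: "f \<in> H \<Longrightarrow> X \<in> borel_measurable S \<Longrightarrow> X \<in> borel_measurable (P f)"
  for X :: "'y \<Rightarrow> real"
  using measurable_cong_sets[OF sets_P refl, of f "borel :: real measure"] by simp

text \<open>Obtained as \<open>(h - h) - h\<close>; it turns the upper tail bound of the locale into
  a lower one.\<close>

lemma R_neg: assumes "(h, X) \<in> R" shows "(- h, \<lambda>y. - X y) \<in> R"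
  using R_diff[OF R_diff[OF assms assms] assms] by simp

lemma R_tail_lower:
  assumes "(h, X) \<in> R" "f \<in> H" "0 \<le> z"
  shows "measure (P f) {y \<in> space S. X y - ip h f < - (z * \<sigma> * nm h)} \<le> 1 - Phi z"
proof -
  have h: "h \<in> H" using assms R by blast
  have "ip (- h) f = - ip h f" "nm (- h) = nm h"
    using ip_scale_left[of h f "-1"] nm_scale[of h "-1"] h assms by auto
  moreover have "{y \<in> space S. X y - ip h f < - (z * \<sigma> * nm h)}
      = {y \<in> space S. - X y - - ip h f > z * \<sigma> * nm h}" by auto
  ultimately show ?thesis using R_tail[OF R_neg[OF assms(1)] assms(2,3)] by simp
qed

text \<open>Choose \<open>z\<close> so large that both tails together carry at most
  \<open>e\<close>, then the norm so small that \<open>z\<close> standard deviations stay below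
  \<open>e\<close>. The threshold \<open>d\<close> does not depend on \<open>f\<close>, so one
  subsequence can be chosen for all laws at once.\<close>

lemma R_small:
  assumes e: "0 < e"
  shows "\<exists>d>0. \<forall>h X f. (h, X) \<in> R \<longrightarrow> f \<in> H \<longrightarrow> nm h < d \<longrightarrow>
    measure (P f) {y \<in> space S. \<bar>X y - ip h f\<bar> > e} \<le> e"
proof -
  have "\<forall>\<^sub>F z in at_top. Phi z > 1 - e / 2"
    using order_tendstoD(1)[OF std_normal.cdf_lim_at_top_prob, of "1 - e/2"] e by simp
  then obtain z0 where z0: "\<And>z. z \<ge> z0 \<Longrightarrow> Phi z > 1 - e / 2"
    by (auto simp: eventually_at_top_linorder)
  define z where "z = max z0 1"
  have z: "0 < z" "1 - Phi z \<le> e / 2" using z0[of z] by (auto simp: z_def)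
  show ?thesis
  proof (intro exI[of _ "e / (z * \<sigma>)"] conjI allI impI)
    show "0 < e / (z * \<sigma>)" using e z \<sigma> by simp
    fix h X f assume hX: "(h, X) \<in> R" and f: "f \<in> H" and n: "nm h < e / (z * \<sigma>)"
    interpret prob_space "P f" using P f by blast
    have [measurable]: "X \<in> borel_measurable (P f)" using R(2)[OF hX] f by (simp add: measurable_P)
    have ne: "z * \<sigma> * nm h < e" using n z \<sigma> by (simp add: pos_less_divide_eq mult.commute mult.left_commute)
    let ?A = "{y \<in> space S. X y - ip h f > z * \<sigma> * nm h}"
    let ?B = "{y \<in> space S. X y - ip h f < - (z * \<sigma> * nm h)}"
    have AB: "?A \<in> sets (P f)" "?B \<in> sets (P f)"
      unfolding space_P[OF f, symmetric] by measurable
    have "prob {y \<in> space S. \<bar>X y - ip h f\<bar> > e} \<le> prob (?A \<union> ?B)"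
      using ne AB by (intro finite_measure_mono) auto
    also have "\<dots> \<le> prob ?A + prob ?B" using AB by (intro measure_Un_le) auto
    also have "\<dots> \<le> e"
      using R_tail[OF hX f, of z] R_tail_lower[OF hX f, of z] z by simp
    finally show "prob {y \<in> space S. \<bar>X y - ip h f\<bar> > e} \<le> e" .
  qed
qed

text \<open>An abstract Wiener integral for a direction in the completion. A subsequence is chosen
  so fast that successive centred differences exceed summable bounds only with summable
  probabilities; Borel--Cantelli gives almost sure convergence, and the tail bounds pass to the
  limit.\<close>

lemma limit_statistic:
  assumes u: "\<And>m. u m \<in> H" and C: "nm_Cauchy u" and \<rho>: "(\<lambda>m. nm (u m)) \<longlonglongrightarrow> \<rho>"
  obtains X where "X \<in> borel_measurable S"
    "\<And>f z. f \<in> H \<Longrightarrow> 0 \<le> z \<Longrightarrow>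
      measure (P f) {y \<in> space S. X y > lim (\<lambda>m. ip (u m) f) + z * \<sigma> * \<rho>} \<le> 1 - Phi z"
    "\<And>f z. f \<in> H \<Longrightarrow> 0 \<le> z \<Longrightarrow>
      measure (P f) {y \<in> space S. X y < lim (\<lambda>m. ip (u m) f) - z * \<sigma> * \<rho>} \<le> 1 - Phi z"
proof -
  define b where "b m = (1/2 :: real) ^ m" for m
  have b: "0 < b m" for m by (simp add: b_def)
  obtain d where d: "\<And>m. 0 < d m" "\<And>m h X f. (h, X) \<in> R \<Longrightarrow> f \<in> H \<Longrightarrow> nm h < d m \<Longrightarrow>
      measure (P f) {y \<in> space S. \<bar>X y - ip h f\<bar> > b m} \<le> b m"
  proof -
    have "\<exists>d. \<forall>m. 0 < d m \<and> (\<forall>h X f. (h, X) \<in> R \<longrightarrow> f \<in> H \<longrightarrow> nm h < d m \<longrightarrow>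
      measure (P f) {y \<in> space S. \<bar>X y - ip h f\<bar> > b m} \<le> b m)"
      by (intro choice allI) (rule R_small[OF b])
    then show thesis using that by blast
  qed
  \<comment> \<open>The running minimum makes \<open>c\<close> nonincreasing. The factor 1/3 pays
    for the three legs of the way from \<open>v (Suc m)\<close> through \<open>u (s (Suc m))\<close>
    and \<open>u (s m)\<close> to \<open>v m\<close>.\<close>
  define c where "c m = Min ((\<lambda>i. min (b i) (d i)) ` {..m}) / 3" for m
  have c0: "0 < c m" for m using b d(1) by (simp add: c_def)
  have cd: "3 * c m \<le> d m" "3 * c m \<le> b m" for m
  proof -
    have "3 * c m \<le> min (b m) (d m)" unfolding c_def by (simp add: Min_le del: min.bounded_iff)
    then show "3 * c m \<le> d m" "3 * c m \<le> b m" by auto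
  qed
  have cmono: "c (Suc m) \<le> c m" for m
    unfolding c_def by (intro divide_right_mono Min_antimono) auto
  obtain N where N: "\<And>m j k. j \<ge> N m \<Longrightarrow> k \<ge> N m \<Longrightarrow> nm (u j - u k) < c m"
  proof -
    have "\<exists>N. \<forall>m. \<forall>j\<ge>N m. \<forall>k\<ge>N m. nm (u j - u k) < c m"
      using C c0 unfolding nm_Cauchy_def by (intro choice) blast
    then show thesis using that by blast
  qed
  \<comment> \<open>The sum makes \<open>s m\<close> at least \<open>N m\<close>, the summand
    \<open>m\<close> makes \<open>s\<close> strictly increasing.\<close>
  define s where "s m = m + (\<Sum>i\<le>m. N i)" for m
  have s_mono: "strict_mono s" by (rule strict_mono_Suc_iff[THEN iffD2]) (simp add: s_def)
  have sN: "s m \<ge> N m" for m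
    unfolding s_def by (auto intro!: trans_le_add2 member_le_sum)
  have sN': "s (Suc m) \<ge> N m" for m
    using sN[of m] strict_monoD[OF s_mono, of m "Suc m"] by simp
  obtain v Z where vZ: "\<And>m. (v m, Z m) \<in> R" "\<And>m. nm (v m - u (s m)) < c m"
  proof -
    have "\<exists>p. \<forall>m. (fst (p m), snd (p m)) \<in> R \<and> nm (fst (p m) - u (s m)) < c m"
      using R_dense[OF u c0] by (intro choice allI) fastforce
    then obtain p where "\<forall>m. (fst (p m), snd (p m)) \<in> R \<and> nm (fst (p m) - u (s m)) < c m" ..
    then show thesis using that[of "\<lambda>m. fst (p m)" "\<lambda>m. snd (p m)"] by blast
  qed
  have v: "v m \<in> H" for m using R vZ by blast
  have Zm[measurable]: "Z m \<in> borel_measurable S" for m using R vZ by blast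
  have b0: "b \<longlonglongrightarrow> 0" unfolding b_def by (intro LIMSEQ_realpow_zero) auto
  have vu0: "(\<lambda>m. nm (v m - u (s m))) \<longlonglongrightarrow> 0"
  proof (rule tendsto_sandwich[OF _ _ tendsto_const b0])
    have "nm (v m - u (s m)) \<le> b m" for m using vZ(2)[of m] cd(2)[of m] c0[of m] by linarith
    then show "\<forall>\<^sub>F m in sequentially. nm (v m - u (s m)) \<le> b m" by simp
  qed (use v u in auto)
  have nmv: "(\<lambda>m. nm (v m)) \<longlonglongrightarrow> \<rho>"
  proof -
    have "(\<lambda>m. nm (v m) - nm (u (s m))) \<longlonglongrightarrow> 0"
      by (rule Lim_null_comparison[OF _ vu0]) (use nm_diff_le v u in auto)
    from tendsto_add[OF this LIMSEQ_subseq_LIMSEQ[OF \<rho> s_mono]] show ?thesis by (simp add: o_def)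
  qed
  have ipv: "(\<lambda>m. ip (v m) f) \<longlonglongrightarrow> lim (\<lambda>m. ip (u m) f)" if f: "f \<in> H" for f
  proof -
    have "(\<lambda>m. ip (v m) f - ip (u (s m)) f) \<longlonglongrightarrow> 0"
    proof (rule Lim_null_comparison)
      show "\<forall>\<^sub>F m in sequentially. norm (ip (v m) f - ip (u (s m)) f) \<le> nm (v m - u (s m)) * nm f"
        using Cauchy_Schwarz[of "v _ - u (s _)" f] v u f by (auto simp: ip_diff_left)
      show "(\<lambda>m. nm (v m - u (s m)) * nm f) \<longlonglongrightarrow> 0"
        using tendsto_mult_right[OF vu0, of "nm f"] by simp
    qed
    from tendsto_add[OF this LIMSEQ_subseq_LIMSEQ[OF nm_Cauchy_convergent_ip[OF u C f] s_mono]]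
    show ?thesis by (simp add: o_def)
  qed
  have step: "nm (v (Suc m) - v m) < d m" for m
  proof -
    have "nm (v (Suc m) - v m) \<le> nm (v (Suc m) - u (s (Suc m))) + nm (u (s (Suc m)) - v m)"
      by (rule nm_triangle_diff) (use u v in auto)
    also have "nm (u (s (Suc m)) - v m) \<le> nm (u (s (Suc m)) - u (s m)) + nm (u (s m) - v m)"
      by (rule nm_triangle_diff) (use u v in auto)
    also have "nm (u (s m) - v m) = nm (v m - u (s m))" by (rule nm_minus) (use u v in auto)
    finally show ?thesis
      using vZ(2)[of m] vZ(2)[of "Suc m"] N[OF sN' sN, of m] cd(1)[of m] cmono[of m] by linarith
  qed
  \<comment> \<open>This pointwise limit makes no reference to \<open>f\<close>; where it fails to
    exist its value is arbitrary, which affects only a null set of each \<open>P f\<close>.\<close>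
  define X where "X y = lim (\<lambda>m. Z m y)" for y
  have X[measurable]: "X \<in> borel_measurable S" unfolding X_def by measurable
  have conv: "AE y in P f. (\<lambda>m. Z m y) \<longlonglongrightarrow> X y" if f: "f \<in> H" for f
  proof -
    interpret prob_space "P f" using P f by blast
    \<comment> \<open>Increments centred at their means under \<open>P f\<close>. Their sums
      telescope, and adding back the convergent means \<open>ip (v n) f\<close> gives convergence of
      \<open>Z n\<close> itself.\<close>
    define D where "D m y = (Z (Suc m) y - Z m y) - ip (v (Suc m) - v m) f" for m y
    define A where "A m = {y \<in> space S. \<bar>D m y\<bar> > b m}" for m
    have A: "A m \<in> sets (P f)" for m
      unfolding A_def D_def sets_P[OF f] by measurable
    have "prob (A m) \<le> b m" for m
      unfolding A_def D_def by (rule d(2)[OF R_diff[OF vZ(1) vZ(1)] f step])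
    moreover have "summable b" unfolding b_def by (intro summable_geometric) auto
    ultimately have "summable (\<lambda>m. prob (A m))"
      by (intro summable_comparison_test[of "\<lambda>m. prob (A m)" b]) auto
    then have "AE y in P f. eventually (\<lambda>m. y \<in> space (P f) - A m) sequentially"
      by (intro borel_cantelli_AE1 A) (auto simp: emeasure_eq_measure)
    then show ?thesis
    proof eventually_elim
      case (elim y)
      then have "\<forall>\<^sub>F m in sequentially. norm (D m y) \<le> b m"
        by eventually_elim (auto simp: A_def space_P[OF f])
      then have "summable (\<lambda>m. D m y)"
        using \<open>summable b\<close> by (rule summable_comparison_test_ev)
      then have "convergent (\<lambda>n. \<Sum>m<n. D m y)" by (simp add: summable_iff_convergent)
      moreover have "(\<Sum>m<n. D m y) = (Z n y - Z 0 y) - (ip (v n) f - ip (v 0) f)" for n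
        using v f by (induction n) (auto simp: D_def ip_diff_left)
      ultimately obtain l where "(\<lambda>n. (Z n y - Z 0 y) - (ip (v n) f - ip (v 0) f)) \<longlonglongrightarrow> l"
        by (auto simp: convergent_def)
      from tendsto_add[OF tendsto_add[OF this ipv[OF f]] tendsto_const[of "Z 0 y - ip (v 0) f"]]
      have "(\<lambda>n. Z n y) \<longlonglongrightarrow> l + lim (\<lambda>m. ip (u m) f) + (Z 0 y - ip (v 0) f)" by simp
      then have "convergent (\<lambda>n. Z n y)" by (rule convergentI)
      then show ?case by (simp add: X_def convergent_LIMSEQ_iff)
    qed
  qed
  show thesis
  proof (rule that[OF X])
    fix f z assume f: "f \<in> H" and z: "0 \<le> (z::real)"
    interpret prob_space "P f" using P f by blast
    let ?l = "lim (\<lambda>m. ip (u m) f)"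
    have "prob {y \<in> space (P f). X y > ?l + z * \<sigma> * \<rho>} \<le> 1 - Phi z"
    proof (rule prob_limit_greater[OF _ _ conv[OF f]])
      show "(\<lambda>m. ip (v m) f + z * \<sigma> * nm (v m)) \<longlonglongrightarrow> ?l + z * \<sigma> * \<rho>"
        by (intro tendsto_intros ipv[OF f] nmv)
      show "prob {y \<in> space (P f). Z m y > ip (v m) f + z * \<sigma> * nm (v m)} \<le> 1 - Phi z" for m
      proof -
        have "{y \<in> space (P f). Z m y > ip (v m) f + z * \<sigma> * nm (v m)}
          = {y \<in> space S. Z m y - ip (v m) f > z * \<sigma> * nm (v m)}"
          by (auto simp: space_P[OF f])
        then show ?thesis using R_tail[OF vZ(1) f z, of m] by simp
      qed
    qed (use f in \<open>auto intro: measurable_P\<close>)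
    then show "prob {y \<in> space S. X y > ?l + z * \<sigma> * \<rho>} \<le> 1 - Phi z"
      by (simp add: space_P[OF f])
    have "prob {y \<in> space (P f). - X y > - ?l + z * \<sigma> * \<rho>} \<le> 1 - Phi z"
    proof (rule prob_limit_greater)
      show "AE y in P f. (\<lambda>m. - Z m y) \<longlonglongrightarrow> - X y"
        using conv[OF f] by eventually_elim (rule tendsto_minus)
      show "(\<lambda>m. - ip (v m) f + z * \<sigma> * nm (v m)) \<longlonglongrightarrow> - ?l + z * \<sigma> * \<rho>"
        by (intro tendsto_intros ipv[OF f] nmv)
      show "prob {y \<in> space (P f). - Z m y > - ip (v m) f + z * \<sigma> * nm (v m)} \<le> 1 - Phi z" for m
      proof -
        have "{y \<in> space (P f). - Z m y > - ip (v m) f + z * \<sigma> * nm (v m)}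
          = {y \<in> space S. Z m y - ip (v m) f < - (z * \<sigma> * nm (v m))}"
          by (auto simp: space_P[OF f])
        then show ?thesis using R_tail_lower[OF vZ(1) f z, of m] by simp
      qed
    qed (use f in \<open>auto intro: measurable_P\<close>)
    moreover have "{y \<in> space (P f). - X y > - ?l + z * \<sigma> * \<rho>} = {y \<in> space S. X y < ?l - z * \<sigma> * \<rho>}"
      by (auto simp: space_P[OF f])
    ultimately show "prob {y \<in> space S. X y < ?l - z * \<sigma> * \<rho>} \<le> 1 - Phi z" by simp
  qed
qed

text \<open>The hyperplane says that \<open>T - L\<close> on \<open>F2\<close> exceeds
  \<open>T - L\<close> on \<open>F1\<close> by at most \<open>A\<close>, so \<open>L\<close> plus a
  suitable constant estimates \<open>T\<close> with bias at most \<open>A / 2\<close> in the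
  direction that matters on each set. The common point \<open>e\<close> puts the origin into the
  difference set.\<close>

lemma pair_estimator:
  assumes VH: "V \<subseteq> H" and T: "linear_functional_on V T"
    and F1: "convex F1" "F1 \<subseteq> V" and F2: "convex F2" "F2 \<subseteq> V" and e: "e \<in> F1" "e \<in> F2"
    and z: "0 < z" and w: "\<And>f g. f \<in> F1 \<Longrightarrow> g \<in> F2 \<Longrightarrow> nm (g - f) \<le> z * \<sigma> \<Longrightarrow> T g - T f \<le> w"
  obtains X where "X \<in> borel_measurable S"
    "\<And>f. f \<in> F1 \<Longrightarrow> measure (P f) {y \<in> space S. X y > T f + w} \<le> 1 - Phi z"
    "\<And>g. g \<in> F2 \<Longrightarrow> measure (P g) {y \<in> space S. X y < T g - w} \<le> 1 - Phi z"
proof -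
  have subV: "subspace V" and Tadd: "\<And>f g. f \<in> V \<Longrightarrow> g \<in> V \<Longrightarrow> T (f + g) = T f + T g"
    and Tscale: "\<And>c f. f \<in> V \<Longrightarrow> T (c *\<^sub>R f) = c * T f"
    using T by (auto simp: linear_functional_on_def)
  have Tconv: "T (f + s *\<^sub>R (g - f)) = T f + s * (T g - T f)" if "f \<in> V" "g \<in> V" for f g s
  proof -
    have "f + s *\<^sub>R (g - f) = (1 - s) *\<^sub>R f + s *\<^sub>R g" by (simp add: algebra_simps)
    moreover have "T ((1 - s) *\<^sub>R f + s *\<^sub>R g) = (1 - s) * T f + s * T g"
      using that by (simp only: Tadd Tscale subspace_scale[OF subV])
    ultimately show ?thesis by (simp add: algebra_simps)
  qed
  have cv: "f + s *\<^sub>R (g - f) \<in> F" if "convex F" "f \<in> F" "g \<in> F" "0 \<le> s" "s \<le> 1" for f g s F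
  proof -
    have "(1 - s) *\<^sub>R f + s *\<^sub>R g \<in> F" using that by (intro convexD) auto
    then show ?thesis by (simp add: algebra_simps)
  qed
  have FH: "F1 \<subseteq> H" "F2 \<subseteq> H" using F1 F2 VH by auto
  define D where "D = {(g - f, T g - T f) | f g. f \<in> F1 \<and> g \<in> F2}"
  obtain u A \<rho> where u: "\<And>m. u m \<in> H" and C: "nm_Cauchy u" and \<rho>: "(\<lambda>m. nm (u m)) \<longlonglongrightarrow> \<rho>"
    and A: "A + 2 * (z * \<sigma>) * \<rho> \<le> 2 * w" and D: "\<And>h t. (h, t) \<in> D \<Longrightarrow> t \<le> lim (\<lambda>m. ip (u m) h) + A"
  proof (rule supporting_functional[of D "z * \<sigma>" w])
    show "(0, 0) \<in> D" unfolding D_def using e by (auto intro!: exI[of _ e])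
    show "0 < z * \<sigma>" using z \<sigma> by simp
    fix h t assume ht: "(h, t) \<in> D"
    then show "h \<in> H" using FH by (auto simp: D_def)
    show "nm h \<le> z * \<sigma> \<Longrightarrow> t \<le> w" using w ht by (auto simp: D_def)
    fix h' t' and s :: real assume ht': "(h', t') \<in> D" and s: "0 \<le> s" "s \<le> 1"
    obtain f g where fg: "f \<in> F1" "g \<in> F2" "h = g - f" "t = T g - T f" using ht by (auto simp: D_def)
    obtain f' g' where fg': "f' \<in> F1" "g' \<in> F2" "h' = g' - f'" "t' = T g' - T f'" using ht' by (auto simp: D_def)
    have V: "f \<in> V" "g \<in> V" "f' \<in> V" "g' \<in> V" using fg fg' F1 F2 by auto
    have "f + s *\<^sub>R (f' - f) \<in> F1" "g + s *\<^sub>R (g' - g) \<in> F2"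
      using fg fg' s F1 F2 by (auto intro!: cv)
    moreover have "h + s *\<^sub>R (h' - h) = (g + s *\<^sub>R (g' - g)) - (f + s *\<^sub>R (f' - f))"
      by (simp add: fg fg' algebra_simps)
    moreover have "t + s * (t' - t) = T (g + s *\<^sub>R (g' - g)) - T (f + s *\<^sub>R (f' - f))"
      unfolding Tconv[OF V(1,3)] Tconv[OF V(2,4)] by (simp add: fg fg' algebra_simps)
    ultimately show "(h + s *\<^sub>R (h' - h), t + s * (t' - t)) \<in> D" unfolding D_def by blast
  qed blast
  define L where "L f = lim (\<lambda>m. ip (u m) f)" for f
  have L: "T g - T f \<le> L g - L f + A" if fg: "f \<in> F1" "g \<in> F2" for f g
  proof -
    have H: "f \<in> H" "g \<in> H" using fg FH by auto
    have "(\<lambda>m. ip (u m) (g - f)) \<longlonglongrightarrow> L g - L f"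
      unfolding L_def using H u by (simp add: ip_diff_right) (intro tendsto_diff nm_Cauchy_convergent_ip u C)
    then have "lim (\<lambda>m. ip (u m) (g - f)) = L g - L f" by (rule limI)
    moreover have "(g - f, T g - T f) \<in> D" using fg by (auto simp: D_def)
    ultimately show ?thesis using D by metis
  qed
  obtain X where X: "X \<in> borel_measurable S"
    and Xu: "\<And>f z. f \<in> H \<Longrightarrow> 0 \<le> z \<Longrightarrow> measure (P f) {y \<in> space S. X y > L f + z * \<sigma> * \<rho>} \<le> 1 - Phi z"
    and Xl: "\<And>f z. f \<in> H \<Longrightarrow> 0 \<le> z \<Longrightarrow> measure (P f) {y \<in> space S. X y < L f - z * \<sigma> * \<rho>} \<le> 1 - Phi z"
    unfolding L_def by (rule limit_statistic[OF u C \<rho>]) blast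
  \<comment> \<open>Finite because the hyperplane inequality, with \<open>e\<close> in the role of
    \<open>f\<close>, bounds \<open>T - L\<close> on \<open>F2\<close>.\<close>
  define a where "a = (SUP g\<in>F2. T g - L g)"
  have bdd: "bdd_above ((\<lambda>g. T g - L g) ` F2)"
  proof (rule bdd_aboveI2)
    show "T g - L g \<le> T e - L e + A" if "g \<in> F2" for g using L[OF e(1) that] by linarith
  qed
  have a1: "T g - L g \<le> a" if "g \<in> F2" for g
    unfolding a_def by (rule cSUP_upper[OF that bdd])
  have a2: "a \<le> T f - L f + A" if "f \<in> F1" for f
    unfolding a_def
  proof (rule cSUP_least)
    show "T g - L g \<le> T f - L f + A" if "g \<in> F2" for g using L[OF \<open>f \<in> F1\<close> that] by linarith
  qed (use e in auto)
  \<comment> \<open>Since \<open>T g - L g \<le> a \<le> T f - L f + A\<close>, subtracting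
    \<open>A / 2\<close> splits the slack evenly; \<open>A / 2\<close> and the noise allowance
    \<open>z * \<sigma> * \<rho>\<close> add up to at most \<open>w\<close>.\<close>
  define X' where "X' y = X y + (a - A / 2)" for y
  have X'[measurable]: "X' \<in> borel_measurable S" unfolding X'_def using X by measurable
  have mono: "measure (P f) {y \<in> space S. Q y} \<le> p"
    if f: "f \<in> H" and Q': "{y \<in> space S. Q' y} \<in> sets S" "\<And>y. Q y \<Longrightarrow> Q' y"
      and p: "measure (P f) {y \<in> space S. Q' y} \<le> p" for f Q Q' p
  proof -
    interpret prob_space "P f" using P f by blast
    have "prob {y \<in> space S. Q y} \<le> prob {y \<in> space S. Q' y}"
      using Q' sets_P[OF f] by (intro finite_measure_mono) auto
    with p show ?thesis by simp
  qed
  show thesis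
  proof (rule that[OF X'])
    fix f assume f: "f \<in> F1"
    show "measure (P f) {y \<in> space S. X' y > T f + w} \<le> 1 - Phi z"
    proof (rule mono[OF _ _ _ Xu])
      show "X' y > T f + w \<Longrightarrow> X y > L f + z * \<sigma> * \<rho>" for y
        using a2[OF f] A by (simp add: X'_def)
      show "{y \<in> space S. X y > L f + z * \<sigma> * \<rho>} \<in> sets S" using X by measurable
    qed (use f FH z in auto)
  next
    fix g assume g: "g \<in> F2"
    show "measure (P g) {y \<in> space S. X' y < T g - w} \<le> 1 - Phi z"
    proof (rule mono[OF _ _ _ Xl])
      show "X' y < T g - w \<Longrightarrow> X y < L g - z * \<sigma> * \<rho>" for y
        using a1[OF g] A by (simp add: X'_def)
      show "{y \<in> space S. X y < L g - z * \<sigma> * \<rho>} \<in> sets S" using X by measurable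
    qed (use g FH z in auto)
  qed
qed

end

section \<open>Combining the pairwise confidence bounds into one interval\<close>

lemma random_interval_Icc:
  assumes [measurable]: "lo \<in> borel_measurable S" "hi \<in> borel_measurable S"
  shows "random_interval S (\<lambda>y. {lo y .. hi y :: real})"
proof -
  have "{p \<in> space (S \<Otimes>\<^sub>M borel). lo (fst p) \<le> snd p \<and> snd p \<le> hi (fst p)} \<in> sets (S \<Otimes>\<^sub>M borel)"
    by measurable
  also have "{p \<in> space (S \<Otimes>\<^sub>M borel). lo (fst p) \<le> snd p \<and> snd p \<le> hi (fst p)}
    = {(y, t). y \<in> space S \<and> t \<in> {lo y .. hi y}}"
    by (auto simp: space_pair_measure)
  finally show ?thesis by (auto simp: random_interval_def is_interval_cc)
qed

lemma Max_image_ex: "finite K \<Longrightarrow> K \<noteq> {} \<Longrightarrow> \<exists>j\<in>K. Max (f ` K) = f j"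
  using Max_in[of "f ` K"] by blast

lemma Min_image_ex: "finite K \<Longrightarrow> K \<noteq> {} \<Longrightarrow> \<exists>j\<in>K. Min (f ` K) = f j"
  using Min_in[of "f ` K"] by blast

lemma modulus_nonneg:
  assumes "f \<in> G" "nrm 0 \<le> \<epsilon>"
  shows "0 \<le> modulus nrm T \<epsilon> G"
proof -
  have "ereal (T f - T f) \<le> modulus nrm T \<epsilon> G"
    unfolding modulus_def using assms by (intro Sup_upper CollectI exI[of _ f]) auto
  then show ?thesis by (simp add: zero_ereal_def)
qed

context gauss_experiment begin

text \<open>For each pair \<open>i\<close>, \<open>j\<close> there is an estimator \<open>X i j\<close> such that \<open>X i j - w\<close> is a lower
  confidence bound for \<open>T f\<close> on \<open>F i\<close> and \<open>X i j + w\<close> an upper one on \<open>F j\<close>. For each \<open>j\<close> the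
  best bounds valid on \<open>F j\<close> are taken, and then the hull over \<open>j\<close>. As the smallest lower bound,
  attained at \<open>i\<close>, and the largest upper bound, attained at \<open>j\<close>, both involve \<open>X i j\<close>, the
  length is at most \<open>2 * w\<close>.\<close>

lemma minimax_length_le:
  assumes VH: "V \<subseteq> H" and T: "linear_functional_on V T" and k: "1 \<le> k"
    and F: "\<And>j. j \<in> {1..k} \<Longrightarrow> convex (F j)" "\<And>j. j \<in> {1..k} \<Longrightarrow> F j \<subseteq> V"
    and meet: "\<And>i j. i \<in> {1..k} \<Longrightarrow> j \<in> {1..k} \<Longrightarrow> F i \<inter> F j \<noteq> {}"
    and z: "0 < z" "1 - Phi z = \<alpha> / (2 * real k)"
  shows "enn2ereal (minimax_length S P T \<alpha> (\<Union>j\<in>{1..k}. F j)) \<le> 2 * modulus nm T (z * \<sigma>) (\<Union>j\<in>{1..k}. F j)"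
proof -
  define K where "K = {1..k}"
  have K: "finite K" "K \<noteq> {}" "card K = k" using k by (auto simp: K_def)
  define G where "G = (\<Union>j\<in>K. F j)"
  have GH: "f \<in> H" if "f \<in> G" for f using that F(2) VH unfolding G_def K_def by blast
  have "1 \<in> {1..k}" using k by simp
  with meet[OF this this] have Gne: "G \<noteq> {}" unfolding G_def K_def by blast
  have m0: "0 \<le> modulus nm T (z * \<sigma>) G"
    using Gne z \<sigma> by (auto intro: modulus_nonneg)
  have "enn2ereal (minimax_length S P T \<alpha> G) \<le> 2 * modulus nm T (z * \<sigma>) G"
  proof (cases "modulus nm T (z * \<sigma>) G = \<infinity>")
    case True
    then show ?thesis by simp
  next
    case False
    then obtain w where w: "modulus nm T (z * \<sigma>) G = ereal w" and w0: "0 \<le> w"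
      using m0 by (cases "modulus nm T (z * \<sigma>) G") auto
    have Tw: "T g - T f \<le> w" if "f \<in> G" "g \<in> G" "nm (g - f) \<le> z * \<sigma>" for f g
    proof -
      have "ereal (T g - T f) \<le> modulus nm T (z * \<sigma>) G"
        unfolding modulus_def using that by (intro Sup_upper) auto
      then show ?thesis by (simp add: w)
    qed
    define Q where "Q i j X \<longleftrightarrow> X \<in> borel_measurable S \<and>
      (\<forall>f\<in>F i. measure (P f) {y \<in> space S. X y > T f + w} \<le> \<alpha> / (2 * real k)) \<and>
      (\<forall>g\<in>F j. measure (P g) {y \<in> space S. X y < T g - w} \<le> \<alpha> / (2 * real k))" for i j X
    have "\<exists>X. Q i j X" if ij: "i \<in> K" "j \<in> K" for i j
    proof -
      obtain e where e: "e \<in> F i" "e \<in> F j" using meet[of i j] ij by (auto simp: K_def)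
      have c: "convex (F i)" "F i \<subseteq> V" "convex (F j)" "F j \<subseteq> V" using F ij by (auto simp: K_def)
      have Tij: "T g - T f \<le> w" if "f \<in> F i" "g \<in> F j" "nm (g - f) \<le> z * \<sigma>" for f g
        using Tw[of f g] that ij by (auto simp: G_def)
      from VH T c e z(1) show ?thesis
      proof (rule pair_estimator[where w = w])
        fix X
        assume X: "X \<in> borel_measurable S"
          "\<And>f. f \<in> F i \<Longrightarrow> measure (P f) {y \<in> space S. X y > T f + w} \<le> 1 - Phi z"
          "\<And>g. g \<in> F j \<Longrightarrow> measure (P g) {y \<in> space S. X y < T g - w} \<le> 1 - Phi z"
        show ?thesis
          unfolding Q_def z(2)[symmetric] by (rule exI[of _ X]) (intro conjI ballI X)
      qed (rule Tij)
    qed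
    then obtain X where QX: "\<And>i j. i \<in> K \<Longrightarrow> j \<in> K \<Longrightarrow> Q i j (X i j)" by metis
    have X: "X i j \<in> borel_measurable S" if "i \<in> K" "j \<in> K" for i j
      by (rule QX[OF that, unfolded Q_def, THEN conjunct1])
    have Xu: "measure (P f) {y \<in> space S. X i j y > T f + w} \<le> \<alpha> / (2 * real k)"
      if "i \<in> K" "j \<in> K" "f \<in> F i" for i j f
      using QX[OF that(1,2), unfolded Q_def, THEN conjunct2, THEN conjunct1] that(3) by (rule bspec)
    have Xl: "measure (P g) {y \<in> space S. X i j y < T g - w} \<le> \<alpha> / (2 * real k)"
      if "i \<in> K" "j \<in> K" "g \<in> F j" for i j g
      using QX[OF that(1,2), unfolded Q_def, THEN conjunct2, THEN conjunct2] that(3) by (rule bspec)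
    define l where "l j y = Max ((\<lambda>i. X j i y - w) ` K)" for j y
    define h where "h j y = Min ((\<lambda>i. X i j y + w) ` K)" for j y
    define lo where "lo y = Min ((\<lambda>j. l j y) ` K)" for y
    define hi where "hi y = Max ((\<lambda>j. h j y) ` K)" for y
    have lm: "l j \<in> borel_measurable S" if "j \<in> K" for j
      unfolding l_def by (intro borel_measurable_Max[OF K(1)] borel_measurable_diff X that borel_measurable_const)
    have hm: "h j \<in> borel_measurable S" if "j \<in> K" for j
      unfolding h_def by (intro borel_measurable_Min[OF K(1)] borel_measurable_add X that borel_measurable_const)
    have lom: "lo \<in> borel_measurable S"
      unfolding lo_def by (intro borel_measurable_Min[OF K(1)] lm)
    have him: "hi \<in> borel_measurable S"
      unfolding hi_def by (intro borel_measurable_Max[OF K(1)] hm)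
    define CI where "CI y = {lo y .. hi y}" for y
    have CI: "random_interval S CI" unfolding CI_def by (rule random_interval_Icc[OF lom him])
    have len: "hi y - lo y \<le> 2 * w" for y
    proof -
      obtain j where j: "j \<in> K" "hi y = h j y"
        unfolding hi_def using Max_image_ex[OF K(1,2), of "\<lambda>j. h j y"] by blast
      obtain i where i: "i \<in> K" "lo y = l i y"
        unfolding lo_def using Min_image_ex[OF K(1,2), of "\<lambda>j. l j y"] by blast
      have "h j y \<le> X i j y + w" unfolding h_def using K i by (intro Min_le) auto
      moreover have "X i j y - w \<le> l i y" unfolding l_def using K j by (intro Max_ge) auto
      ultimately show ?thesis using i j by simp
    qed
    have cov: "1 - \<alpha> \<le> measure (P f) {y \<in> space S. T f \<in> CI y}" if f: "f \<in> G" for f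
    proof -
      obtain j where j: "j \<in> K" "f \<in> F j" using f by (auto simp: G_def)
      interpret prob_space "P f" using P GH[OF f] by blast
      have sp: "space (P f) = space S" and se: "sets (P f) = sets S"
        using space_P[OF GH[OF f]] sets_P[OF GH[OF f]] by simp_all
      define A where "A i = {y \<in> space S. X j i y > T f + w}" for i
      define B where "B i = {y \<in> space S. X i j y < T f - w}" for i
      have AB: "A i \<in> events" "B i \<in> events" if "i \<in> K" for i
        using X[OF j(1) that] X[OF that j(1)] unfolding A_def B_def se by measurable
      have ev: "{y \<in> space S. T f \<in> CI y} \<in> events"
        unfolding se by (rule random_interval_section[OF CI])
      \<comment> \<open>A miss of the hull is a miss of the bounds belonging to the index
        \<open>j\<close> with \<open>f \<in> F j\<close>, hence a failure of one of the
        \<open>X j i\<close> from above or of one of the \<open>X i j\<close> from below: 2 k events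
        in all.\<close>
      have "space S - {y \<in> space S. T f \<in> CI y} \<subseteq> (\<Union>i\<in>K. A i) \<union> (\<Union>i\<in>K. B i)"
      proof
        fix y assume y: "y \<in> space S - {y \<in> space S. T f \<in> CI y}"
        then have "T f < lo y \<or> hi y < T f" by (auto simp: CI_def not_le)
        moreover have "lo y \<le> l j y" unfolding lo_def using K j by (intro Min_le) auto
        moreover have "h j y \<le> hi y" unfolding hi_def using K j by (intro Max_ge) auto
        ultimately have "T f < l j y \<or> h j y < T f" by linarith
        then show "y \<in> (\<Union>i\<in>K. A i) \<union> (\<Union>i\<in>K. B i)"
        proof
          assume "T f < l j y"
          moreover obtain i where "i \<in> K" "l j y = X j i y - w"
            unfolding l_def using Max_image_ex[OF K(1,2), of "\<lambda>i. X j i y - w"] by blast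
          ultimately have "y \<in> A i" "i \<in> K" using y by (auto simp: A_def)
          then show ?thesis by blast
        next
          assume "h j y < T f"
          moreover obtain i where "i \<in> K" "h j y = X i j y + w"
            unfolding h_def using Min_image_ex[OF K(1,2), of "\<lambda>i. X i j y + w"] by blast
          ultimately have "y \<in> B i" "i \<in> K" using y by (auto simp: B_def)
          then show ?thesis by blast
        qed
      qed
      then have "prob (space S - {y \<in> space S. T f \<in> CI y}) \<le> prob ((\<Union>i\<in>K. A i) \<union> (\<Union>i\<in>K. B i))"
        using AB K by (intro finite_measure_mono) auto
      also have "\<dots> \<le> prob (\<Union>i\<in>K. A i) + prob (\<Union>i\<in>K. B i)"
        using AB K by (intro measure_Un_le) auto
      also have "\<dots> \<le> (\<Sum>i\<in>K. prob (A i)) + (\<Sum>i\<in>K. prob (B i))"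
        using AB K by (intro add_mono measure_UNION_le) auto
      also have "\<dots> \<le> (\<Sum>i\<in>K. \<alpha> / (2 * real k)) + (\<Sum>i\<in>K. \<alpha> / (2 * real k))"
        unfolding A_def B_def using j by (intro add_mono sum_mono Xu Xl)
      also have "\<dots> = \<alpha>" using K k by (simp add: field_simps)
      finally show ?thesis using prob_compl[OF ev] by (simp add: sp)
    qed
    have "CI \<in> confidence_intervals S P T \<alpha> G"
      using CI cov Gne by (auto simp: confidence_intervals_def intro!: cINF_greatest)
    then have "minimax_length S P T \<alpha> G \<le> (SUP f\<in>G. expected_length (P f) CI)"
      unfolding minimax_length_def by (rule INF_lower)
    also have "\<dots> \<le> ennreal (2 * w)"
    proof (rule SUP_least)
      fix f assume f: "f \<in> G"
      interpret prob_space "P f" using P GH[OF f] by blast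
      \<comment> \<open>Where \<open>hi y < lo y\<close> the interval is empty and has length 0,
        which is below \<open>2 * w\<close> as \<open>w\<close> is nonnegative.\<close>
      have "expected_length (P f) CI \<le> (\<integral>\<^sup>+y. ennreal (2 * w) \<partial>P f)"
        unfolding expected_length_def CI_def
        by (intro nn_integral_mono) (use len w0 in \<open>simp add: emeasure_lborel_Icc_eq ennreal_leI\<close>)
      then show "expected_length (P f) CI \<le> ennreal (2 * w)" by (simp add: emeasure_space_1)
    qed
    finally have "enn2ereal (minimax_length S P T \<alpha> G) \<le> enn2ereal (ennreal (2 * w))"
      by (simp add: less_eq_ennreal.rep_eq)
    then show ?thesis using w0 by (simp add: w)
  qed
  then show ?thesis by (simp add: G_def K_def)
qed

theorem minimax_length_bounds:
  assumes VH: "V \<subseteq> H" and T: "linear_functional_on V T" and k: "1 \<le> k"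
    and F: "\<And>j. j \<in> {1..k} \<Longrightarrow> convex (F j)" "\<And>j. j \<in> {1..k} \<Longrightarrow> F j \<subseteq> V"
    and meet: "\<And>i j. i \<in> {1..k} \<Longrightarrow> j \<in> {1..k} \<Longrightarrow> F i \<inter> F j \<noteq> {}"
    and \<alpha>: "0 < \<alpha>" "\<alpha> < 1/2" and G: "G = (\<Union>j\<in>{1..k}. F j)"
  shows "ereal (1/2 - \<alpha>) * modulus nm T (normal_quantile \<alpha> * \<sigma>) G \<le> enn2ereal (minimax_length S P T \<alpha> G)"
    and "enn2ereal (minimax_length S P T \<alpha> G) \<le> 12 * modulus nm T (normal_quantile (\<alpha> / (2 * real k)) * \<sigma>) G"
proof -
  have GH: "f \<in> H" if "f \<in> G" for f using that F(2) VH unfolding G by blast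
  show "ereal (1/2 - \<alpha>) * modulus nm T (normal_quantile \<alpha> * \<sigma>) G \<le> enn2ereal (minimax_length S P T \<alpha> G)"
  proof (rule minimax_length_ge)
    fix f g A assume *: "f \<in> G" "g \<in> G" "nm (g - f) \<le> normal_quantile \<alpha> * \<sigma>" "A \<in> sets S"
      "1 - \<alpha> \<le> measure (P g) A"
    have "Phi (normal_quantile \<alpha>) \<le> measure (P g) A" "0 \<le> normal_quantile \<alpha>"
      using *(5) Phi_normal_quantile[of \<alpha>] normal_quantile_pos[of \<alpha>] \<alpha> by simp_all
    then show "1/2 \<le> measure (P f) A"
      using *(1-4) GH by (intro shift[of f g "normal_quantile \<alpha>" A])
  qed (use P sets_P GH \<alpha> in auto)
  define b where "b = \<alpha> / (2 * real k)"
  have "\<alpha> * 1 \<le> \<alpha> * (2 * real k)" using \<alpha> k by (intro mult_left_mono) auto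
  then have b: "0 < b" "b < 1/2" using \<alpha> k by (auto simp: b_def field_simps)
  let ?\<omega> = "modulus nm T (normal_quantile b * \<sigma>) G"
  have "enn2ereal (minimax_length S P T \<alpha> G) \<le> 2 * ?\<omega>"
    unfolding G using b Phi_normal_quantile[of b] normal_quantile_pos[of b]
    by (intro minimax_length_le[OF VH T k F meet]) (auto simp: b_def)
  \<comment> \<open>Mere enlargement of the constant, which the nonnegative modulus permits.\<close>
  also have "\<dots> \<le> 12 * ?\<omega>"
  proof (rule ereal_mult_right_mono)
    have "1 \<in> {1..k}" using k by simp
    with meet[OF this this] obtain f where "f \<in> G" unfolding G by blast
    then show "0 \<le> ?\<omega>" using normal_quantile_pos[of b] b \<sigma> by (intro modulus_nonneg) auto
  qed simp
  finally show "enn2ereal (minimax_length S P T \<alpha> G) \<le> 12 * modulus nm T (normal_quantile (\<alpha> / (2 * real k)) * \<sigma>) G"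
    by (simp add: b_def)
qed

end

section \<open>Comparison of laws on a product space through cylinders\<close>

lemma cylinder_in_sets:
  assumes "J \<subseteq> I" "X \<in> sets (\<Pi>\<^sub>M i\<in>J. N)"
  shows "{y \<in> space (\<Pi>\<^sub>M i\<in>I. N). restrict y J \<in> X} \<in> sets (\<Pi>\<^sub>M i\<in>I. N)"
  using measurable_sets[OF measurable_restrict_subset[OF assms(1), of "\<lambda>_. N"] assms(2)]
  by (simp add: vimage_def Int_def conj_commute)

text \<open>The cylinders form an algebra that generates the product sets, whatever the size of the
  index set; paths over the window have uncountably many coordinates.\<close>

lemma prob_ge_half_of_cylinders:
  fixes P Q :: "('i \<Rightarrow> real) measure"
  assumes P: "prob_space P" "sets P = sets (\<Pi>\<^sub>M i\<in>I. borel)"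
    and Q: "prob_space Q" "sets Q = sets (\<Pi>\<^sub>M i\<in>I. borel)"
    and np: "\<And>J X c. finite J \<Longrightarrow> J \<subseteq> I \<Longrightarrow> X \<in> sets (\<Pi>\<^sub>M i\<in>J. borel) \<Longrightarrow>
      Phi c \<le> measure P {y \<in> space (\<Pi>\<^sub>M i\<in>I. borel). restrict y J \<in> X} \<Longrightarrow>
      Phi (c - z) \<le> measure Q {y \<in> space (\<Pi>\<^sub>M i\<in>I. borel). restrict y J \<in> X}"
    and A: "A \<in> sets (\<Pi>\<^sub>M i\<in>I. borel)" "Phi z \<le> measure P A"
  shows "1/2 \<le> measure Q A"
proof -
  \<comment> \<open>An auxiliary family: only its algebra of cylinders is used, and this depends on
    the measurable sets of the factors alone.\<close>
  let ?N = "\<lambda>_::'i. std_normal_distribution"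
  interpret E: product_prob_space ?N I
    by unfold_locales
  have s: "sets (PiM J ?N) = sets (\<Pi>\<^sub>M i\<in>J. borel)" for J :: "'i set"
    by (intro sets_PiM_cong) auto
  have sp: "space (PiM I ?N) = space (\<Pi>\<^sub>M i\<in>I. (borel :: real measure))"
    by (rule sets_eq_imp_space_eq[OF s])
  show ?thesis
  proof (rule prob_ge_half_of_algebra[OF E.algebra_generator P(1) Q(1)])
    fix A c assume "A \<in> E.generator" and c: "Phi c \<le> measure P A"
    then obtain J X where J: "A = prod_emb I ?N J X" "finite J" "J \<subseteq> I" "X \<in> sets (PiM J ?N)"
      by (auto elim: E.generator.cases)
    have "A = {y \<in> space (\<Pi>\<^sub>M i\<in>I. borel). restrict y J \<in> X}"
      by (auto simp: J(1) prod_emb_def space_PiM)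
    then show "Phi (c - z) \<le> measure Q A"
      using np[of J X c] J c by (simp add: s)
  qed (use A P Q in \<open>simp_all add: s E.sets_PiM_generator[symmetric]\<close>)
qed

section \<open>The Gaussian sequence model\<close>

lemma l2_mult_summable:
  assumes "f \<in> l2_seqs M" "g \<in> l2_seqs M"
  shows "(\<lambda>i. f i * g i) summable_on M"
proof -
  have "(\<lambda>i. (f i)\<^sup>2 + (g i)\<^sup>2) summable_on M"
    using assms by (intro summable_on_add) (auto simp: l2_seqs_def)
  then have "(\<lambda>i. norm ((f i)\<^sup>2 + (g i)\<^sup>2)) summable_on M"
    by simp
  then have "(\<lambda>i. norm (f i * g i)) summable_on M"
  proof (rule Infinite_Sum.abs_summable_on_comparison_test)
    fix i
    have "2 * (\<bar>f i\<bar> * \<bar>g i\<bar>) \<le> (f i)\<^sup>2 + (g i)\<^sup>2" "0 \<le> \<bar>f i\<bar> * \<bar>g i\<bar>"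
      using sum_squares_bound[of "\<bar>f i\<bar>" "\<bar>g i\<bar>"] by auto
    then have "\<bar>f i * g i\<bar> \<le> (f i)\<^sup>2 + (g i)\<^sup>2"
      unfolding abs_mult by linarith
    then show "norm (f i * g i) \<le> norm ((f i)\<^sup>2 + (g i)\<^sup>2)" by simp
  qed
  then show ?thesis by (rule summable_on_iff_abs_summable_on_real[THEN iffD2])
qed

lemma subspace_l2_seqs: "subspace (l2_seqs M)"
proof (rule subspaceI)
  show "0 \<in> l2_seqs M" by (simp add: l2_seqs_def)
  show "f + g \<in> l2_seqs M" if fg: "f \<in> l2_seqs M" "g \<in> l2_seqs M" for f g
  proof -
    have "(\<lambda>i. ((f i)\<^sup>2 + (g i)\<^sup>2) + 2 * (f i * g i)) summable_on M"
      using fg by (intro summable_on_add summable_on_cmult_right l2_mult_summable) (auto simp: l2_seqs_def)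
    then have "(\<lambda>i. (f i + g i)\<^sup>2) summable_on M" by (simp add: power2_sum algebra_simps)
    then show ?thesis using fg by (simp add: l2_seqs_def)
  qed
  show "c *\<^sub>R f \<in> l2_seqs M" if f: "f \<in> l2_seqs M" for c f
  proof -
    have "(\<lambda>i. c\<^sup>2 * (f i)\<^sup>2) summable_on M"
      using f by (intro summable_on_cmult_right) (auto simp: l2_seqs_def)
    then show ?thesis using f by (simp add: l2_seqs_def scaleR_fun_def power_mult_distrib)
  qed
qed

lemma semi_inner_l2: "semi_inner (l2_seqs M) (\<lambda>f g. \<Sum>\<^sub>\<infinity>i\<in>M. f i * g i)"
proof
  fix f g h assume fgh: "f \<in> l2_seqs M" "g \<in> l2_seqs M" "h \<in> l2_seqs M"
  show "(\<Sum>\<^sub>\<infinity>i\<in>M. (f + g) i * h i) = (\<Sum>\<^sub>\<infinity>i\<in>M. f i * h i) + (\<Sum>\<^sub>\<infinity>i\<in>M. g i * h i)"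
    using fgh by (simp add: distrib_right infsum_add l2_mult_summable)
next
  fix f h and c :: real
  show "(\<Sum>\<^sub>\<infinity>i\<in>M. (c *\<^sub>R f) i * h i) = c * (\<Sum>\<^sub>\<infinity>i\<in>M. f i * h i)"
    by (simp add: scaleR_fun_def mult.assoc infsum_cmult_right')
qed (auto simp: subspace_l2_seqs mult.commute intro!: infsum_nonneg)

lemma infsum_finite_support:
  fixes f :: "'i \<Rightarrow> real"
  assumes "finite J" "J \<subseteq> M" "\<And>i. i \<notin> J \<Longrightarrow> f i = 0"
  shows "(\<Sum>\<^sub>\<infinity>i\<in>M. f i) = (\<Sum>i\<in>J. f i)"
proof -
  have "infsum f M = infsum f J" by (rule infsum_cong_neutral) (use assms in auto)
  then show ?thesis using assms by simp
qed

lemma finite_support_in_l2_seqs: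
  assumes "finite J" "J \<subseteq> M" "\<And>i. i \<notin> J \<Longrightarrow> h i = 0"
  shows "h \<in> l2_seqs M"
proof -
  have "(\<lambda>i. (h i)\<^sup>2) summable_on M \<longleftrightarrow> (\<lambda>i. (h i)\<^sup>2) summable_on J"
    by (rule summable_on_cong_neutral) (use assms in auto)
  then show ?thesis using assms by (auto simp: l2_seqs_def)
qed

lemma l2_truncation:
  assumes h: "h \<in> l2_seqs M" and e: "0 < e"
  obtains J where "finite J" "J \<subseteq> M" "(\<Sum>\<^sub>\<infinity>i\<in>M. ((if i \<in> J then h i else 0) - h i)\<^sup>2) < e"
proof -
  let ?q = "\<lambda>i. (h i)\<^sup>2"
  have s: "?q summable_on M" using h by (simp add: l2_seqs_def)
  have "\<forall>\<^sub>F J in finite_subsets_at_top M. dist (sum ?q J) (infsum ?q M) < e"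
    using infsum_tendsto[OF s] e by (auto simp: tendsto_iff)
  then obtain J where J: "finite J" "J \<subseteq> M" "dist (sum ?q J) (infsum ?q M) < e"
    unfolding eventually_finite_subsets_at_top by blast
  have "(\<Sum>\<^sub>\<infinity>i\<in>M. ((if i \<in> J then h i else 0) - h i)\<^sup>2) = infsum ?q (M - J)"
    by (rule infsum_cong_neutral) (use J in auto)
  also have "\<dots> = infsum ?q M - infsum ?q J"
    using J s by (intro infsum_Diff) auto
  also have "\<dots> < e" using J by (simp add: dist_real_def)
  finally show thesis using J by (intro that)
qed

lemma distributed_PiM_std_normal:
  assumes "i \<in> M"
  shows "distributed (\<Pi>\<^sub>M i\<in>M. std_normal_distribution) lborel (\<lambda>x. x i) std_normal_density"
proof -
  interpret E: product_prob_space "\<lambda>_. std_normal_distribution" M by unfold_locales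
  have "distr (\<Pi>\<^sub>M i\<in>M. std_normal_distribution) lborel (\<lambda>x. x i)
    = distr (\<Pi>\<^sub>M i\<in>M. std_normal_distribution) std_normal_distribution (\<lambda>x. x i)"
    by (intro distr_cong) auto
  also have "\<dots> = std_normal_distribution"
    using E.PiM_component[OF assms] .
  finally show ?thesis
    using measurable_component_singleton[OF assms, of "\<lambda>_. std_normal_distribution"]
    by (simp add: distributed_def)
qed

lemma indep_vars_PiM_std_normal:
  assumes J: "finite J" "J \<subseteq> M"
  shows "prob_space.indep_vars (\<Pi>\<^sub>M i\<in>M. std_normal_distribution) (\<lambda>_. borel) (\<lambda>i x. x i) J"
proof -
  interpret E: product_prob_space "\<lambda>_. std_normal_distribution" M by unfold_locales
  show ?thesis
  \<comment> \<open>The characterisation of independence by the product law is stated for nonempty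
    index sets.\<close>
  proof (cases "J = {}")
    case True
    then show ?thesis
      by (simp add: E.P.indep_vars_def E.P.indep_sets_def)
  next
    case False
    let ?P = "\<Pi>\<^sub>M i\<in>M. std_normal_distribution"
    have m: "(\<lambda>x. x i) \<in> borel_measurable ?P" if "i \<in> J" for i
      using distributed_PiM_std_normal[of i M] that J by (auto simp: distributed_def)
    have "distr ?P (\<Pi>\<^sub>M i\<in>J. borel) (\<lambda>x. \<lambda>i\<in>J. x i) = distr ?P (\<Pi>\<^sub>M i\<in>J. std_normal_distribution) (\<lambda>x. restrict x J)"
      by (intro distr_cong sets_PiM_cong) (auto simp: restrict_def)
    also have "\<dots> = (\<Pi>\<^sub>M i\<in>J. std_normal_distribution)"
      using J by (rule E.distr_PiM_restrict_finite)
    also have "\<dots> = (\<Pi>\<^sub>M i\<in>J. distr ?P borel (\<lambda>x. x i))"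
    proof (rule PiM_cong[OF refl])
      fix i assume "i \<in> J"
      then have "i \<in> M" using J by auto
      then have "std_normal_distribution = distr ?P lborel (\<lambda>x. x i)"
        using distributed_PiM_std_normal[of i M] by (simp add: distributed_def)
      also have "\<dots> = distr ?P borel (\<lambda>x. x i)" by (intro distr_cong) auto
      finally show "std_normal_distribution = distr ?P borel (\<lambda>x. x i)" .
    qed
    finally show ?thesis
      using E.P.indep_vars_iff_distr_eq_PiM'[OF False, where M'="\<lambda>_. borel" and X="\<lambda>i x. x i"] m by simp
  qed
qed

text \<open>A direction of finite support is paired with the same combination of the observations,
  whose noise is a finite Gaussian sum; truncation makes these directions dense. For
  \<open>shift\<close>, a cylinder depends on finitely many coordinates, and discarding the others
  can only shorten the difference of the means.\<close>

lemma gauss_experiment_seq: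
  assumes n: "1 \<le> n"
  shows "gauss_experiment (l2_seqs M) (\<lambda>f g. \<Sum>\<^sub>\<infinity>i\<in>M. f i * g i) (seq_space M) (gaussian_seq_law M n)
    (1 / sqrt (real n))
    {(h, \<lambda>y. \<Sum>i\<in>J. h i * y i) | h J. finite J \<and> J \<subseteq> M \<and> (\<forall>i. i \<notin> J \<longrightarrow> h i = 0)}"
proof -
  define ip where "ip f g = (\<Sum>\<^sub>\<infinity>i\<in>M. f i * g i)" for f g :: "'a \<Rightarrow> real"
  define \<sigma> where "\<sigma> = 1 / sqrt (real n)"
  define R where "R = {(h, \<lambda>y. \<Sum>i\<in>J. h i * y i) | h J. finite J \<and> J \<subseteq> M \<and> (\<forall>i. i \<notin> J \<longrightarrow> h i = (0::real))}"
  let ?N = "\<Pi>\<^sub>M i\<in>M. std_normal_distribution"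
  have \<sigma>: "0 < \<sigma>" "sqrt (real n) * \<sigma> = 1" using n by (auto simp: \<sigma>_def)
  interpret E: product_prob_space "\<lambda>_. std_normal_distribution" M by unfold_locales
  interpret L: semi_inner "l2_seqs M" ip
    unfolding ip_def by (rule semi_inner_l2)
  have Ym[measurable]: "(\<lambda>z. \<lambda>i\<in>M. f i + z i / sqrt (real n)) \<in> measurable ?N (seq_space M)" for f
    unfolding seq_space_def by measurable
  have P: "prob_space (gaussian_seq_law M n f)" for f
    unfolding gaussian_seq_law_def by (rule E.P.prob_space_distr[OF Ym])
  have mP: "measure (gaussian_seq_law M n f) {y \<in> space (seq_space M). p y}
      = measure ?N {x \<in> space ?N. p (\<lambda>i\<in>M. f i + \<sigma> * x i)}"
    if "{y \<in> space (seq_space M). p y} \<in> sets (seq_space M)" for f p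
    unfolding gaussian_seq_law_def using that measurable_space[OF Ym]
    by (subst measure_distr) (auto intro!: arg_cong[where f="measure _"] simp: \<sigma>_def)
  have comp[measurable]: "(\<lambda>y. y i) \<in> borel_measurable (seq_space M)" if "i \<in> M" for i
    using that unfolding seq_space_def by measurable
  have Xm: "(\<lambda>y. \<Sum>i\<in>J. h i * y i) \<in> borel_measurable (seq_space M)" if "J \<subseteq> M" for h J
    using that by (intro borel_measurable_sum borel_measurable_times comp) auto
  have "gauss_experiment (l2_seqs M) ip (seq_space M) (gaussian_seq_law M n) \<sigma> R"
  proof (intro gauss_experiment.intro L.semi_inner_axioms gauss_experiment_axioms.intro)
    show "0 < \<sigma>" by fact
    fix f
    show "prob_space (gaussian_seq_law M n f)" by (rule P)
    show "sets (gaussian_seq_law M n f) = sets (seq_space M)" by (simp add: gaussian_seq_law_def)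
  next
    fix h X assume hX: "(h, X) \<in> R"
    obtain J where J: "finite J" "J \<subseteq> M" "\<And>i. i \<notin> J \<Longrightarrow> h i = 0" and X: "X = (\<lambda>y. \<Sum>i\<in>J. h i * y i)"
      using hX by (auto simp: R_def)
    show "h \<in> l2_seqs M" using J by (rule finite_support_in_l2_seqs)
    show Xm': "X \<in> borel_measurable (seq_space M)" unfolding X using J by (intro Xm)
    fix f and z :: real assume f: "f \<in> l2_seqs M" and z: "0 \<le> z"
    have ipf: "ip h f = (\<Sum>i\<in>J. h i * f i)"
      unfolding ip_def by (rule infsum_finite_support) (use J in auto)
    have "ip h h = (\<Sum>i\<in>J. (h i)\<^sup>2)"
      unfolding ip_def power2_eq_square by (rule infsum_finite_support) (use J in auto)
    then have nmh: "L.nm h = sqrt (\<Sum>i\<in>J. (h i)\<^sup>2)" by (simp add: L.nm_def)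
    have "measure (gaussian_seq_law M n f) {y \<in> space (seq_space M). X y - ip h f > z * \<sigma> * L.nm h}
      = measure ?N {x \<in> space ?N. (\<Sum>i\<in>J. h i * x i) > z * L.nm h}"
    proof (subst mP)
      show "{y \<in> space (seq_space M). X y - ip h f > z * \<sigma> * L.nm h} \<in> sets (seq_space M)"
        using Xm' by measurable
      have "X (\<lambda>i\<in>M. f i + \<sigma> * x i) - ip h f = \<sigma> * (\<Sum>i\<in>J. h i * x i)" for x
      proof -
        have "X (\<lambda>i\<in>M. f i + \<sigma> * x i) = (\<Sum>i\<in>J. h i * (f i + \<sigma> * x i))"
          unfolding X using J by (intro sum.cong) auto
        also have "\<dots> = (\<Sum>i\<in>J. h i * f i) + \<sigma> * (\<Sum>i\<in>J. h i * x i)"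
          by (simp add: sum.distrib sum_distrib_left algebra_simps)
        finally show ?thesis by (simp add: ipf)
      qed
      then have "X (\<lambda>i\<in>M. f i + \<sigma> * x i) - ip h f > z * \<sigma> * L.nm h \<longleftrightarrow> (\<Sum>i\<in>J. h i * x i) > z * L.nm h" for x
        using \<sigma> by (simp add: mult.commute[of z \<sigma>] mult.assoc)
      then show "measure ?N {x \<in> space ?N. X (\<lambda>i\<in>M. f i + \<sigma> * x i) - ip h f > z * \<sigma> * L.nm h}
        = measure ?N {x \<in> space ?N. (\<Sum>i\<in>J. h i * x i) > z * L.nm h}" by simp
    qed
    also have "\<dots> \<le> 1 - Phi z"
      unfolding nmh using J z
      by (intro E.P.prob_gauss_sum_greater indep_vars_PiM_std_normal distributed_PiM_std_normal) auto
    finally show "measure (gaussian_seq_law M n f) {y \<in> space (seq_space M). X y - ip h f > z * \<sigma> * L.nm h} \<le> 1 - Phi z" .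
  next
    fix h X h' X' assume R: "(h, X) \<in> R" "(h', X') \<in> R"
    obtain J where J: "finite J" "J \<subseteq> M" "\<And>i. i \<notin> J \<Longrightarrow> h i = 0" and X: "X = (\<lambda>y. \<Sum>i\<in>J. h i * y i)"
      using R by (auto simp: R_def)
    obtain J' where J': "finite J'" "J' \<subseteq> M" "\<And>i. i \<notin> J' \<Longrightarrow> h' i = 0" and X': "X' = (\<lambda>y. \<Sum>i\<in>J'. h' i * y i)"
      using R by (auto simp: R_def)
    have "X = (\<lambda>y. \<Sum>i\<in>J \<union> J'. h i * y i)" "X' = (\<lambda>y. \<Sum>i\<in>J \<union> J'. h' i * y i)"
      unfolding X X' using J J' by (auto intro!: ext sum.mono_neutral_left)
    then have "(\<lambda>y. X y - X' y) = (\<lambda>y. \<Sum>i\<in>J \<union> J'. (h - h') i * y i)"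
      by (simp add: sum_subtractf left_diff_distrib)
    moreover have "finite (J \<union> J')" "J \<union> J' \<subseteq> M" "\<forall>i. i \<notin> J \<union> J' \<longrightarrow> (h - h') i = 0"
      using J J' by auto
    ultimately show "(h - h', \<lambda>y. X y - X' y) \<in> R" unfolding R_def by blast
  next
    fix h and e :: real assume h: "h \<in> l2_seqs M" and e: "0 < e"
    have "0 < e\<^sup>2" using e by simp
    then obtain J where J: "finite J" "J \<subseteq> M" "(\<Sum>\<^sub>\<infinity>i\<in>M. ((if i \<in> J then h i else 0) - h i)\<^sup>2) < e\<^sup>2"
      by (rule l2_truncation[OF h])
    define h' where "h' i = (if i \<in> J then h i else 0)" for i
    have "L.nm (h' - h) = sqrt (\<Sum>\<^sub>\<infinity>i\<in>M. ((if i \<in> J then h i else 0) - h i)\<^sup>2)"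
      by (simp add: L.nm_def ip_def h'_def power2_eq_square)
    also have "\<dots> < sqrt (e\<^sup>2)" using J(3) by (rule real_sqrt_less_mono)
    also have "\<dots> = e" using e by simp
    finally have "L.nm (h' - h) < e" .
    moreover have "(h', \<lambda>y. \<Sum>i\<in>J. h' i * y i) \<in> R"
      unfolding R_def using J by (intro CollectI exI[of _ h'] exI[of _ J]) (auto simp: h'_def)
    ultimately show "\<exists>h' X'. (h', X') \<in> R \<and> L.nm (h' - h) < e" by blast
  next
    fix f g z A
    assume fg: "f \<in> l2_seqs M" "g \<in> l2_seqs M" and z: "0 \<le> (z::real)" and d: "L.nm (g - f) \<le> z * \<sigma>"
      and A: "A \<in> sets (seq_space M)" "Phi z \<le> measure (gaussian_seq_law M n g) A"
    show "1/2 \<le> measure (gaussian_seq_law M n f) A"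
    proof (rule prob_ge_half_of_cylinders[OF P _ P])
      fix J X c
      assume J: "finite J" "J \<subseteq> M" and X[measurable]: "X \<in> sets (\<Pi>\<^sub>M i\<in>J. (borel::real measure))"
        and c: "Phi c \<le> measure (gaussian_seq_law M n g) {y \<in> space (\<Pi>\<^sub>M i\<in>M. borel). restrict y J \<in> X}"
      \<comment> \<open>The event in units of the noise: on \<open>J\<close> the data are \<sigma>
        times a vector with unit variances and means \<open>sqrt (real n) * f i\<close>.\<close>
      define X' where "X' = {x \<in> space (\<Pi>\<^sub>M i\<in>J. (borel::real measure)). (\<lambda>i\<in>J. \<sigma> * x i) \<in> X}"
      have X'[measurable]: "X' \<in> sets (\<Pi>\<^sub>M i\<in>J. borel)" unfolding X'_def by measurable
      have ev: "{y \<in> space (\<Pi>\<^sub>M i\<in>M. (borel::real measure)). restrict y J \<in> X} \<in> sets (seq_space M)"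
        unfolding seq_space_def by (rule cylinder_in_sets[OF J(2) X])
      have eq: "measure (gaussian_seq_law M n f) {y \<in> space (\<Pi>\<^sub>M i\<in>M. borel). restrict y J \<in> X}
        = measure ?N {x \<in> space ?N. (\<lambda>i\<in>J. sqrt (real n) * f i + x i) \<in> X'}" for f
      proof -
        have "restrict (\<lambda>i\<in>M. f i + \<sigma> * x i) J = (\<lambda>i\<in>J. \<sigma> * (\<lambda>i\<in>J. sqrt (real n) * f i + x i) i)" for x
          using J \<sigma> by (auto simp: fun_eq_iff algebra_simps restrict_def)
        then show ?thesis
          using mP[of "\<lambda>y. restrict y J \<in> X" f] ev by (simp add: X'_def space_PiM seq_space_def)
      qed
      have "(\<Sum>i\<in>J. (sqrt (real n) * f i - sqrt (real n) * g i)\<^sup>2) = real n * (\<Sum>i\<in>J. ((g - f) i)\<^sup>2)"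
        by (simp add: sum_distrib_left power2_eq_square algebra_simps)
      also have "\<dots> \<le> real n * (\<Sum>\<^sub>\<infinity>i\<in>M. ((g - f) i)\<^sup>2)"
        using J L.H_closed(3)[OF fg(2,1)]
        by (intro mult_left_mono finite_sum_le_infsum) (auto simp: l2_seqs_def)
      also have "(\<Sum>\<^sub>\<infinity>i\<in>M. ((g - f) i)\<^sup>2) = (L.nm (g - f))\<^sup>2"
        using L.nm_sq[of "g - f"] fg by (simp add: ip_def power2_eq_square)
      also have "real n * (L.nm (g - f))\<^sup>2 \<le> real n * (z * \<sigma>)\<^sup>2"
        using d fg by (intro mult_left_mono power_mono) auto
      also have "\<dots> = z\<^sup>2" using n by (simp add: \<sigma>_def power_divide)
      finally have "(\<Sum>i\<in>J. (sqrt (real n) * f i - sqrt (real n) * g i)\<^sup>2) \<le> z\<^sup>2" .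
      from E.P.gauss_shift_prob[OF J(1) indep_vars_PiM_std_normal[OF J] _ X' z this, of c]
      show "Phi (c - z) \<le> measure (gaussian_seq_law M n f) {y \<in> space (\<Pi>\<^sub>M i\<in>M. borel). restrict y J \<in> X}"
        using c J unfolding eq by (auto intro: distributed_PiM_std_normal)
    qed (use A in \<open>simp_all add: gaussian_seq_law_def seq_space_def\<close>)
  qed
  then show ?thesis unfolding ip_def \<sigma>_def R_def .
qed

section \<open>Square integrable functions and step functions\<close>

definition L2_ip :: "(real \<Rightarrow> real) \<Rightarrow> (real \<Rightarrow> real) \<Rightarrow> real" where
  "L2_ip f g = (LINT t:unit_window|lebesgue. f t * g t)"

lemma L2_funsD:
  assumes "f \<in> L2_funs"
  shows "t \<notin> unit_window \<Longrightarrow> f t = 0" "f \<in> borel_measurable lebesgue" "integrable lebesgue (\<lambda>t. (f t)\<^sup>2)"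
  using assms unfolding L2_funs_def by blast+

lemma L2_dominated:
  assumes g: "g \<in> L2_funs" and f: "f \<in> borel_measurable lebesgue" and le: "\<And>t. \<bar>f t\<bar> \<le> \<bar>g t\<bar>"
  shows "f \<in> L2_funs"
proof -
  have "f t = 0" if "t \<notin> unit_window" for t
    using le[of t] L2_funsD(1)[OF g that] by simp
  moreover have "integrable lebesgue (\<lambda>t. (f t)\<^sup>2)"
  proof (rule Bochner_Integration.integrable_bound[OF L2_funsD(3)[OF g]])
    show "(\<lambda>t. (f t)\<^sup>2) \<in> borel_measurable lebesgue" using f by measurable
    show "AE t in lebesgue. norm ((f t)\<^sup>2) \<le> norm ((g t)\<^sup>2)"
      using le by (auto simp: abs_le_square_iff)
  qed
  ultimately show ?thesis using f by (simp add: L2_funs_def)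
qed

lemma L2_mult_integrable:
  assumes f: "f \<in> L2_funs" and g: "g \<in> L2_funs"
  shows "integrable lebesgue (\<lambda>t. f t * g t)"
proof (rule Bochner_Integration.integrable_bound)
  show "integrable lebesgue (\<lambda>t. (f t)\<^sup>2 + (g t)\<^sup>2)"
    using L2_funsD(3)[OF f] L2_funsD(3)[OF g] by (rule Bochner_Integration.integrable_add)
  show "(\<lambda>t. f t * g t) \<in> borel_measurable lebesgue"
    using L2_funsD(2)[OF f] L2_funsD(2)[OF g] by measurable
  show "AE t in lebesgue. norm (f t * g t) \<le> norm ((f t)\<^sup>2 + (g t)\<^sup>2)"
  proof (rule AE_I2)
    fix t
    have "2 * (\<bar>f t\<bar> * \<bar>g t\<bar>) \<le> (f t)\<^sup>2 + (g t)\<^sup>2" "0 \<le> \<bar>f t\<bar> * \<bar>g t\<bar>"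
      using sum_squares_bound[of "\<bar>f t\<bar>" "\<bar>g t\<bar>"] by auto
    then have "\<bar>f t * g t\<bar> \<le> (f t)\<^sup>2 + (g t)\<^sup>2"
      unfolding abs_mult by linarith
    then show "norm (f t * g t) \<le> norm ((f t)\<^sup>2 + (g t)\<^sup>2)" by simp
  qed
qed

lemma L2_ip_eq:
  assumes f: "f \<in> L2_funs"
  shows "L2_ip f g = (LINT t|lebesgue. f t * g t)"
proof -
  have "indicator unit_window t *\<^sub>R (f t * g t) = f t * g t" for t
    by (cases "t \<in> unit_window") (auto simp: L2_funsD(1)[OF f])
  then show ?thesis unfolding L2_ip_def set_lebesgue_integral_def by (simp only:)
qed

lemma L2_funs_add:
  assumes f: "f \<in> L2_funs" and g: "g \<in> L2_funs"
  shows "(\<lambda>t. f t + g t) \<in> L2_funs"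
proof -
  have "integrable lebesgue (\<lambda>t. (f t)\<^sup>2 + (g t)\<^sup>2 + 2 * (f t * g t))"
    using L2_funsD(3)[OF f] L2_funsD(3)[OF g] L2_mult_integrable[OF f g]
    by (intro Bochner_Integration.integrable_add integrable_mult_right) auto
  then have "integrable lebesgue (\<lambda>t. (f t + g t)\<^sup>2)"
    by (simp add: power2_sum mult.assoc)
  moreover have "(\<lambda>t. f t + g t) \<in> borel_measurable lebesgue"
    using L2_funsD(2)[OF f] L2_funsD(2)[OF g] by measurable
  ultimately show ?thesis
    using L2_funsD(1)[OF f] L2_funsD(1)[OF g] unfolding L2_funs_def by auto
qed

lemma L2_funs_scale:
  assumes f: "f \<in> L2_funs"
  shows "(\<lambda>t. c * f t) \<in> L2_funs"
proof -
  have "integrable lebesgue (\<lambda>t. (c * f t)\<^sup>2)"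
    using L2_funsD(3)[OF f] by (simp add: power_mult_distrib)
  moreover have "(\<lambda>t. c * f t) \<in> borel_measurable lebesgue"
    using L2_funsD(2)[OF f] by measurable
  ultimately show ?thesis
    using L2_funsD(1)[OF f] unfolding L2_funs_def by auto
qed

lemma subspace_L2_funs: "subspace L2_funs"
proof (rule subspaceI)
  show "0 \<in> L2_funs" by (auto simp: L2_funs_def zero_fun_def)
  show "f + g \<in> L2_funs" if "f \<in> L2_funs" "g \<in> L2_funs" for f g
    using L2_funs_add[OF that] by (simp add: plus_fun_def)
  show "c *\<^sub>R f \<in> L2_funs" if "f \<in> L2_funs" for c f
    using L2_funs_scale[OF that] by (simp add: scaleR_fun_def)
qed

interpretation L2: semi_inner L2_funs L2_ip
proof
  fix f g h assume fgh: "f \<in> L2_funs" "g \<in> L2_funs" "h \<in> L2_funs"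
  have "f + g \<in> L2_funs" using fgh subspace_add[OF subspace_L2_funs] by blast
  then show "L2_ip (f + g) h = L2_ip f h + L2_ip g h"
    using fgh by (simp add: L2_ip_eq distrib_right L2_mult_integrable)
next
  fix f h and c :: real assume fh: "f \<in> L2_funs" "h \<in> L2_funs"
  have "c *\<^sub>R f \<in> L2_funs" using fh subspace_scale[OF subspace_L2_funs] by blast
  then show "L2_ip (c *\<^sub>R f) h = c * L2_ip f h"
    using fh by (simp add: L2_ip_eq scaleR_fun_def mult.assoc)
next
  fix f assume "f \<in> L2_funs"
  then show "0 \<le> L2_ip f f" by (simp add: L2_ip_eq)
qed (auto simp: subspace_L2_funs L2_ip_def mult.commute)

lemma L2_nm_eq_L2_nrm: "L2.nm = L2_nrm"
  by (simp add: fun_eq_iff L2.nm_def L2_nrm_def L2_ip_def power2_eq_square)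

lemma L2_nm_sq: "f \<in> L2_funs \<Longrightarrow> (L2.nm f)\<^sup>2 = (LINT t|lebesgue. (f t)\<^sup>2)"
  unfolding L2.nm_sq by (simp add: L2_ip_eq power2_eq_square)

lemma L2_nm_cong_AE:
  assumes "f \<in> L2_funs" "g \<in> L2_funs" "AE t in lebesgue. f t = g t"
  shows "L2.nm f = L2.nm g"
proof -
  have "(LINT t|lebesgue. f t * f t) = (LINT t|lebesgue. g t * g t)"
    using assms L2_funsD(2)[of f] L2_funsD(2)[of g] by (intro integral_cong_AE) auto
  then show ?thesis using assms by (simp add: L2.nm_def L2_ip_eq)
qed

lemma L2_nm_dominated_convergence:
  assumes f: "\<And>k. f k \<in> L2_funs" and g: "g \<in> L2_funs" and h: "h \<in> L2_funs"
    and lim: "\<And>t. (\<lambda>k. f k t) \<longlonglongrightarrow> g t" and le: "\<And>k t. \<bar>f k t\<bar> \<le> \<bar>h t\<bar>"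
  shows "(\<lambda>k. L2.nm (f k - g)) \<longlonglongrightarrow> 0"
proof -
  have gle: "\<bar>g t\<bar> \<le> \<bar>h t\<bar>" for t
    by (rule LIMSEQ_le_const2[OF tendsto_rabs[OF lim]]) (use le in auto)
  have fg: "f k - g \<in> L2_funs" for k using f g by auto
  have "(\<lambda>k. LINT t|lebesgue. ((f k - g) t)\<^sup>2) \<longlonglongrightarrow> (LINT t|(lebesgue :: real measure). 0)"
  proof (rule integral_dominated_convergence[where w="\<lambda>t. 4 * (h t)\<^sup>2"])
    show "(\<lambda>t. ((f k - g) t)\<^sup>2) \<in> borel_measurable lebesgue" for k
      using L2_funsD(2)[OF fg] by measurable
    show "integrable lebesgue (\<lambda>t. 4 * (h t)\<^sup>2)" using L2_funsD(3)[OF h] by simp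
    show "AE t in lebesgue. (\<lambda>k. ((f k - g) t)\<^sup>2) \<longlonglongrightarrow> 0"
    proof (rule AE_I2)
      fix t
      have "(\<lambda>k. (f k t - g t)\<^sup>2) \<longlonglongrightarrow> (g t - g t)\<^sup>2" by (intro tendsto_intros lim)
      then show "(\<lambda>k. ((f k - g) t)\<^sup>2) \<longlonglongrightarrow> 0" by simp
    qed
    show "AE t in lebesgue. norm (((f k - g) t)\<^sup>2) \<le> 4 * (h t)\<^sup>2" for k
    proof (rule AE_I2)
      fix t
      have "\<bar>f k t - g t\<bar> \<le> 2 * \<bar>h t\<bar>" using le[of k t] gle[of t] by linarith
      then have "\<bar>f k t - g t\<bar>\<^sup>2 \<le> (2 * \<bar>h t\<bar>)\<^sup>2" by (rule power_mono) simp
      then show "norm (((f k - g) t)\<^sup>2) \<le> 4 * (h t)\<^sup>2" by (simp add: power_mult_distrib)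
    qed
  qed simp
  then have "(\<lambda>k. (L2.nm (f k - g))\<^sup>2) \<longlonglongrightarrow> 0" using fg by (simp add: L2_nm_sq)
  then have "(\<lambda>k. sqrt ((L2.nm (f k - g))\<^sup>2)) \<longlonglongrightarrow> sqrt 0" by (rule tendsto_real_sqrt)
  then show ?thesis using fg by simp
qed

section \<open>Step functions and their density in L2\<close>

definition step_fun :: "real set \<Rightarrow> (real \<Rightarrow> real) \<Rightarrow> real \<Rightarrow> real" where
  "step_fun J c x = (\<Sum>t\<in>J. c t * indicator {-1/2<..t} x)"

text \<open>The Wiener integral of \<open>step_fun J c\<close> against the observed path: each
  indicator of \<open>{-1/2<..t}\<close> is replaced by the increment of \<open>y\<close> over that
  interval.\<close>

definition step_statistic :: "real set \<Rightarrow> (real \<Rightarrow> real) \<Rightarrow> (real \<Rightarrow> real) \<Rightarrow> real" where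
  "step_statistic J c y = (\<Sum>t\<in>J. c t * (y t - y (-1/2)))"

lemma indicator_window_L2:
  assumes "B \<in> sets lebesgue"
  shows "indicator (B \<inter> unit_window) \<in> L2_funs"
proof -
  have "B \<inter> unit_window \<in> lmeasurable"
    using assms by (intro bounded_set_imp_lmeasurable bounded_Int) auto
  then have "integrable lebesgue (indicator (B \<inter> unit_window) :: real \<Rightarrow> real)"
    by (intro integrable_real_indicator fmeasurableD) (auto simp: fmeasurable_def)
  moreover have "(\<lambda>x. (indicator (B \<inter> unit_window) x :: real)\<^sup>2) = indicator (B \<inter> unit_window)"
    by (auto simp: indicator_def)
  moreover have "(indicator (B \<inter> unit_window) :: real \<Rightarrow> real) \<in> borel_measurable lebesgue"
    using assms by (intro borel_measurable_indicator sets.Int) auto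
  ultimately show ?thesis
    unfolding L2_funs_def by (intro CollectI conjI allI impI) (simp_all only:, simp)
qed

lemma L2_window_dominated:
  assumes g: "g \<in> L2_funs" and u: "u \<in> borel_measurable lebesgue"
    and le: "\<And>t. t \<in> unit_window \<Longrightarrow> \<bar>u t\<bar> \<le> \<bar>g t\<bar>"
  shows "(\<lambda>x. u x * indicator unit_window x) \<in> L2_funs"
proof (rule L2_dominated[OF g])
  have "indicator (UNIV \<inter> unit_window) \<in> L2_funs" by (rule indicator_window_L2) simp
  from L2_funsD(2)[OF this] have "(indicator unit_window :: real \<Rightarrow> real) \<in> borel_measurable lebesgue"
    by (simp only: Int_UNIV_left)
  with u show "(\<lambda>x. u x * indicator unit_window x) \<in> borel_measurable lebesgue"
    by (rule borel_measurable_times)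
  show "\<bar>u t * indicator unit_window t\<bar> \<le> \<bar>g t\<bar>" for t
    using le[of t] by (cases "t \<in> unit_window") auto
qed

lemma indicator_Ioc_L2:
  assumes "s \<in> unit_window" "t \<in> unit_window"
  shows "indicator {s<..t} \<in> L2_funs"
proof -
  have "{s<..t} \<inter> unit_window = {s<..t}" using assms by auto
  then show ?thesis using indicator_window_L2[of "{s<..t}"] by simp
qed

lemma L2_funs_sum:
  assumes "\<And>i. i \<in> I \<Longrightarrow> f i \<in> L2_funs"
  shows "(\<lambda>x. \<Sum>i\<in>I. c i * f i x) \<in> L2_funs"
  using assms
proof (induction I rule: infinite_finite_induct)
  case (insert i I)
  then have "(\<lambda>x. c i * f i x + (\<Sum>i\<in>I. c i * f i x)) \<in> L2_funs"
    by (intro L2_funs_add L2_funs_scale) auto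
  then show ?case using insert by simp
qed (use L2.H_closed(1) in \<open>auto simp: zero_fun_def\<close>)

lemma step_fun_L2: "J \<subseteq> unit_window \<Longrightarrow> step_fun J c \<in> L2_funs"
  unfolding step_fun_def[abs_def] by (intro L2_funs_sum indicator_Ioc_L2) auto

text \<open>Padding with zero coefficients brings two step functions to a common set of times, where
  \<open>step_lincomb\<close> works coefficientwise.\<close>

lemma step_extend:
  assumes "finite J'" "J \<subseteq> J'"
  shows "step_fun J c = step_fun J' (\<lambda>t. if t \<in> J then c t else 0)"
    and "step_statistic J c = step_statistic J' (\<lambda>t. if t \<in> J then c t else 0)"
proof -
  have "(\<Sum>t\<in>J. c t * g t) = (\<Sum>t\<in>J'. (if t \<in> J then c t else 0) * g t)" for g :: "real \<Rightarrow> real"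
    by (rule sum.mono_neutral_cong_left) (use assms in auto)
  then show "step_fun J c = step_fun J' (\<lambda>t. if t \<in> J then c t else 0)"
    and "step_statistic J c = step_statistic J' (\<lambda>t. if t \<in> J then c t else 0)"
    by (simp_all add: fun_eq_iff step_fun_def step_statistic_def)
qed

lemma step_lincomb:
  "a * step_fun J c x + b * step_fun J d x = step_fun J (\<lambda>t. a * c t + b * d t) x"
  "a * step_statistic J c y + b * step_statistic J d y = step_statistic J (\<lambda>t. a * c t + b * d t) y"
  unfolding step_fun_def step_statistic_def
  by (simp_all add: sum_distrib_left sum.distrib[symmetric] algebra_simps)

definition step_approximable :: "(real \<Rightarrow> real) \<Rightarrow> bool" where
  "step_approximable f \<longleftrightarrow> f \<in> L2_funs \<and>
    (\<forall>e>0. \<exists>J c. finite J \<and> J \<subseteq> unit_window \<and> L2.nm (step_fun J c - f) < e)"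

lemma step_approximable_lincomb:
  assumes f: "step_approximable f" and g: "step_approximable g"
  shows "step_approximable (\<lambda>x. a * f x + b * g x)"
  unfolding step_approximable_def
proof (intro conjI allI impI)
  have fg: "f \<in> L2_funs" "g \<in> L2_funs" using f g by (auto simp: step_approximable_def)
  show "(\<lambda>x. a * f x + b * g x) \<in> L2_funs" using fg by (intro L2_funs_add L2_funs_scale)
  fix e :: real assume e: "0 < e"
  define r where "r = e / (\<bar>a\<bar> + \<bar>b\<bar> + 1)"
  have r: "0 < r" using e by (simp add: r_def)
  obtain J c where J: "finite J" "J \<subseteq> unit_window" "L2.nm (step_fun J c - f) < r"
    using f r unfolding step_approximable_def by blast
  obtain J' c' where J': "finite J'" "J' \<subseteq> unit_window" "L2.nm (step_fun J' c' - g) < r"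
    using g r unfolding step_approximable_def by blast
  define K where "K = J \<union> J'"
  define d where "d t = a * (if t \<in> J then c t else 0) + b * (if t \<in> J' then c' t else 0)" for t
  have K: "finite K" "K \<subseteq> unit_window" "J \<subseteq> K" "J' \<subseteq> K" using J J' by (auto simp: K_def)
  have s: "step_fun J c - f \<in> L2_funs" "step_fun J' c' - g \<in> L2_funs"
    using J J' fg step_fun_L2 by (metis L2.H_closed(3))+
  have "step_fun K d - (\<lambda>x. a * f x + b * g x) = a *\<^sub>R (step_fun J c - f) + b *\<^sub>R (step_fun J' c' - g)"
    unfolding step_extend(1)[OF K(1,3)] step_extend(1)[OF K(1,4)] d_def
    by (auto simp: fun_eq_iff scaleR_fun_def step_lincomb[symmetric] algebra_simps)
  then have "L2.nm (step_fun K d - (\<lambda>x. a * f x + b * g x)) \<le> \<bar>a\<bar> * L2.nm (step_fun J c - f) + \<bar>b\<bar> * L2.nm (step_fun J' c' - g)"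
    using L2.nm_triangle[of "a *\<^sub>R (step_fun J c - f)" "b *\<^sub>R (step_fun J' c' - g)"] s
    by (simp add: L2.nm_scale L2.H_closed)
  also have "\<dots> \<le> \<bar>a\<bar> * r + \<bar>b\<bar> * r"
    using J J' by (intro add_mono mult_left_mono) auto
  also have "\<dots> < (\<bar>a\<bar> + \<bar>b\<bar> + 1) * r" using r by (simp add: algebra_simps)
  also have "\<dots> = e" by (simp add: r_def add_nonneg_eq_0_iff)
  finally show "\<exists>J c. finite J \<and> J \<subseteq> unit_window \<and> L2.nm (step_fun J c - (\<lambda>x. a * f x + b * g x)) < e"
    using K by blast
qed

lemma step_approximable_limit:
  assumes f: "\<And>k. step_approximable (f k)" and g: "g \<in> L2_funs"
    and lim: "(\<lambda>k. L2.nm (f k - g)) \<longlonglongrightarrow> 0"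
  shows "step_approximable g"
  unfolding step_approximable_def
proof (intro conjI allI impI g)
  fix e :: real assume e: "0 < e"
  have fL: "f k \<in> L2_funs" for k using f by (auto simp: step_approximable_def)
  have "\<forall>\<^sub>F k in sequentially. L2.nm (f k - g) < e / 2"
    by (rule order_tendstoD(2)[OF lim]) (use e in simp)
  then obtain k where k: "L2.nm (f k - g) < e / 2" by (auto simp: eventually_sequentially)
  have "0 < e / 2" using e by simp
  then obtain J c where J: "finite J" "J \<subseteq> unit_window" "L2.nm (step_fun J c - f k) < e / 2"
    using f[of k] unfolding step_approximable_def by blast
  have "L2.nm (step_fun J c - g) \<le> L2.nm (step_fun J c - f k) + L2.nm (f k - g)"
    by (rule L2.nm_triangle_diff[OF step_fun_L2[OF J(2)] fL g])
  then show "\<exists>J c. finite J \<and> J \<subseteq> unit_window \<and> L2.nm (step_fun J c - g) < e"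
    using J k by (intro exI[of _ J] exI[of _ c]) auto
qed

lemma step_approximable_cong_AE:
  assumes f: "step_approximable f" and g: "g \<in> L2_funs" and eq: "AE t in lebesgue. f t = g t"
  shows "step_approximable g"
proof (rule step_approximable_limit[of "\<lambda>_. f"])
  have fL: "f \<in> L2_funs" using f by (auto simp: step_approximable_def)
  have "L2.nm (f - g) = L2.nm 0"
    by (rule L2_nm_cong_AE) (use fL g eq in auto)
  then show "(\<lambda>k. L2.nm (f - g)) \<longlonglongrightarrow> 0" by simp
qed (use f g in auto)

lemma step_approximable_step: "finite J \<Longrightarrow> J \<subseteq> unit_window \<Longrightarrow> step_approximable (step_fun J c)"
  unfolding step_approximable_def using step_fun_L2[of J c] by (auto intro!: exI[of _ J] exI[of _ c])

text \<open>Closed half lines form an intersection-stable generator and give single steps;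
  complements within the window are differences, and disjoint unions are dominated limits of sums.
  Hence induction over disjoint unions applies.\<close>

lemma step_approximable_indicator_borel:
  assumes "B \<in> sets borel"
  shows "step_approximable (indicator (B \<inter> unit_window))"
proof -
  define gen where "gen = range (\<lambda>a::real. {..a})"
  have sb: "sets borel = sigma_sets UNIV gen"
    unfolding borel_eq_atMost gen_def by (simp add: sets_measure_of)
  have leb: "A \<in> sets lebesgue" if "A \<in> sigma_sets UNIV gen" for A
    using that by (simp flip: sb)
  have base: "step_approximable (indicator ({..a} \<inter> unit_window))" for a :: real
  proof (cases "a < -1/2")
    case True
    then have "indicator ({..a} \<inter> unit_window) = step_fun {} (\<lambda>_. 0)"
      by (auto simp: fun_eq_iff step_fun_def indicator_def)
    then show ?thesis using step_approximable_step[of "{}"] by simp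
  next
    case False
    \<comment> \<open>\<open>a\<close> is capped at the right end of the window. The step omits the
      point -1/2, which is null.\<close>
    define b where "b = min a (1/2)"
    have b: "b \<in> unit_window" using False by (auto simp: b_def)
    have "step_approximable (step_fun {b} (\<lambda>_. 1))" using b by (intro step_approximable_step) auto
    then show ?thesis
    proof (rule step_approximable_cong_AE)
      show "indicator ({..a} \<inter> unit_window) \<in> L2_funs" by (intro indicator_window_L2) auto
      have "AE t in lebesgue. t \<notin> {-1/2::real}"
        by (intro AE_not_in null_sets_completionI) (simp add: null_sets_def)
      then show "AE t in lebesgue. step_fun {b} (\<lambda>_. 1) t = indicator ({..a} \<inter> unit_window) t"
        by eventually_elim (auto simp: step_fun_def indicator_def b_def)
    qed
  qed
  have "Int_stable gen" by (auto simp: Int_stable_def gen_def)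
  moreover have "gen \<subseteq> Pow UNIV" by simp
  moreover have "B \<in> sigma_sets UNIV gen" using assms by (simp add: sb)
  ultimately show ?thesis
  proof (induction rule: sigma_sets_induct_disjoint)
    case (basic A)
    then show ?case using base by (auto simp: gen_def)
  next
    case empty
    show ?case using step_approximable_step[of "{}" "\<lambda>_. 0"] by (simp add: step_fun_def[abs_def] indicator_def[abs_def])
  next
    case (compl A)
    have "step_approximable (\<lambda>x. 1 * indicator ({..1} \<inter> unit_window) x + (-1) * indicator (A \<inter> unit_window) x)"
      by (intro step_approximable_lincomb base compl)
    also have "(\<lambda>x. 1 * indicator ({..1} \<inter> unit_window) x + (-1) * indicator (A \<inter> unit_window) x)
      = (indicator ((UNIV - A) \<inter> unit_window) :: real \<Rightarrow> real)"
      by (auto simp: fun_eq_iff indicator_def)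
    finally show ?case .
  next
    case (union A)
    have part: "step_approximable (indicator ((\<Union>i<k. A i) \<inter> unit_window))" for k :: nat
    proof (induction k)
      case 0
      show ?case using step_approximable_step[of "{}" "\<lambda>_. 0"] by (simp add: step_fun_def[abs_def] indicator_def[abs_def])
    next
      case (Suc k)
      have "step_approximable (\<lambda>x. 1 * indicator ((\<Union>i<k. A i) \<inter> unit_window) x + 1 * indicator (A k \<inter> unit_window) x)"
        by (intro step_approximable_lincomb Suc union)
      also have "(\<lambda>x. 1 * indicator ((\<Union>i<k. A i) \<inter> unit_window) x + 1 * indicator (A k \<inter> unit_window) x)
        = (indicator ((\<Union>i<Suc k. A i) \<inter> unit_window) :: real \<Rightarrow> real)"
      proof -
        have "A i \<inter> A k = {}" if "i < k" for i
          using union(1) that by (auto simp: disjoint_family_on_def)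
        then show ?thesis by (fastforce simp: fun_eq_iff indicator_def lessThan_Suc)
      qed
      finally show ?case .
    qed
    have UN: "(\<Union>i. A i) \<in> sets lebesgue" using union(2) leb by (intro sets.countable_UN) auto
    show ?case
    proof (rule step_approximable_limit[OF part])
      show "indicator ((\<Union>i. A i) \<inter> unit_window) \<in> L2_funs" by (rule indicator_window_L2[OF UN])
      show "(\<lambda>k. L2.nm (indicator ((\<Union>i<k. A i) \<inter> unit_window) - indicator ((\<Union>i. A i) \<inter> unit_window))) \<longlonglongrightarrow> 0"
      proof (rule L2_nm_dominated_convergence)
        show "indicator ((\<Union>i<k. A i) \<inter> unit_window) \<in> L2_funs" for k
          using part[of k] by (simp add: step_approximable_def)
        show "indicator ((\<Union>i. A i) \<inter> unit_window) \<in> L2_funs" by (rule indicator_window_L2[OF UN])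
        show "(indicator (UNIV \<inter> unit_window) :: real \<Rightarrow> real) \<in> L2_funs" by (intro indicator_window_L2) auto
        show "\<bar>indicator ((\<Union>i<k. A i) \<inter> unit_window) t :: real\<bar> \<le> \<bar>indicator (UNIV \<inter> unit_window) t\<bar>" for k t
          by (auto simp: indicator_def)
        show "(\<lambda>k. indicator ((\<Union>i<k. A i) \<inter> unit_window) t :: real) \<longlonglongrightarrow> indicator ((\<Union>i. A i) \<inter> unit_window) t" for t
        proof (cases "t \<in> (\<Union>i. A i) \<inter> unit_window")
          case True
          then obtain i where i: "t \<in> A i" "t \<in> unit_window" by auto
          have "\<forall>\<^sub>F k in sequentially. indicator ((\<Union>i<k. A i) \<inter> unit_window) t = (1::real)"
            using eventually_gt_at_top[of i] by eventually_elim (use i in \<open>auto simp: indicator_def\<close>)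
          then show ?thesis using True by (simp add: tendsto_eventually)
        next
          case False
          then have "t \<notin> (\<Union>i<k. A i) \<inter> unit_window" for k by auto
          then have "indicator ((\<Union>i<k. A i) \<inter> unit_window) t = (0 :: real)" for k
            by (rule indicator_simps(2))
          moreover have "indicator ((\<Union>i. A i) \<inter> unit_window) t = (0 :: real)"
            using False by (rule indicator_simps(2))
          ultimately show ?thesis by (simp only: tendsto_const)
        qed
      qed
    qed
  qed
qed

lemma step_approximable_indicator:
  assumes B: "B \<in> sets lebesgue"
  shows "step_approximable (indicator (B \<inter> unit_window))"
proof -
  obtain C N N' where C: "B = C \<union> N" "C \<in> sets borel" "N \<subseteq> N'" "N' \<in> null_sets lborel"
    using B by (auto elim: sets_completionE)
  show ?thesis
  proof (rule step_approximable_cong_AE[OF step_approximable_indicator_borel[OF C(2)]])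
    show "indicator (B \<inter> unit_window) \<in> L2_funs" by (rule indicator_window_L2[OF B])
    have "AE t in lebesgue. t \<notin> N'" by (intro AE_not_in null_sets_completionI C)
    then show "AE t in lebesgue. indicator (C \<inter> unit_window) t = (indicator (B \<inter> unit_window) t :: real)"
      by eventually_elim (use C in \<open>auto simp: indicator_def\<close>)
  qed
qed

lemma step_approximable_nonneg:
  assumes "u \<in> borel_measurable lebesgue" "\<And>x. 0 \<le> u x"
    and "(\<lambda>x. u x * indicator unit_window x) \<in> L2_funs"
  shows "step_approximable (\<lambda>x. u x * indicator unit_window x)"
  using assms
proof (induction rule: borel_measurable_induct_real)
  case (set A)
  have "(\<lambda>x. indicator A x * indicator unit_window x :: real) = indicator (A \<inter> unit_window)"
    by (auto simp: fun_eq_iff indicator_def)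
  then show ?case using step_approximable_indicator[OF set(1)] by simp
next
  case (mult u c)
  show ?case
  \<comment> \<open>Square integrability is known for \<open>c * u\<close>; passing to
    \<open>u\<close>, as the induction hypothesis requires, means dividing by
    \<open>c\<close>.\<close>
  proof (cases "c = 0")
    case True
    then show ?thesis using step_approximable_step[of "{}" "\<lambda>_. 0"] by (simp add: step_fun_def[abs_def])
  next
    case False
    have "(\<lambda>x. (1/c) * (c * u x * indicator unit_window x)) \<in> L2_funs"
      by (rule L2_funs_scale[OF mult.prems])
    then have "step_approximable (\<lambda>x. u x * indicator unit_window x)" using mult.IH False by simp
    from step_approximable_lincomb[OF this this, of c 0] show ?thesis by (simp add: mult.assoc)
  qed
next
  case (add u v)
  \<comment> \<open>Both summands are nonnegative, so each is dominated by the sum and inherits its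
    square integrability.\<close>
  have le: "\<bar>u t\<bar> \<le> \<bar>(v t + u t) * indicator unit_window t\<bar>"
    "\<bar>v t\<bar> \<le> \<bar>(v t + u t) * indicator unit_window t\<bar>" if "t \<in> unit_window" for t
    using add.hyps(2,4)[of t] that by (auto simp: indicator_def)
  have "(\<lambda>x. u x * indicator unit_window x) \<in> L2_funs"
    by (rule L2_window_dominated[OF add.prems add.hyps(1) le(1)])
  moreover have "(\<lambda>x. v x * indicator unit_window x) \<in> L2_funs"
    by (rule L2_window_dominated[OF add.prems add.hyps(3) le(2)])
  ultimately have "step_approximable (\<lambda>x. 1 * (v x * indicator unit_window x) + 1 * (u x * indicator unit_window x))"
    by (intro step_approximable_lincomb add.IH)
  then show ?case by (simp add: distrib_right)
next
  case (seq U)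
  have le: "U k x \<le> u x" for k x
    using seq.hyps(3,4) by (intro incseq_le[of "\<lambda>k. U k x"]) (auto simp: incseq_def le_fun_def)
  have abs_le: "\<bar>U k t * indicator unit_window t\<bar> \<le> \<bar>u t * indicator unit_window t\<bar>" for k t
    using le[of k t] seq.hyps(2)[of k t] by (auto simp: indicator_def)
  have UL: "(\<lambda>x. U k x * indicator unit_window x) \<in> L2_funs" for k
  proof (rule L2_window_dominated[OF seq.prems seq.hyps(1)])
    show "\<bar>U k t\<bar> \<le> \<bar>u t * indicator unit_window t\<bar>" if "t \<in> unit_window" for t
      using abs_le[of k t] that by simp
  qed
  show ?case
  proof (rule step_approximable_limit)
    show "step_approximable (\<lambda>x. U k x * indicator unit_window x)" for k by (rule seq.IH[OF UL])
    show "(\<lambda>k. L2.nm ((\<lambda>x. U k x * indicator unit_window x) - (\<lambda>x. u x * indicator unit_window x))) \<longlonglongrightarrow> 0"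
    proof (rule L2_nm_dominated_convergence[OF UL seq.prems seq.prems])
      show "(\<lambda>k. U k t * indicator unit_window t) \<longlonglongrightarrow> u t * indicator unit_window t" for t
        using seq.hyps(4)[of t] by (intro tendsto_intros) auto
    qed (rule abs_le)
  qed (rule seq.prems)
qed

lemma step_approximable_L2:
  assumes h: "h \<in> L2_funs"
  shows "step_approximable h"
proof -
  note hm[measurable] = L2_funsD(2)[OF h]
  define p where "p x = max 0 (h x)" for x
  define q where "q x = max 0 (- h x)" for x
  have m: "p \<in> borel_measurable lebesgue" "q \<in> borel_measurable lebesgue"
    unfolding p_def q_def by measurable
  have "step_approximable (\<lambda>x. p x * indicator unit_window x)"
    using m by (intro step_approximable_nonneg L2_window_dominated[OF h]) (auto simp: p_def)
  moreover have "step_approximable (\<lambda>x. q x * indicator unit_window x)"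
    using m by (intro step_approximable_nonneg L2_window_dominated[OF h]) (auto simp: q_def)
  ultimately have "step_approximable (\<lambda>x. 1 * (p x * indicator unit_window x) + (-1) * (q x * indicator unit_window x))"
    by (rule step_approximable_lincomb)
  also have "(\<lambda>x. 1 * (p x * indicator unit_window x) + (-1) * (q x * indicator unit_window x)) = h"
    using L2_funsD(1)[OF h] by (auto simp: fun_eq_iff p_def q_def indicator_def)
  finally show ?thesis .
qed

section \<open>The white noise model\<close>

text \<open>Starting at the left endpoint, path values are sums of increments; strict growth gives
  every increment a positive variance.\<close>

definition grid :: "nat \<Rightarrow> (nat \<Rightarrow> real) \<Rightarrow> bool" where
  "grid m \<tau> \<longleftrightarrow> \<tau> 0 = -1/2 \<and> strict_mono_on {..m} \<tau> \<and> \<tau> ` {..m} \<subseteq> unit_window"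

lemma grid_window: "grid m \<tau> \<Longrightarrow> i \<le> m \<Longrightarrow> \<tau> i \<in> unit_window"
  by (auto simp: grid_def image_subset_iff)

lemma grid_less: "grid m \<tau> \<Longrightarrow> i < j \<Longrightarrow> j \<le> m \<Longrightarrow> \<tau> i < \<tau> j"
  by (auto simp: grid_def strict_mono_on_def)

lemma grid_le: "grid m \<tau> \<Longrightarrow> i \<le> j \<Longrightarrow> j \<le> m \<Longrightarrow> \<tau> i \<le> \<tau> j"
  using grid_less[of m \<tau> i j] by (cases "i = j") auto

lemma grid_exists:
  assumes J: "finite J" "J \<subseteq> unit_window"
  obtains m \<tau> where "grid m \<tau>" "\<tau> ` {..m} = insert (-1/2) J"
proof -
  define K where "K = insert (-1/2) J"
  define l where "l = sorted_list_of_set K"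
  have K: "finite K" "K \<noteq> {}" "-1/2 \<in> K" "K \<subseteq> unit_window" using J by (auto simp: K_def)
  have sl: "sorted_wrt (<) l" "set l = K" "l \<noteq> []"
    using K by (auto simp: l_def)
  define m where "m = length l - 1"
  have len: "i \<le> m \<longleftrightarrow> i < length l" for i using sl by (cases l) (auto simp: m_def)
  have less: "l ! i < l ! j" if "i < j" "j \<le> m" for i j
    using that sl(1) by (simp add: len sorted_wrt_iff_nth_less)
  have img: "(!) l ` {..m} = K"
    using sl(2) by (auto simp: set_conv_nth len image_iff)
  have "l ! 0 = -1/2"
  proof -
    obtain j where j: "j \<le> m" "l ! j = -1/2" using img K(3) by (metis atMost_iff imageE)
    have "l ! 0 \<in> unit_window" using img K(4) by auto
    then have "\<not> 0 < j" using less[of 0 j] j by auto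
    then show ?thesis using j by simp
  qed
  then have "grid m ((!) l)"
    using less img K(4) by (auto simp: grid_def strict_mono_on_def)
  then show thesis using img that by (simp add: K_def)
qed

text \<open>Summation by parts: the increment from \<open>i\<close> to \<open>Suc i\<close> is
  collected by every \<open>j > i\<close>.\<close>

lemma sum_telescope_weights:
  fixes d y :: "nat \<Rightarrow> real"
  shows "(\<Sum>j\<le>m. d j * (y j - y 0)) = (\<Sum>i<m. (\<Sum>j\<in>{i<..m}. d j) * (y (Suc i) - y i))"
proof (induction m)
  case (Suc m)
  have "(\<Sum>j\<in>{i<..Suc m}. d j) = (\<Sum>j\<in>{i<..m}. d j) + d (Suc m)" if "i \<le> m" for i
  proof -
    have "{i<..Suc m} = insert (Suc m) {i<..m}" using that by auto
    then show ?thesis by simp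
  qed
  then have "(\<Sum>i<Suc m. (\<Sum>j\<in>{i<..Suc m}. d j) * (y (Suc i) - y i))
    = (\<Sum>i<Suc m. (\<Sum>j\<in>{i<..m}. d j) * (y (Suc i) - y i) + d (Suc m) * (y (Suc i) - y i))"
    by (intro sum.cong) (auto simp: distrib_right)
  also have "\<dots> = (\<Sum>i<Suc m. (\<Sum>j\<in>{i<..m}. d j) * (y (Suc i) - y i)) + d (Suc m) * (\<Sum>i<Suc m. y (Suc i) - y i)"
    by (simp add: sum.distrib sum_distrib_left del: sum.lessThan_Suc)
  also have "\<dots> = (\<Sum>i<m. (\<Sum>j\<in>{i<..m}. d j) * (y (Suc i) - y i)) + d (Suc m) * (y (Suc m) - y 0)"
    unfolding sum_lessThan_telescope by simp
  finally show ?case using Suc by simp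
qed simp

text \<open>The intervals \<open>{-1/2<..t}\<close> overlap; successive intervals instead have
  orthogonal indicators and independent noise. The identity \<open>key\<close> holds for every
  \<open>y\<close>, so the same coefficients serve the statistic and, with \<open>y t\<close> the
  indicator of \<open>{-1/2<..t}\<close> at \<open>x\<close>, the step function.\<close>

lemma step_normal_form:
  assumes J: "finite J" "J \<subseteq> unit_window"
  obtains m \<tau> C where "grid m \<tau>"
    "step_fun J c = (\<lambda>x. \<Sum>i<m. C i * indicator {\<tau> i<..\<tau> (Suc i)} x)"
    "step_statistic J c = (\<lambda>y. \<Sum>i<m. C i * (y (\<tau> (Suc i)) - y (\<tau> i)))"
proof -
  obtain m \<tau> where g: "grid m \<tau>" and img: "\<tau> ` {..m} = insert (-1/2) J" by (rule grid_exists[OF J])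
  define d where "d j = (if \<tau> j \<in> J then c (\<tau> j) else 0)" for j
  define C where "C i = (\<Sum>j\<in>{i<..m}. d j)" for i
  have inj: "inj_on \<tau> {..m}" using g strict_mono_on_imp_inj_on by (auto simp: grid_def)
  have \<tau>0: "\<tau> 0 = -1/2" using g by (simp add: grid_def)
  have key: "(\<Sum>t\<in>J. c t * (y t - y (-1/2))) = (\<Sum>i<m. C i * (y (\<tau> (Suc i)) - y (\<tau> i)))" for y :: "real \<Rightarrow> real"
  proof -
    have "(\<Sum>t\<in>J. c t * (y t - y (-1/2))) = (\<Sum>t\<in>\<tau> ` {..m}. (if t \<in> J then c t else 0) * (y t - y (-1/2)))"
      unfolding img by (rule sum.mono_neutral_cong_left) (use J in auto)
    also have "\<dots> = (\<Sum>j\<le>m. d j * (y (\<tau> j) - y (\<tau> 0)))"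
      by (simp add: sum.reindex[OF inj] d_def \<tau>0)
    also have "\<dots> = (\<Sum>i<m. C i * (y (\<tau> (Suc i)) - y (\<tau> i)))"
      unfolding C_def by (rule sum_telescope_weights)
    finally show ?thesis .
  qed
  show thesis
  proof (rule that[OF g])
    show "step_statistic J c = (\<lambda>y. \<Sum>i<m. C i * (y (\<tau> (Suc i)) - y (\<tau> i)))"
      by (rule ext) (unfold step_statistic_def, rule key)
    show "step_fun J c = (\<lambda>x. \<Sum>i<m. C i * indicator {\<tau> i<..\<tau> (Suc i)} x)"
    proof (rule ext)
      fix x
      \<comment> \<open>The subtracted interval is empty; it only brings the sum into the form of
        \<open>key\<close>.\<close>
      have "step_fun J c x = (\<Sum>t\<in>J. c t * (indicator {-1/2<..t} x - indicator {-1/2<..-1/2} x))"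
        by (simp add: step_fun_def)
      also have "\<dots> = (\<Sum>i<m. C i * (indicator {-1/2<..\<tau> (Suc i)} x - indicator {-1/2<..\<tau> i} x))"
        using key[of "\<lambda>t. indicator {-1/2<..t} x"] .
      also have "\<dots> = (\<Sum>i<m. C i * indicator {\<tau> i<..\<tau> (Suc i)} x)"
      proof (intro sum.cong refl)
        fix i assume "i \<in> {..<m}"
        then have "-1/2 \<le> \<tau> i" "\<tau> i \<le> \<tau> (Suc i)"
          using grid_window[OF g, of i] grid_le[OF g, of i "Suc i"] by auto
        then show "C i * (indicator {-1/2<..\<tau> (Suc i)} x - indicator {-1/2<..\<tau> i} x) = C i * indicator {\<tau> i<..\<tau> (Suc i)} x"
          by (auto simp: indicator_def)
      qed
      finally show "step_fun J c x = (\<Sum>i<m. C i * indicator {\<tau> i<..\<tau> (Suc i)} x)" .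
    qed
  qed
qed

section \<open>Orthogonality of grid indicators and Bessel's inequality\<close>

lemma L2_ip_sum:
  assumes f: "\<And>i. i \<in> I \<Longrightarrow> f i \<in> L2_funs" and g: "g \<in> L2_funs"
  shows "L2_ip (\<lambda>x. \<Sum>i\<in>I. c i * f i x) g = (\<Sum>i\<in>I. c i * L2_ip (f i) g)"
proof -
  have "(\<lambda>x. \<Sum>i\<in>I. c i * f i x) \<in> L2_funs" using f by (rule L2_funs_sum)
  then have "L2_ip (\<lambda>x. \<Sum>i\<in>I. c i * f i x) g = (LINT x|lebesgue. (\<Sum>i\<in>I. c i * (f i x * g x)))"
    by (simp add: L2_ip_eq sum_distrib_right mult.assoc)
  also have "\<dots> = (\<Sum>i\<in>I. LINT x|lebesgue. c i * (f i x * g x))"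
    using f g by (intro Bochner_Integration.integral_sum integrable_mult_right L2_mult_integrable)
  finally show ?thesis using f by (simp add: L2_ip_eq)
qed

lemma grid_indicator_L2: "grid m \<tau> \<Longrightarrow> i < m \<Longrightarrow> indicator {\<tau> i<..\<tau> (Suc i)} \<in> L2_funs"
  by (intro indicator_Ioc_L2 grid_window) auto

lemma grid_indicator_ip:
  assumes g: "grid m \<tau>" and ij: "i < m" "j < m"
  shows "L2_ip (indicator {\<tau> i<..\<tau> (Suc i)}) (indicator {\<tau> j<..\<tau> (Suc j)})
    = (if i = j then \<tau> (Suc i) - \<tau> i else 0)"
proof (cases "i = j")
  case True
  have "\<tau> i \<le> \<tau> (Suc i)" using grid_le[OF g, of i "Suc i"] ij by simp
  then have "(LINT t|lebesgue. indicator {\<tau> i<..\<tau> (Suc i)} t :: real) = \<tau> (Suc i) - \<tau> i"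
    by simp
  then show ?thesis
    using True grid_indicator_L2[OF g ij(1)] by (simp add: L2_ip_eq flip: indicator_inter_arith)
next
  case False
  have "{\<tau> i<..\<tau> (Suc i)} \<inter> {\<tau> j<..\<tau> (Suc j)} = {}"
  proof (cases "i < j")
    case True
    then show ?thesis using grid_le[OF g, of "Suc i" j] ij by auto
  next
    case f: False
    then show ?thesis using False grid_le[OF g, of "Suc j" i] ij by auto
  qed
  then have "(\<lambda>x. indicator {\<tau> i<..\<tau> (Suc i)} x * indicator {\<tau> j<..\<tau> (Suc j)} x :: real) = (\<lambda>x. 0)"
    by (simp add: fun_eq_iff del: Int_greaterThanAtMost flip: indicator_inter_arith)
  then show ?thesis using False by (simp add: L2_ip_eq[OF grid_indicator_L2[OF g ij(1)]])
qed

lemma grid_sum_nm_sq: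
  assumes g: "grid m \<tau>"
  shows "(L2.nm (\<lambda>x. \<Sum>i<m. C i * indicator {\<tau> i<..\<tau> (Suc i)} x))\<^sup>2 = (\<Sum>i<m. (C i * sqrt (\<tau> (Suc i) - \<tau> i))\<^sup>2)"
proof -
  let ?I = "\<lambda>i. indicator {\<tau> i<..\<tau> (Suc i)} :: real \<Rightarrow> real"
  let ?h = "\<lambda>x. \<Sum>i<m. C i * ?I i x"
  have I: "?I i \<in> L2_funs" if "i \<in> {..<m}" for i using grid_indicator_L2[OF g] that by simp
  have h: "?h \<in> L2_funs" by (intro L2_funs_sum I)
  have "(L2.nm ?h)\<^sup>2 = (\<Sum>i<m. C i * L2_ip (?I i) ?h)"
    unfolding L2.nm_sq[OF h] by (rule L2_ip_sum[OF I h])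
  also have "\<dots> = (\<Sum>i<m. C i * (C i * (\<tau> (Suc i) - \<tau> i)))"
  proof (intro sum.cong refl)
    fix i assume i: "i \<in> {..<m}"
    have "L2_ip (?I i) ?h = L2_ip ?h (?I i)" by (rule L2.ip_commute[OF I[OF i] h])
    also have "\<dots> = (\<Sum>j<m. C j * L2_ip (?I j) (?I i))" by (rule L2_ip_sum[OF I I[OF i]])
    also have "\<dots> = (\<Sum>j<m. if j = i then C i * (\<tau> (Suc i) - \<tau> i) else 0)"
      using i by (intro sum.cong refl) (auto simp: grid_indicator_ip[OF g])
    also have "\<dots> = C i * (\<tau> (Suc i) - \<tau> i)" using i by simp
    finally show "C i * L2_ip (?I i) ?h = C i * (C i * (\<tau> (Suc i) - \<tau> i))" by simp
  qed
  also have "\<dots> = (\<Sum>i<m. (C i * sqrt (\<tau> (Suc i) - \<tau> i))\<^sup>2)"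
    using grid_le[OF g] by (intro sum.cong refl) (auto simp: power_mult_distrib power2_eq_square[of "C _"])
  finally show ?thesis .
qed

text \<open>The indicators divided by the square roots of the lengths are orthonormal. For the
  projection \<open>?h\<close> of \<open>k\<close>, both the inner product with \<open>k\<close> and
  the squared norm equal \<open>B\<close>, so Cauchy--Schwarz gives
  \<open>B\<^sup>2 \<le> B * (L2.nm k)\<^sup>2\<close>.\<close>

lemma grid_bessel:
  assumes g: "grid m \<tau>" and k: "k \<in> L2_funs"
  shows "(\<Sum>i<m. (L2_ip (indicator {\<tau> i<..\<tau> (Suc i)}) k / sqrt (\<tau> (Suc i) - \<tau> i))\<^sup>2) \<le> (L2.nm k)\<^sup>2"
proof -
  let ?I = "\<lambda>i. indicator {\<tau> i<..\<tau> (Suc i)} :: real \<Rightarrow> real"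
  define a where "a i = L2_ip (?I i) k" for i
  define D where "D i = \<tau> (Suc i) - \<tau> i" for i
  define B where "B = (\<Sum>i<m. (a i / sqrt (D i))\<^sup>2)"
  have D: "0 < D i" if "i < m" for i using grid_less[OF g, of i "Suc i"] that by (simp add: D_def)
  let ?h = "\<lambda>x. \<Sum>i<m. a i / D i * ?I i x"
  have I: "?I i \<in> L2_funs" if "i \<in> {..<m}" for i using grid_indicator_L2[OF g] that by simp
  have h: "?h \<in> L2_funs" by (intro L2_funs_sum I)
  have B1: "L2_ip ?h k = B"
  proof -
    have "L2_ip ?h k = (\<Sum>i<m. a i / D i * a i)" unfolding a_def by (rule L2_ip_sum[OF I k])
    also have "\<dots> = B" unfolding B_def
      using D by (intro sum.cong refl) (auto simp: power_divide power2_eq_square[of "a _"] less_imp_le)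
    finally show ?thesis .
  qed
  have B2: "(L2.nm ?h)\<^sup>2 = B"
  proof -
    have "(a i / D i * sqrt (D i))\<^sup>2 = (a i / sqrt (D i))\<^sup>2" if "i < m" for i
      using D[OF that] by (simp add: power_mult_distrib power_divide power2_eq_square[of "D i"])
    then show ?thesis unfolding grid_sum_nm_sq[OF g] B_def D_def[symmetric] by simp
  qed
  have B0: "0 \<le> B" by (simp add: B_def sum_nonneg)
  have "B \<le> L2.nm ?h * L2.nm k" using L2.Cauchy_Schwarz[OF h k] B1 B0 by simp
  then have "B\<^sup>2 \<le> (L2.nm ?h * L2.nm k)\<^sup>2" using B0 by (rule power_mono)
  also have "\<dots> = B * (L2.nm k)\<^sup>2" unfolding power_mult_distrib B2 ..
  finally have "B \<le> (L2.nm k)\<^sup>2"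
    using B0 by (cases "B = 0") (simp_all add: power2_eq_square[of B])
  then show ?thesis by (simp add: B_def a_def D_def)
qed

text \<open>Writing the drift as an inner product makes shifts of the path accessible to Bessel's
  inequality.\<close>

lemma signal_eq_ip:
  assumes t: "t \<in> unit_window"
  shows "(LINT s:{-1/2..t}|lebesgue. f s) = L2_ip (indicator ({..t} \<inter> unit_window)) f"
proof -
  have "{-1/2..t} = {..t} \<inter> unit_window" using t by auto
  moreover have "indicator ({..t} \<inter> unit_window) \<in> L2_funs" by (rule indicator_window_L2) simp
  ultimately show ?thesis by (simp only: L2_ip_eq set_lebesgue_integral_def real_scaleR_def)
qed

lemma signal_diff:
  assumes st: "s \<in> unit_window" "t \<in> unit_window" "s \<le> t" and f: "f \<in> L2_funs"
  shows "(LINT x:{-1/2..t}|lebesgue. f x) - (LINT x:{-1/2..s}|lebesgue. f x) = L2_ip (indicator {s<..t}) f"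
proof -
  have I: "indicator ({..u} \<inter> unit_window) \<in> L2_funs" for u :: real
    by (rule indicator_window_L2) simp
  have "indicator {s<..t} = (indicator ({..t} \<inter> unit_window) - indicator ({..s} \<inter> unit_window) :: real \<Rightarrow> real)"
    using st by (auto simp: fun_eq_iff indicator_def)
  then show ?thesis
    using L2.ip_diff_left[OF I I f, of t s] by (simp only: signal_eq_ip[OF st(1)] signal_eq_ip[OF st(2)])
qed

lemma signal_start:
  assumes f: "f \<in> L2_funs"
  shows "(LINT s:{-1/2..-1/2}|lebesgue. f s) = 0"
proof -
  have "AE t in lebesgue. t \<notin> {-1/2::real}"
    by (intro AE_not_in null_sets_completionI) (simp add: null_sets_def)
  then have "AE t in lebesgue. indicator {-1/2..-1/2} t *\<^sub>R f t = 0"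
    by eventually_elim simp
  then show ?thesis unfolding set_lebesgue_integral_def by (rule integral_eq_zero_AE)
qed

section \<open>The white noise law as a Gaussian experiment\<close>

lemma brownian_increments:
  assumes bm: "brownian_motion \<Omega> W" and g: "grid m \<tau>"
  defines "Z \<equiv> \<lambda>i w. (W (\<tau> (Suc i)) w - W (\<tau> i) w) / sqrt (\<tau> (Suc i) - \<tau> i)"
  shows "prob_space.indep_vars \<Omega> (\<lambda>_. borel) Z {..<m}"
    and "i \<in> {..<m} \<Longrightarrow> distributed \<Omega> lborel (Z i) std_normal_density"
proof -
  interpret prob_space \<Omega> using bm by (simp add: brownian_motion_def)
  have incr: "distributed \<Omega> lborel (\<lambda>w. W t w - W s w) (normal_density 0 (sqrt (t - s)))"
    if "s \<in> unit_window" "t \<in> unit_window" "s < t" for s t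
    using bm that unfolding brownian_motion_def by blast
  have ind: "indep_vars (\<lambda>_. borel) (\<lambda>i w. W (\<tau> (Suc i)) w - W (\<tau> i) w) {..<m}"
  proof -
    have "mono_on {..m} \<tau>" by (intro mono_onI grid_le[OF g]) auto
    moreover have "\<tau> ` {..m} \<subseteq> unit_window" using g by (simp add: grid_def)
    ultimately show ?thesis using bm unfolding brownian_motion_def by blast
  qed
  show "indep_vars (\<lambda>_. borel) Z {..<m}"
    unfolding Z_def
    using indep_vars_compose2[OF ind, of "\<lambda>i x. x / sqrt (\<tau> (Suc i) - \<tau> i)" "\<lambda>_. borel"] by simp
  assume "i \<in> {..<m}"
  then have i: "i < m" by simp
  have lt: "\<tau> i < \<tau> (Suc i)" using grid_less[OF g, of i "Suc i"] i by simp
  have "distributed \<Omega> lborel (\<lambda>w. W (\<tau> (Suc i)) w - W (\<tau> i) w) (normal_density 0 (sqrt (\<tau> (Suc i) - \<tau> i)))"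
    using i by (intro incr grid_window[OF g] lt) auto
  then show "distributed \<Omega> lborel (Z i) std_normal_density"
    using normal_standard_normal_convert[of "sqrt (\<tau> (Suc i) - \<tau> i)" "\<lambda>w. W (\<tau> (Suc i)) w - W (\<tau> i) w" 0] lt
    by (simp add: Z_def)
qed

text \<open>Step functions are paired with their Wiener integrals and are dense by
  \<open>step_approximable_L2\<close>. For \<open>shift\<close>, a cylinder event is a function of
  finitely many normalised increments, which are independent standard normals shifted by
  coefficients of the signal; Bessel's inequality bounds the distance of two such shifts by the L2
  distance.\<close>

lemma gauss_experiment_white_noise:
  assumes n: "1 \<le> n" and bm: "brownian_motion \<Omega> W"
  shows "gauss_experiment L2_funs L2_ip path_space (white_noise_law \<Omega> W n) (1 / sqrt (real n))
    {(step_fun J c, step_statistic J c) | J c. finite J \<and> J \<subseteq> unit_window}"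
proof -
  define \<sigma> where "\<sigma> = 1 / sqrt (real n)"
  define R where "R = {(step_fun J c, step_statistic J c) | J c. finite J \<and> J \<subseteq> unit_window}"
  have \<sigma>: "0 < \<sigma>" using n by (simp add: \<sigma>_def)
  interpret prob_space \<Omega> using bm by (simp add: brownian_motion_def)
  have Wm: "W t \<in> borel_measurable \<Omega>" if "t \<in> unit_window" for t
    using bm that unfolding brownian_motion_def by blast
  have W0: "AE w in \<Omega>. W (-1/2) w = 0" using bm unfolding brownian_motion_def by blast
  define F where "F f t = (LINT s:{-1/2..t}|lebesgue. f s)" for f :: "real \<Rightarrow> real" and t :: real
  define Y where "Y f w = (\<lambda>t\<in>unit_window. F f t + W t w / sqrt (real n))" for f w
  have law: "white_noise_law \<Omega> W n f = distr \<Omega> path_space (Y f)" for f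
    by (simp add: white_noise_law_def Y_def[abs_def] F_def)
  have Ym[measurable]: "Y f \<in> measurable \<Omega> path_space" for f
    unfolding Y_def path_space_def
    by (intro measurable_restrict borel_measurable_add borel_measurable_const borel_measurable_divide Wm)
  have Yt: "Y f w t = F f t + \<sigma> * W t w" if "t \<in> unit_window" for f w t
    using that by (simp add: Y_def \<sigma>_def)
  have P: "prob_space (white_noise_law \<Omega> W n f)" for f
    unfolding law by (rule prob_space_distr[OF Ym])
  have mP: "measure (white_noise_law \<Omega> W n f) {y \<in> space path_space. p y} = prob {w \<in> space \<Omega>. p (Y f w)}"
    if "{y \<in> space path_space. p y} \<in> sets path_space" for f p
    unfolding law using that measurable_space[OF Ym]
    by (subst measure_distr) (auto intro!: arg_cong[where f=prob])
  have comp: "(\<lambda>y. y t) \<in> borel_measurable path_space" if "t \<in> unit_window" for t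
    using that unfolding path_space_def by measurable
  have incr: "Y f w (\<tau> (Suc i)) - Y f w (\<tau> i)
      = L2_ip (indicator {\<tau> i<..\<tau> (Suc i)}) f + \<sigma> * (W (\<tau> (Suc i)) w - W (\<tau> i) w)"
    if g: "grid m \<tau>" and i: "i < m" and f: "f \<in> L2_funs" for f w m \<tau> i
  proof -
    have win: "\<tau> i \<in> unit_window" "\<tau> (Suc i) \<in> unit_window" "\<tau> i < \<tau> (Suc i)"
      using grid_window[OF g] grid_less[OF g, of i "Suc i"] i by auto
    then have "F f (\<tau> (Suc i)) - F f (\<tau> i) = L2_ip (indicator {\<tau> i<..\<tau> (Suc i)}) f"
      unfolding F_def by (intro signal_diff f) auto
    then show ?thesis using win by (simp add: Yt algebra_simps)
  qed
  have "gauss_experiment L2_funs L2_ip path_space (white_noise_law \<Omega> W n) \<sigma> R"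
  proof (intro gauss_experiment.intro L2.semi_inner_axioms gauss_experiment_axioms.intro)
    show "0 < \<sigma>" by fact
    fix f
    show "prob_space (white_noise_law \<Omega> W n f)" by (rule P)
    show "sets (white_noise_law \<Omega> W n f) = sets path_space" by (simp add: law)
  next
    fix h X assume hX: "(h, X) \<in> R"
    obtain J c where J: "finite J" "J \<subseteq> unit_window" and h: "h = step_fun J c" and X: "X = step_statistic J c"
      using hX by (auto simp: R_def)
    show hL: "h \<in> L2_funs" unfolding h by (rule step_fun_L2[OF J(2)])
    show Xm: "X \<in> borel_measurable path_space"
      unfolding X step_statistic_def[abs_def] using J
      by (intro borel_measurable_sum borel_measurable_times borel_measurable_diff comp borel_measurable_const) auto
    fix f and z :: real assume f: "f \<in> L2_funs" and z: "0 \<le> z"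
    obtain m \<tau> C where g: "grid m \<tau>"
      and h': "h = (\<lambda>x. \<Sum>i<m. C i * indicator {\<tau> i<..\<tau> (Suc i)} x)"
      and X': "X = (\<lambda>y. \<Sum>i<m. C i * (y (\<tau> (Suc i)) - y (\<tau> i)))"
      unfolding h X by (rule step_normal_form[OF J, of c])
    define Z where "Z i w = (W (\<tau> (Suc i)) w - W (\<tau> i) w) / sqrt (\<tau> (Suc i) - \<tau> i)" for i w
    define b where "b i = C i * sqrt (\<tau> (Suc i) - \<tau> i)" for i
    note Z = brownian_increments[OF bm g, folded Z_def]
    have WZ: "C i * (W (\<tau> (Suc i)) w - W (\<tau> i) w) = b i * Z i w" if "i < m" for i w
      using grid_less[OF g, of i "Suc i"] that by (simp add: Z_def b_def)
    have ip: "L2_ip h f = (\<Sum>i<m. C i * L2_ip (indicator {\<tau> i<..\<tau> (Suc i)}) f)"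
      unfolding h' by (rule L2_ip_sum) (auto intro: grid_indicator_L2[OF g] f)
    have nmh: "L2.nm h = sqrt (\<Sum>i<m. (b i)\<^sup>2)"
      using grid_sum_nm_sq[OF g, of C] hL unfolding h'[symmetric] b_def[symmetric]
      by (metis L2.nm_nonneg real_sqrt_unique)
    have "X (Y f w) - L2_ip h f = \<sigma> * (\<Sum>i<m. b i * Z i w)" for w
    proof -
      have "X (Y f w) = (\<Sum>i<m. C i * L2_ip (indicator {\<tau> i<..\<tau> (Suc i)}) f + \<sigma> * (b i * Z i w))"
        unfolding X' by (intro sum.cong refl, subst incr[OF g _ f])
          (auto simp: WZ[symmetric] algebra_simps)
      then show ?thesis by (simp add: ip sum.distrib sum_distrib_left)
    qed
    then have "X (Y f w) - L2_ip h f > z * \<sigma> * L2.nm h \<longleftrightarrow> (\<Sum>i<m. b i * Z i w) > z * L2.nm h" for w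
      using \<sigma> by (simp add: mult.commute[of z \<sigma>] mult.assoc)
    moreover have "{y \<in> space path_space. X y - L2_ip h f > z * \<sigma> * L2.nm h} \<in> sets path_space"
      using Xm by measurable
    ultimately have "measure (white_noise_law \<Omega> W n f) {y \<in> space path_space. X y - L2_ip h f > z * \<sigma> * L2.nm h}
      = prob {w \<in> space \<Omega>. (\<Sum>i<m. b i * Z i w) > z * L2.nm h}"
      by (simp add: mP)
    also have "\<dots> \<le> 1 - Phi z"
      unfolding nmh by (rule prob_gauss_sum_greater[OF _ Z(1) Z(2) z refl]) auto
    finally show "measure (white_noise_law \<Omega> W n f) {y \<in> space path_space. X y - L2_ip h f > z * \<sigma> * L2.nm h} \<le> 1 - Phi z" .
  next
    fix h X h' X' assume R: "(h, X) \<in> R" "(h', X') \<in> R"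
    obtain J c where J: "finite J" "J \<subseteq> unit_window" and hX: "h = step_fun J c" "X = step_statistic J c"
      using R by (auto simp: R_def)
    obtain J' c' where J': "finite J'" "J' \<subseteq> unit_window" and hX': "h' = step_fun J' c'" "X' = step_statistic J' c'"
      using R by (auto simp: R_def)
    have K: "finite (J \<union> J')" "J \<subseteq> J \<union> J'" "J' \<subseteq> J \<union> J'" "J \<union> J' \<subseteq> unit_window"
      using J J' by auto
    define d where "d t = 1 * (if t \<in> J then c t else 0) + (-1) * (if t \<in> J' then c' t else 0)" for t
    have "h - h' = step_fun (J \<union> J') d" "(\<lambda>y. X y - X' y) = step_statistic (J \<union> J') d"
      unfolding hX hX' step_extend[OF K(1,2), of c] step_extend[OF K(1,3), of c'] d_def[abs_def]
      by (simp_all only: fun_eq_iff step_lincomb[symmetric]) simp_all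
    then show "(h - h', \<lambda>y. X y - X' y) \<in> R" unfolding R_def using K by blast
  next
    fix h and e :: real assume h: "h \<in> L2_funs" and e: "0 < e"
    show "\<exists>h' X'. (h', X') \<in> R \<and> L2.nm (h' - h) < e"
      using step_approximable_L2[OF h] e unfolding step_approximable_def R_def by blast
  next
    fix f g z A
    assume fg: "f \<in> L2_funs" "g \<in> L2_funs" and z: "0 \<le> (z::real)" and d: "L2.nm (g - f) \<le> z * \<sigma>"
      and A: "A \<in> sets path_space" "Phi z \<le> measure (white_noise_law \<Omega> W n g) A"
    show "1/2 \<le> measure (white_noise_law \<Omega> W n f) A"
    proof (rule prob_ge_half_of_cylinders[OF P _ P])
      fix J X c
      assume J: "finite J" "J \<subseteq> unit_window" and X[measurable]: "X \<in> sets (\<Pi>\<^sub>M i\<in>J. (borel::real measure))"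
        and c: "Phi c \<le> measure (white_noise_law \<Omega> W n g) {y \<in> space (\<Pi>\<^sub>M i\<in>unit_window. borel). restrict y J \<in> X}"
      obtain m \<tau> where gr: "grid m \<tau>" and img: "\<tau> ` {..m} = insert (-1/2) J" by (rule grid_exists[OF J])
      define Z where "Z i w = (W (\<tau> (Suc i)) w - W (\<tau> i) w) / sqrt (\<tau> (Suc i) - \<tau> i)" for i w
      note Z = brownian_increments[OF bm gr, folded Z_def]
      define D where "D i = \<tau> (Suc i) - \<tau> i" for i
      have D: "0 < D i" if "i < m" for i using grid_less[OF gr, of i "Suc i"] that by (simp add: D_def)
      \<comment> \<open>The mean of the increment divided by \<open>\<sigma> * sqrt (D i)\<close>;
        its noise is then exactly \<open>Z i\<close>.\<close>
      define b where "b f i = L2_ip (indicator {\<tau> i<..\<tau> (Suc i)}) f / sqrt (D i) / \<sigma>" for f i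
      have "\<exists>j\<le>m. \<tau> j = t" if "t \<in> J" for t using img that by (metis atMost_iff imageE insertCI)
      then obtain idx where idx: "\<And>t. t \<in> J \<Longrightarrow> idx t \<le> m" "\<And>t. t \<in> J \<Longrightarrow> \<tau> (idx t) = t" by metis
      \<comment> \<open>Rebuilds the path at the times in \<open>J\<close>: as \<open>t\<close> is
        the grid point with index \<open>idx t\<close>, the value is the sum of the increments with
        indices below \<open>idx t\<close>, empty at time -1/2.\<close>
      define \<Psi> where "\<Psi> x = (\<lambda>t\<in>J. \<Sum>i<idx t. \<sigma> * sqrt (D i) * x i)" for x :: "nat \<Rightarrow> real"
      define X' where "X' = {x \<in> space (\<Pi>\<^sub>M i\<in>{..<m}. (borel::real measure)). \<Psi> x \<in> X}"
      have \<Psi>[measurable]: "\<Psi> \<in> measurable (\<Pi>\<^sub>M i\<in>{..<m}. borel) (\<Pi>\<^sub>M i\<in>J. borel)"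
        unfolding \<Psi>_def[abs_def]
      proof (intro measurable_restrict borel_measurable_sum borel_measurable_times borel_measurable_const)
        fix t i assume "t \<in> J" "i \<in> {..<idx t}"
        then have "i \<in> {..<m}" using idx(1)[of t] by auto
        then show "(\<lambda>x. x i) \<in> borel_measurable (\<Pi>\<^sub>M i\<in>{..<m}. (borel::real measure))" by measurable
      qed
      have X'[measurable]: "X' \<in> sets (\<Pi>\<^sub>M i\<in>{..<m}. borel)" unfolding X'_def by measurable
      \<comment> \<open>Only almost sure, because recovering values from increments relies on
        \<open>W (-1/2) w = 0\<close>, which holds almost everywhere.\<close>
      have path: "AE w in \<Omega>. restrict (Y f w) J = \<Psi> (\<lambda>i\<in>{..<m}. b f i + Z i w)" if f: "f \<in> L2_funs" for f
        using W0
      proof eventually_elim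
        case (elim w)
        show ?case
        proof (rule ext)
          fix t
          show "restrict (Y f w) J t = \<Psi> (\<lambda>i\<in>{..<m}. b f i + Z i w) t"
          proof (cases "t \<in> J")
            case True
            have "Y f w (\<tau> 0) = 0"
              using gr elim signal_start[OF f] Yt[of "\<tau> 0" f w] grid_window[OF gr, of 0]
              by (simp add: grid_def F_def)
            then have "Y f w t = (\<Sum>i<idx t. Y f w (\<tau> (Suc i)) - Y f w (\<tau> i))"
              using sum_lessThan_telescope[of "\<lambda>i. Y f w (\<tau> i)" "idx t"] idx(2)[OF True] by simp
            also have "\<dots> = (\<Sum>i<idx t. \<sigma> * sqrt (D i) * (\<lambda>i\<in>{..<m}. b f i + Z i w) i)"
            proof (intro sum.cong refl)
              fix i assume "i \<in> {..<idx t}"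
              then have i: "i < m" using idx(1)[OF True] by simp
              then show "Y f w (\<tau> (Suc i)) - Y f w (\<tau> i) = \<sigma> * sqrt (D i) * (\<lambda>i\<in>{..<m}. b f i + Z i w) i"
                unfolding incr[OF gr i f]
                using D[OF i] \<sigma> by (simp add: b_def Z_def distrib_left flip: D_def)
            qed
            finally show ?thesis using True by (simp add: \<Psi>_def)
          qed (simp add: \<Psi>_def)
        qed
      qed
      have Zm: "Z i \<in> borel_measurable \<Omega>" if "i \<in> {..<m}" for i
        using Z(2)[OF that] by (auto simp: distributed_def)
      have bZ[measurable]: "(\<lambda>w. \<lambda>i\<in>{..<m}. b f i + Z i w) \<in> measurable \<Omega> (\<Pi>\<^sub>M i\<in>{..<m}. borel)" for f
        by (intro measurable_restrict borel_measurable_add borel_measurable_const Zm)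
      have ev: "{y \<in> space path_space. restrict y J \<in> X} \<in> sets path_space"
        unfolding path_space_def by (rule cylinder_in_sets[OF J(2) X])
      have eq: "measure (white_noise_law \<Omega> W n f) {y \<in> space path_space. restrict y J \<in> X}
        = prob {w \<in> space \<Omega>. (\<lambda>i\<in>{..<m}. b f i + Z i w) \<in> X'}" if f: "f \<in> L2_funs" for f
      proof -
        have "{w \<in> space \<Omega>. restrict (Y f w) J \<in> X} = Y f -` {y \<in> space path_space. restrict y J \<in> X} \<inter> space \<Omega>"
          using measurable_space[OF Ym] by auto
        then have m1: "{w \<in> space \<Omega>. restrict (Y f w) J \<in> X} \<in> events"
          using measurable_sets[OF Ym ev, of f] by simp
        have m2: "{w \<in> space \<Omega>. (\<lambda>i\<in>{..<m}. b f i + Z i w) \<in> X'} \<in> events" by measurable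
        have "prob {w \<in> space \<Omega>. restrict (Y f w) J \<in> X} = prob {w \<in> space \<Omega>. (\<lambda>i\<in>{..<m}. b f i + Z i w) \<in> X'}"
        proof (rule finite_measure_eq_AE[OF _ m1 m2])
          show "AE w in \<Omega>. (w \<in> {w \<in> space \<Omega>. restrict (Y f w) J \<in> X}) =
              (w \<in> {w \<in> space \<Omega>. (\<lambda>i\<in>{..<m}. b f i + Z i w) \<in> X'})"
            using path[OF f] by eventually_elim (simp add: X'_def space_PiM)
        qed
        then show ?thesis using mP[OF ev, of f] by simp
      qed
      have "(\<Sum>i<m. (b f i - b g i)\<^sup>2) = (\<Sum>i<m. (L2_ip (indicator {\<tau> i<..\<tau> (Suc i)}) (g - f) / sqrt (D i))\<^sup>2) / \<sigma>\<^sup>2"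
        unfolding sum_divide_distrib
      proof (intro sum.cong refl)
        fix i assume "i \<in> {..<m}"
        then have "L2_ip (indicator {\<tau> i<..\<tau> (Suc i)}) (g - f)
          = L2_ip (indicator {\<tau> i<..\<tau> (Suc i)}) g - L2_ip (indicator {\<tau> i<..\<tau> (Suc i)}) f"
          using grid_indicator_L2[OF gr] fg by (simp add: L2.ip_diff_right)
        then show "(b f i - b g i)\<^sup>2 = (L2_ip (indicator {\<tau> i<..\<tau> (Suc i)}) (g - f) / sqrt (D i))\<^sup>2 / \<sigma>\<^sup>2"
          by (simp add: b_def power_divide power_mult_distrib power2_commute[of "L2_ip _ f"] flip: diff_divide_distrib)
      qed
      also have "\<dots> \<le> (L2.nm (g - f))\<^sup>2 / \<sigma>\<^sup>2"
        unfolding D_def using fg by (intro divide_right_mono grid_bessel[OF gr]) auto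
      also have "\<dots> \<le> (z * \<sigma>)\<^sup>2 / \<sigma>\<^sup>2"
        using d fg by (intro divide_right_mono power_mono) auto
      also have "\<dots> = z\<^sup>2" using \<sigma> by (simp add: power_mult_distrib)
      finally have "(\<Sum>i<m. (b f i - b g i)\<^sup>2) \<le> z\<^sup>2" .
      from gauss_shift_prob[OF finite_lessThan Z X' z this, of c]
      show "Phi (c - z) \<le> measure (white_noise_law \<Omega> W n f) {y \<in> space (\<Pi>\<^sub>M i\<in>unit_window. borel). restrict y J \<in> X}"
        using c unfolding path_space_def[symmetric] eq[OF fg(1)] eq[OF fg(2)] by blast
    qed (use A in \<open>simp_all add: law path_space_def\<close>)
  qed
  then show ?thesis unfolding \<sigma>_def R_def .
qed

theorem theorem4:
  fixes n k :: nat and \<alpha> :: real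
  assumes "n \<ge> 1" and "k \<ge> 1" and "0 < \<alpha>" and "\<alpha> < 1/2"
  shows
    "(\<forall>(\<Omega> :: 'w measure) W V T F.
        brownian_motion \<Omega> W \<and>
        V \<subseteq> L2_funs \<and> linear_functional_on V T \<and>
        (\<forall>j\<in>{1..k}. convex (F j) \<and> F j \<subseteq> V) \<and>
        (\<forall>i\<in>{1..k}. \<forall>j\<in>{1..k}. F i \<inter> F j \<noteq> {})
        \<longrightarrow>
        (let G = (\<Union>j\<in>{1..k}. F j);
             L = enn2ereal (minimax_length path_space (white_noise_law \<Omega> W n) T \<alpha> G)
         in ereal (1/2 - \<alpha>) * modulus L2_nrm T (normal_quantile \<alpha> / sqrt (real n)) G \<le> L \<and>
            L \<le> 12 * modulus L2_nrm T (normal_quantile (\<alpha> / (2 * real k)) / sqrt (real n)) G))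
     \<and>
     (\<forall>(M :: 'i set) V T F.
        countable M \<and>
        V \<subseteq> l2_seqs M \<and> linear_functional_on V T \<and>
        (\<forall>j\<in>{1..k}. convex (F j) \<and> F j \<subseteq> V) \<and>
        (\<forall>i\<in>{1..k}. \<forall>j\<in>{1..k}. F i \<inter> F j \<noteq> {})
        \<longrightarrow>
        (let G = (\<Union>j\<in>{1..k}. F j);
             L = enn2ereal (minimax_length (seq_space M) (gaussian_seq_law M n) T \<alpha> G)
         in ereal (1/2 - \<alpha>) * modulus (l2_nrm M) T (normal_quantile \<alpha> / sqrt (real n)) G \<le> L \<and>
            L \<le> 12 * modulus (l2_nrm M) T (normal_quantile (\<alpha> / (2 * real k)) / sqrt (real n)) G))"
proof (intro conjI allI impI)
  fix \<Omega> :: "'w measure" and W V T F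
  assume *: "brownian_motion \<Omega> W \<and>
        V \<subseteq> L2_funs \<and> linear_functional_on V T \<and>
        (\<forall>j\<in>{1..k}. convex (F j) \<and> F j \<subseteq> V) \<and>
        (\<forall>i\<in>{1..k}. \<forall>j\<in>{1..k}. F i \<inter> F j \<noteq> {})"
  then have bm: "brownian_motion \<Omega> W" by blast
  interpret E: gauss_experiment L2_funs L2_ip path_space "white_noise_law \<Omega> W n" "1 / sqrt (real n)"
    "{(step_fun J c, step_statistic J c) | J c. finite J \<and> J \<subseteq> unit_window}"
    by (rule gauss_experiment_white_noise[OF assms(1) bm])
  from * show "let G = (\<Union>j\<in>{1..k}. F j);
             L = enn2ereal (minimax_length path_space (white_noise_law \<Omega> W n) T \<alpha> G)
         in ereal (1/2 - \<alpha>) * modulus L2_nrm T (normal_quantile \<alpha> / sqrt (real n)) G \<le> L \<and>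
            L \<le> 12 * modulus L2_nrm T (normal_quantile (\<alpha> / (2 * real k)) / sqrt (real n)) G"
    using E.minimax_length_bounds[of V T k F \<alpha>] assms
    unfolding Let_def L2_nm_eq_L2_nrm times_divide_eq_right mult_1_right by blast
next
  fix M :: "'i set" and V T F
  assume *: "countable M \<and>
        V \<subseteq> l2_seqs M \<and> linear_functional_on V T \<and>
        (\<forall>j\<in>{1..k}. convex (F j) \<and> F j \<subseteq> V) \<and>
        (\<forall>i\<in>{1..k}. \<forall>j\<in>{1..k}. F i \<inter> F j \<noteq> {})"
  interpret E: gauss_experiment "l2_seqs M" "\<lambda>f g. \<Sum>\<^sub>\<infinity>i\<in>M. f i * g i" "seq_space M" "gaussian_seq_law M n"
    "1 / sqrt (real n)"
    "{(h, \<lambda>y. \<Sum>i\<in>J. h i * y i) | h J. finite J \<and> J \<subseteq> M \<and> (\<forall>i. i \<notin> J \<longrightarrow> h i = 0)}"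
    by (rule gauss_experiment_seq[OF assms(1)])
  have nm: "E.nm = l2_nrm M"
    by (simp add: fun_eq_iff E.nm_def l2_nrm_def power2_eq_square)
  from * show "let G = (\<Union>j\<in>{1..k}. F j);
             L = enn2ereal (minimax_length (seq_space M) (gaussian_seq_law M n) T \<alpha> G)
         in ereal (1/2 - \<alpha>) * modulus (l2_nrm M) T (normal_quantile \<alpha> / sqrt (real n)) G \<le> L \<and>
            L \<le> 12 * modulus (l2_nrm M) T (normal_quantile (\<alpha> / (2 * real k)) / sqrt (real n)) G"
    using E.minimax_length_bounds[of V T k F \<alpha>] assms
    unfolding Let_def nm times_divide_eq_right mult_1_right by blast
qed

end
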